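(* Consider the following two cases. (a) $(T(t))_{t\ge0}$ is a uniformly bounded $C_0$-semigroup on a Hilbert space with generator $A$ such that $i\mathbb{R}\subset\varrho(A)$ and $A$ is normal. (b) $\Omega$ is a locally compact Hausdorff space, $\mu$ is a $\sigma$-finite regular Borel measure on $\Omega$, and either (i) $X:=L^p(\Omega,\mu)$ for some $1\le p<\infty$ and $\phi:\Omega\to\mathbb{C}$ is measurable with essential range contained in the open left half-plane $\mathbb{C}_-$; or (ii) $X:=C_0(\Omega)$ and $\phi:\Omega\to\mathbb{C}$ is continuous with $\overline{\phi(\Omega)}\subset\mathbb{C}_-$. In case (b), $A$ is the multiplication operator induced by $\phi$ on $X$, i.e. $Af=\phi f$ with domain $D(A):=\{f\in X:\phi f\in X\}$, and $(T(t))_{t\ge0}$ is the $C_0$-semigroup on $X$ generated by $A$. In both cases (a) and (b), if $\|T(t)(-A)^{-\alpha}\|=O(1/t)$ as $t\to\infty$ for some $\alpha>0$, then the Cayley transform $A_d:=(I+A)(I-A)^{-1}$ satisfies $$\|A_d^n(-A)^{-\alpha-2}\| = O\left(\frac1n\right)\qquad (n\to\infty).$$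
   Context: All spaces are complex. $\varrho(A)$ is the resolvent set of $A$, $i\mathbb{R}=\{i\eta:\eta\in\mathbb{R}\}$, and $\mathbb{C}_-=\{\lambda\in\mathbb{C}:\mathrm{Re}\,\lambda<0\}$. A $C_0$-semigroup is uniformly bounded if $\sup_{t\ge0}\|T(t)\|<\infty$. $f(t)=O(g(t))$ as $t\to\infty$ means there are $M>0$ and $t_0$ with $f(t)\le M g(t)$ for all $t\ge t_0$ (similarly for sequences). When $A$ generates a uniformly bounded $C_0$-semigroup and $0\in\varrho(A)$, $-A$ is sectorial and invertible, and the fractional powers $(-A)^{a}$, $a\in\mathbb{R}$, are those of the functional calculus for sectorial operators. In particular, for $a>0$, $(-A)^{-a}$ is the bounded injective operator determined by $(-A)^{-a}=\frac{\sin \pi a}{\pi}\int_0^\infty s^{-a}(sI-A)^{-1}ds$ for $0<a<1$ and $(-A)^{-(k+a)}=((-A)^{-1})^k(-A)^{-a}$ for $k\in\mathbb{N}$, $0\le a<1$ (with $(-A)^0=I$), and $(-A)^{a}$ is its inverse. *)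

theory Defs
  imports "HOL-Analysis.Analysis" "HOL-Library.Landau_Symbols"
begin

section \<open>Complex Banach and Hilbert spaces\<close>

class complex_banach = banach +
  fixes scaleC :: "complex \<Rightarrow> 'a \<Rightarrow> 'a"  (infixr \<open>*\<^sub>C\<close> 75)
  assumes scaleC_add_right: "a *\<^sub>C (x + y) = a *\<^sub>C x + a *\<^sub>C y"
    and scaleC_add_left: "(a + b) *\<^sub>C x = a *\<^sub>C x + b *\<^sub>C x"
    and scaleC_scaleC: "a *\<^sub>C b *\<^sub>C x = (a * b) *\<^sub>C x"
    and scaleC_of_real: "complex_of_real r *\<^sub>C x = r *\<^sub>R x"
    and norm_scaleC: "norm (a *\<^sub>C x) = cmod a * norm x"

text \<open>The inner product is linear in its first argument.\<close>

class complex_hilbert = complex_banach +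
  fixes cinner :: "'a \<Rightarrow> 'a \<Rightarrow> complex"
  assumes cinner_commute: "cinner x y = cnj (cinner y x)"
    and cinner_add_left: "cinner (x + y) z = cinner x z + cinner y z"
    and cinner_scaleC_left: "cinner (a *\<^sub>C x) y = a * cinner x y"
    and cinner_self: "cinner x x = complex_of_real ((norm x)\<^sup>2)"

text \<open>
  Bounded operators are elements of the library type \<open>'x \<Rightarrow>\<^sub>L 'x\<close> of bounded real-linear maps;
  complex linearity is required separately. The operator norm does not depend on the scalar field.
\<close>

definition complex_linear :: "('x::complex_banach \<Rightarrow>\<^sub>L 'x) \<Rightarrow> bool" where
  "complex_linear L \<longleftrightarrow> (\<forall>c x. blinfun_apply L (c *\<^sub>C x) = c *\<^sub>C blinfun_apply L x)"

primrec blinfun_power :: "('x::real_normed_vector \<Rightarrow>\<^sub>L 'x) \<Rightarrow> nat \<Rightarrow> ('x \<Rightarrow>\<^sub>L 'x)" where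
  "blinfun_power L 0 = id_blinfun"
| "blinfun_power L (Suc n) = L o\<^sub>L blinfun_power L n"


section \<open>Unbounded operators\<close>

text \<open>
  An unbounded operator \<open>A\<close> is represented by its graph \<open>{(x, A x) | x \<in> D(A)}\<close>. Thus \<open>Domain A\<close>
  is its domain, \<open>A\<inverse>\<close> is its inverse, and \<open>A O B\<close> is the operator \<open>x \<mapsto> B (A x)\<close> with its
  natural domain.
\<close>

definition graph_of :: "('x::real_normed_vector \<Rightarrow>\<^sub>L 'x) \<Rightarrow> ('x \<times> 'x) set" where
  "graph_of L = {(x, blinfun_apply L x) | x. True}"

text \<open>The operator \<open>a I + b A\<close> with domain \<open>D(A)\<close>.\<close>

definition affine_op :: "complex \<Rightarrow> complex \<Rightarrow> ('x::complex_banach \<times> 'x) set \<Rightarrow> ('x \<times> 'x) set" where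
  "affine_op a b A = {(x, a *\<^sub>C x + b *\<^sub>C y) | x y. (x, y) \<in> A}"

definition resolvent_set :: "('x::complex_banach \<times> 'x) set \<Rightarrow> complex set" where
  "resolvent_set A =
     {z. \<exists>R. complex_linear R \<and> graph_of R = (affine_op z (-1) A)\<inverse>}"

text \<open>The operator \<open>(zI - A)\<^sup>-\<^sup>1\<close>; meaningful for \<open>z \<in> resolvent_set A\<close>.\<close>

definition resolvent :: "('x::complex_banach \<times> 'x) set \<Rightarrow> complex \<Rightarrow> ('x \<Rightarrow>\<^sub>L 'x)" where
  "resolvent A z = (THE R. graph_of R = (affine_op z (-1) A)\<inverse>)"

text \<open>The Cayley transform \<open>(I + A) (I - A)\<^sup>-\<^sup>1\<close>; meaningful for \<open>1 \<in> resolvent_set A\<close>.\<close>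

definition cayley :: "('x::complex_banach \<times> 'x) set \<Rightarrow> ('x \<Rightarrow>\<^sub>L 'x)" where
  "cayley A = (THE C. graph_of C = (affine_op 1 (-1) A)\<inverse> O affine_op 1 1 A)"

text \<open>
  The operator \<open>(-A)\<^sup>-\<^sup>a\<close> for \<open>a \<ge> 0\<close>; meaningful when \<open>A\<close> generates a uniformly bounded
  \<open>C\<^sub>0\<close>-semigroup and \<open>0 \<in> resolvent_set A\<close>. Note that \<open>resolvent A 0 = (-A)\<^sup>-\<^sup>1\<close>. The integral
  is taken in the Banach space of bounded operators.
\<close>

definition neg_inv_powr :: "('x::complex_banach \<times> 'x) set \<Rightarrow> real \<Rightarrow> ('x \<Rightarrow>\<^sub>L 'x)" where
  "neg_inv_powr A a =
     blinfun_power (resolvent A 0) (nat \<lfloor>a\<rfloor>) o\<^sub>L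
     (if frac a = 0 then id_blinfun
      else (sin (pi * frac a) / pi) *\<^sub>R
             integral {0<..} (\<lambda>s. (s powr (- frac a)) *\<^sub>R resolvent A (complex_of_real s)))"

definition adjoint_op :: "('x::complex_hilbert \<times> 'x) set \<Rightarrow> ('x \<times> 'x) set" where
  "adjoint_op A = {(y, z). \<forall>(x, w)\<in>A. cinner w y = cinner x z}"

definition normal_op :: "('x::complex_hilbert \<times> 'x) set \<Rightarrow> bool" where
  "normal_op A \<longleftrightarrow>
     closure (Domain A) = UNIV \<and> closed A \<and> A O adjoint_op A = adjoint_op A O A"


section \<open>Semigroups\<close>

definition C0_semigroup :: "(real \<Rightarrow> ('x::complex_banach \<Rightarrow>\<^sub>L 'x)) \<Rightarrow> bool" where
  "C0_semigroup T \<longleftrightarrow>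
     (\<forall>t\<ge>0. complex_linear (T t)) \<and>
     T 0 = id_blinfun \<and>
     (\<forall>s\<ge>0. \<forall>t\<ge>0. T (s + t) = T s o\<^sub>L T t) \<and>
     (\<forall>x. ((\<lambda>t. blinfun_apply (T t) x) \<longlongrightarrow> x) (at_right 0))"

definition generator :: "(real \<Rightarrow> ('x::complex_banach \<Rightarrow>\<^sub>L 'x)) \<Rightarrow> ('x \<times> 'x) set" where
  "generator T = {(x, y). ((\<lambda>t. (blinfun_apply (T t) x - x) /\<^sub>R t) \<longlongrightarrow> y) (at_right 0)}"

definition uniformly_bounded :: "(real \<Rightarrow> ('x::complex_banach \<Rightarrow>\<^sub>L 'x)) \<Rightarrow> bool" where
  "uniformly_bounded T \<longleftrightarrow> bounded (T ` {0..})"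


section \<open>The space \<open>L\<^sup>p(\<Omega>, \<mu>)\<close>\<close>

definition regular_borel_measure :: "'w::t2_space measure \<Rightarrow> bool" where
  "regular_borel_measure \<mu> \<longleftrightarrow>
     sets \<mu> = sets borel \<and>
     (\<forall>B\<in>sets \<mu>.
        emeasure \<mu> B = (INF U\<in>{U. open U \<and> B \<subseteq> U}. emeasure \<mu> U) \<and>
        emeasure \<mu> B = (SUP K\<in>{K. compact K \<and> K \<subseteq> B}. emeasure \<mu> K))"

definition essential_range :: "'w measure \<Rightarrow> ('w \<Rightarrow> complex) \<Rightarrow> complex set" where
  "essential_range \<mu> \<phi> = {z. \<forall>e>0. emeasure \<mu> {x \<in> space \<mu>. dist (\<phi> x) z < e} > 0}"

definition Lp_functions :: "'w measure \<Rightarrow> real \<Rightarrow> ('w \<Rightarrow> complex) set" where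
  "Lp_functions \<mu> p = {f \<in> borel_measurable \<mu>. integrable \<mu> (\<lambda>x. cmod (f x) powr p)}"

definition Lp_norm :: "'w measure \<Rightarrow> real \<Rightarrow> ('w \<Rightarrow> complex) \<Rightarrow> real" where
  "Lp_norm \<mu> p f = (\<integral>x. cmod (f x) powr p \<partial>\<mu>) powr (1 / p)"

text \<open>
  A type cannot depend on the values \<open>\<mu>\<close> and \<open>p\<close>. So \<open>L\<^sup>p(\<Omega>, \<mu>)\<close> is an arbitrary type \<open>'x\<close>
  together with the map \<open>J\<close> sending a function to its class: \<open>J\<close> is linear, onto, and
  carries the \<open>p\<close>-seminorm to the norm of \<open>'x\<close>. In particular \<open>J f = J g\<close> iff
  \<open>f = g\<close> almost everywhere, and \<open>'x\<close> is the quotient of \<open>Lp_functions \<mu> p\<close> modulo null functions.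
\<close>

definition is_Lp_space ::
    "'w measure \<Rightarrow> real \<Rightarrow> (('w \<Rightarrow> complex) \<Rightarrow> 'x::complex_banach) \<Rightarrow> bool" where
  "is_Lp_space \<mu> p J \<longleftrightarrow>
     (\<forall>f\<in>Lp_functions \<mu> p. \<forall>g\<in>Lp_functions \<mu> p. J (\<lambda>x. f x + g x) = J f + J g) \<and>
     (\<forall>c. \<forall>f\<in>Lp_functions \<mu> p. J (\<lambda>x. c * f x) = c *\<^sub>C J f) \<and>
     (\<forall>f\<in>Lp_functions \<mu> p. norm (J f) = Lp_norm \<mu> p f) \<and>
     J ` Lp_functions \<mu> p = UNIV"

definition Lp_mult_op ::
    "'w measure \<Rightarrow> real \<Rightarrow> (('w \<Rightarrow> complex) \<Rightarrow> 'x::complex_banach) \<Rightarrow> ('w \<Rightarrow> complex) \<Rightarrow> ('x \<times> 'x) set"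
  where
  "Lp_mult_op \<mu> p J \<phi> =
     {(J f, J (\<lambda>x. \<phi> x * f x)) | f. f \<in> Lp_functions \<mu> p \<and> (\<lambda>x. \<phi> x * f x) \<in> Lp_functions \<mu> p}"


section \<open>The space \<open>C\<^sub>0(\<Omega>)\<close>\<close>

typedef (overloaded) ('w::topological_space) c0 =
  "{f :: 'w \<Rightarrow> complex. continuous_on UNIV f \<and>
      (\<forall>e>0. \<exists>K. compact K \<and> (\<forall>x. x \<notin> K \<longrightarrow> cmod (f x) < e))}"
  morphisms c0_apply C0
  by (rule exI[of _ "\<lambda>_. 0"]) (auto intro: exI[of _ "{}"])

lemma c0_eqI: "(\<And>x. c0_apply f x = c0_apply g x) \<Longrightarrow> f = g"
  by (metis c0_apply_inject ext)

lemma c0_continuous: "continuous_on UNIV (c0_apply f)"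
  using c0_apply[of f] by simp

lemma c0_vanish: "e > 0 \<Longrightarrow> \<exists>K. compact K \<and> (\<forall>x. x \<notin> K \<longrightarrow> cmod (c0_apply f x) < e)"
  using c0_apply[of f] by simp

lemma c0_bounded: "bounded (range (c0_apply f))"
proof -
  obtain K where K: "compact K" "\<And>x. x \<notin> K \<Longrightarrow> cmod (c0_apply f x) < 1"
    using c0_vanish[of 1 f] by auto
  have "bounded (c0_apply f ` K)"
    by (intro compact_imp_bounded compact_continuous_image K(1)
        continuous_on_subset[OF c0_continuous]) auto
  then obtain b where b: "\<And>x. x \<in> K \<Longrightarrow> cmod (c0_apply f x) \<le> b"
    by (auto simp: bounded_iff)
  have "cmod (c0_apply f x) \<le> max b 1" for x
    using b[of x] K(2)[of x] by (cases "x \<in> K") auto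
  then show ?thesis by (auto simp: bounded_iff)
qed

lemma c0_memI:
  assumes "continuous_on UNIV f"
    and "\<And>e. e > 0 \<Longrightarrow> \<exists>K. compact K \<and> (\<forall>x. x \<notin> K \<longrightarrow> cmod (f x) < e)"
  shows "c0_apply (C0 f) = f"
  using assms by (intro C0_inverse) auto

lemma c0_lincomb_mem:
  "c0_apply (C0 (\<lambda>x. a * c0_apply f x + b * c0_apply g x)) =
     (\<lambda>x. a * c0_apply f x + b * c0_apply g x)"
proof (rule c0_memI)
  show "continuous_on UNIV (\<lambda>x. a * c0_apply f x + b * c0_apply g x)"
    by (intro continuous_intros c0_continuous)
next
  fix e :: real assume e: "e > 0"
  define d where "d = e / (2 * (cmod a + cmod b + 1))"
  have pos: "cmod a + cmod b + 1 > 0" by (simp add: add_nonneg_pos)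
  have d: "d > 0" unfolding d_def using e pos by simp
  obtain K L where K: "compact K" "\<And>x. x \<notin> K \<Longrightarrow> cmod (c0_apply f x) < d"
    and L: "compact L" "\<And>x. x \<notin> L \<Longrightarrow> cmod (c0_apply g x) < d"
    using c0_vanish[OF d] by metis
  have "cmod (a * c0_apply f x + b * c0_apply g x) < e" if "x \<notin> K \<union> L" for x
  proof -
    have "cmod (a * c0_apply f x + b * c0_apply g x)
        \<le> cmod a * cmod (c0_apply f x) + cmod b * cmod (c0_apply g x)"
      by (metis norm_mult norm_triangle_ineq)
    also have "\<dots> \<le> cmod a * d + cmod b * d"
      using that K(2)[of x] L(2)[of x] by (intro add_mono mult_left_mono) auto
    also have "\<dots> \<le> (cmod a + cmod b + 1) * d" using d by (simp add: algebra_simps)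
    also have "\<dots> = e / 2" unfolding d_def using pos by (simp add: field_simps)
    also have "\<dots> < e" using e by simp
    finally show ?thesis .
  qed
  then show "\<exists>K. compact K \<and> (\<forall>x. x \<notin> K \<longrightarrow> cmod (a * c0_apply f x + b * c0_apply g x) < e)"
    using K(1) L(1) compact_Un by blast
qed

instantiation c0 :: (topological_space) real_vector
begin

definition "(0 :: 'a c0) = C0 (\<lambda>_. 0)"
definition "f + g = C0 (\<lambda>x. c0_apply f x + c0_apply g x)"
definition "f - g = C0 (\<lambda>x. c0_apply f x - c0_apply g x)"
definition "- f = C0 (\<lambda>x. - c0_apply f x)"
definition "r *\<^sub>R f = C0 (\<lambda>x. r *\<^sub>R c0_apply f x)"
lemma c0_apply_simps:
  "c0_apply 0 x = 0"
  "c0_apply (f + g) x = c0_apply f x + c0_apply g x"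
  "c0_apply (f - g) x = c0_apply f x - c0_apply g x"
  "c0_apply (- f) x = - c0_apply f x"
  "c0_apply (r *\<^sub>R f) x = r *\<^sub>R c0_apply f x"
  using c0_lincomb_mem[of 0 f 0 f] c0_lincomb_mem[of 1 f 1 g] c0_lincomb_mem[of 1 f "-1" g]
    c0_lincomb_mem[of "-1" f 0 f] c0_lincomb_mem[of "of_real r" f 0 f]
  by (simp_all add: zero_c0_def plus_c0_def minus_c0_def uminus_c0_def scaleR_c0_def
      scaleR_conv_of_real)

instance
  by standard (rule c0_eqI; simp add: c0_apply_simps algebra_simps)+

end

instantiation c0 :: (topological_space) real_normed_vector
begin

definition norm_c0 :: "'a c0 \<Rightarrow> real" where "norm_c0 f = (SUP x. cmod (c0_apply f x))"
definition dist_c0 :: "'a c0 \<Rightarrow> 'a c0 \<Rightarrow> real" where "dist_c0 f g = norm (f - g)"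
definition sgn_c0 :: "'a c0 \<Rightarrow> 'a c0" where "sgn_c0 f = f /\<^sub>R norm f"
definition uniformity_c0 :: "('a c0 \<times> 'a c0) filter" where
  "uniformity_c0 = (INF e\<in>{0 <..}. principal {(x, y). dist x y < e})"
definition open_c0 :: "'a c0 set \<Rightarrow> bool" where
  "open_c0 S = (\<forall>x\<in>S. \<forall>\<^sub>F (x', y) in uniformity. x' = x \<longrightarrow> y \<in> S)"

lemma c0_norm_upper: "cmod (c0_apply f x) \<le> norm f"
proof -
  have "bdd_above (range (\<lambda>x. cmod (c0_apply f x)))"
    using c0_bounded[of f] by (auto simp: bounded_iff bdd_above_def)
  then show ?thesis unfolding norm_c0_def by (intro cSUP_upper) auto
qed

lemma c0_norm_least: "(\<And>x. cmod (c0_apply f x) \<le> b) \<Longrightarrow> norm f \<le> b"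
  unfolding norm_c0_def by (intro cSUP_least) auto

instance
proof
  fix f g :: "'a c0" and r :: real
  show "norm f = 0 \<longleftrightarrow> f = 0"
  proof
    assume "norm f = 0"
    then show "f = 0"
      using c0_norm_upper[of f] by (intro c0_eqI) (simp add: c0_apply_simps)
  next
    assume f: "f = 0"
    show "norm f = 0"
      using c0_norm_upper[of f undefined] c0_norm_least[of f 0]
      by (intro antisym) (auto simp: f c0_apply_simps)
  qed
  show "norm (f + g) \<le> norm f + norm g"
  proof (rule c0_norm_least)
    fix x
    show "cmod (c0_apply (f + g) x) \<le> norm f + norm g"
      unfolding c0_apply_simps
      by (intro norm_triangle_le add_mono c0_norm_upper)
  qed
  have le: "norm (s *\<^sub>R h) \<le> \<bar>s\<bar> * norm h" for s :: real and h :: "'a c0"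
    by (rule c0_norm_least) (simp add: c0_apply_simps mult_left_mono c0_norm_upper)
  show "norm (r *\<^sub>R f) = \<bar>r\<bar> * norm f"
  proof (cases "r = 0")
    case True
    have "norm (0 :: 'a c0) \<le> 0" by (rule c0_norm_least) (simp add: c0_apply_simps)
    moreover have "norm (0 :: 'a c0) \<ge> 0"
      using c0_norm_upper[of 0 undefined] by (simp add: c0_apply_simps)
    moreover have "0 *\<^sub>R f = 0" by (rule c0_eqI) (simp add: c0_apply_simps)
    ultimately show ?thesis using True by simp
  next
    case False
    have "f = inverse r *\<^sub>R (r *\<^sub>R f)"
      using False by (intro c0_eqI) (simp add: c0_apply_simps)
    then have "norm f \<le> \<bar>inverse r\<bar> * norm (r *\<^sub>R f)" using le by metis
    then have "\<bar>r\<bar> * norm f \<le> norm (r *\<^sub>R f)"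
      using False by (simp add: field_simps abs_inverse)
    with le[of r f] show ?thesis by simp
  qed
qed (rule dist_c0_def sgn_c0_def uniformity_c0_def open_c0_def)+

end

instantiation c0 :: (topological_space) complex_banach
begin

definition scaleC_c0 :: "complex \<Rightarrow> 'a c0 \<Rightarrow> 'a c0" where
  "scaleC_c0 c f = C0 (\<lambda>x. c * c0_apply f x)"

lemma c0_apply_scaleC: "c0_apply (c *\<^sub>C f) x = c * c0_apply f x"
  using c0_lincomb_mem[of c f 0 f] by (simp add: scaleC_c0_def)

instance
proof
  fix X :: "nat \<Rightarrow> 'a c0"
  assume X: "Cauchy X"
  have "uniformly_Cauchy_on UNIV (\<lambda>n. c0_apply (X n))"
    unfolding uniformly_Cauchy_on_def
  proof (intro allI impI)
    fix e :: real assume "e > 0"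
    then obtain M where M: "\<And>m n. m \<ge> M \<Longrightarrow> n \<ge> M \<Longrightarrow> dist (X m) (X n) < e"
      using X unfolding Cauchy_def by blast
    have "dist (c0_apply (X m) x) (c0_apply (X n) x) \<le> dist (X m) (X n)" for m n x
      using c0_norm_upper[of "X m - X n" x] by (simp add: dist_norm c0_apply_simps)
    then show "\<exists>M. \<forall>x\<in>UNIV. \<forall>m\<ge>M. \<forall>n\<ge>M. dist (c0_apply (X m) x) (c0_apply (X n) x) < e"
      using M by (meson le_less_trans)
  qed
  then obtain l where l: "uniform_limit UNIV (\<lambda>n. c0_apply (X n)) l sequentially"
    using Cauchy_uniformly_convergent uniformly_convergent_on_def by blast
  have l_app: "c0_apply (C0 l) = l"
  proof (rule c0_memI)
    show "continuous_on UNIV l"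
      by (rule uniform_limit_theorem[OF _ l]) (auto simp: c0_continuous)
  next
    fix e :: real assume "e > 0"
    then have e: "e / 2 > 0" by simp
    obtain n where n: "\<And>x. dist (c0_apply (X n) x) (l x) < e / 2"
      using uniform_limitD[OF l e] by (auto simp: eventually_sequentially)
    obtain K where K: "compact K" "\<And>x. x \<notin> K \<Longrightarrow> cmod (c0_apply (X n) x) < e / 2"
      using c0_vanish[OF e] by blast
    have "cmod (l x) < e" if "x \<notin> K" for x
      using n[of x] K(2)[OF that] norm_triangle_sub[of "l x" "c0_apply (X n) x"]
      by (simp add: dist_norm norm_minus_commute)
    then show "\<exists>K. compact K \<and> (\<forall>x. x \<notin> K \<longrightarrow> cmod (l x) < e)" using K(1) by blast
  qed
  have "X \<longlonglongrightarrow> C0 l"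
  proof (rule tendstoI)
    fix e :: real assume "e > 0"
    then have e: "e / 2 > 0" by simp
    from uniform_limitD[OF l e] show "\<forall>\<^sub>F n in sequentially. dist (X n) (C0 l) < e"
    proof eventually_elim
      case (elim n)
      have "norm (X n - C0 l) \<le> e / 2"
        using elim by (intro c0_norm_least) (auto simp: c0_apply_simps l_app dist_norm less_imp_le)
      then show ?case using \<open>e > 0\<close> by (simp add: dist_norm)
    qed
  qed
  then show "convergent X" by (rule convergentI)
next
  fix a :: complex and f :: "'a c0"
  have le: "norm (c *\<^sub>C h) \<le> cmod c * norm h" for c and h :: "'a c0"
    by (rule c0_norm_least) (simp add: c0_apply_scaleC norm_mult mult_left_mono c0_norm_upper)
  show "norm (a *\<^sub>C f) = cmod a * norm f"
  proof (cases "a = 0")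
    case True
    then show ?thesis using le[of a f] by simp
  next
    case False
    have "f = inverse a *\<^sub>C (a *\<^sub>C f)"
      using False by (intro c0_eqI) (simp add: c0_apply_scaleC)
    then have "norm f \<le> cmod (inverse a) * norm (a *\<^sub>C f)" using le by metis
    then have "cmod a * norm f \<le> norm (a *\<^sub>C f)"
      using False unfolding norm_inverse by (simp add: field_simps)
    with le[of a f] show ?thesis by simp
  qed
qed (rule c0_eqI; simp add: c0_apply_simps c0_apply_scaleC algebra_simps scaleR_conv_of_real)+

end

definition C0_mult_op :: "('w::topological_space \<Rightarrow> complex) \<Rightarrow> ('w c0 \<times> 'w c0) set" where
  "C0_mult_op \<phi> = {(f, g). \<forall>x. c0_apply g x = \<phi> x * c0_apply f x}"

end

theory Submission
  imports Defs
begin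

text \<open>
  Write \<open>B = (- A)\<^sup>-\<^sup>1\<close>, \<open>M = (- A)\<^sup>-\<^sup>\<alpha>\<close> and \<open>C = A\<^sub>d\<close>. As \<open>(- A)\<^sup>-\<^sup>(\<^sup>\<alpha>\<^sup>+\<^sup>2\<^sup>) = B\<^sup>2 M\<close>, the only property of \<open>M\<close> that is
  needed is that it commutes with everything that commutes with the resolvents of \<open>A\<close>. On the level of
  symbols, \<open>\<parallel>T(t) M\<parallel> \<le> c / t\<close> for large \<open>t\<close> amounts to \<open>\<bar>m(\<lambda>)\<bar> \<le> k \<bar>Re \<lambda>\<bar>\<close> on the spectrum (take \<open>t = 1 / \<bar>Re \<lambda>\<bar>\<close>),
  while \<open>\<bar>(1 + \<lambda>) / (1 - \<lambda>)\<bar>\<^sup>2 = 1 - 4 \<bar>Re \<lambda>\<bar> / \<bar>1 - \<lambda>\<bar>\<^sup>2\<close> bounds the \<open>n\<close>-th power of the symbol of \<open>C\<close> by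
  \<open>\<bar>1 - \<lambda>\<bar>\<^sup>2 / (2 n \<bar>Re \<lambda>\<bar>)\<close>; the product with \<open>\<bar>\<lambda>\<bar>\<^sup>-\<^sup>2\<close> is \<open>O(1 / n)\<close> since \<open>\<bar>\<lambda>\<bar>\<close> is bounded below.

  On \<open>C\<^sub>0(\<Omega>)\<close> this is a pointwise argument. On \<open>L\<^sup>p\<close> it is applied on countably many pieces of \<open>\<Omega>\<close> on
  which \<open>Re \<phi>\<close> is nearly constant; \<open>M\<close> commutes with the restrictions to the pieces. On a Hilbert space the
  spectral theorem is replaced by quadratic form inequalities for the commuting operators \<open>B\<close>, \<open>B\<^sup>*\<close>,
  \<open>T(t)\<close>, \<open>T(t)\<^sup>*\<close> and \<open>M\<close>, with \<open>Re B = (B + B\<^sup>*) / 2\<close> as the symbol \<open>\<bar>Re \<lambda>\<bar> / \<bar>\<lambda>\<bar>\<^sup>2\<close>.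
\<close>

section \<open>Semigroups, generators and resolvents\<close>

lemma uniform_boundedness:
  fixes L :: "nat \<Rightarrow> 'a::banach \<Rightarrow>\<^sub>L 'b::real_normed_vector"
  assumes "\<And>x. bounded (range (\<lambda>n. blinfun_apply (L n) x))"
  shows "bounded (range L)"
proof -
  define F where "F k = {x. \<forall>n. norm (blinfun_apply (L n) x) \<le> real k}" for k
  have cl: "closed (F k)" for k
  proof -
    have "F k = (\<Inter>n. {x. norm (blinfun_apply (L n) x) \<le> real k})" by (auto simp: F_def)
    moreover have "closed {x. norm (blinfun_apply (L n) x) \<le> real k}" for n
      by (intro closed_Collect_le continuous_intros)
    ultimately show ?thesis by auto
  qed
  have un: "\<Union> (range F) = UNIV"
  proof (intro equalityI subsetI UNIV_I)
    fix x :: 'a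
    obtain b where b: "\<And>n. norm (blinfun_apply (L n) x) \<le> b"
      using assms[of x] by (auto simp: bounded_iff)
    obtain k where "b \<le> real k" using real_arch_simple by blast
    then have "x \<in> F k" unfolding F_def using b order.trans by blast
    then show "x \<in> \<Union> (range F)" by blast
  qed
  \<comment> \<open>Baire: the closed sets \<open>F k\<close> cover the space, so they cannot all
    have empty interior.\<close>
  have "\<exists>k. interior (F k) \<noteq> {}"
  proof (rule ccontr)
    assume "\<not> ?thesis"
    then have "closedin euclidean S \<and> euclidean interior_of S = {}" if "S \<in> range F" for S
      using that cl by auto
    then have "euclidean interior_of \<Union> (range F) = {}"
      by (intro Baire_category_alt disjI1 completely_metrizable_space_euclidean) simp_all
    then show False using un by simp
  qed
  then obtain k a where "a \<in> interior (F k)" by blast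
  then obtain e where e: "e > 0" "ball a e \<subseteq> F k" by (auto simp: mem_interior)
  \<comment> \<open>The ball lies in \<open>F k\<close> but need not be centred at \<open>0\<close>;
    writing \<open>y\<close> as the difference of two of its points costs the factor
    \<open>2\<close>.\<close>
  have small: "norm (blinfun_apply (L n) y) \<le> 2 * real k" if "norm y < e" for n y
  proof -
    have "a + y \<in> ball a e" "a \<in> ball a e" using that e by (simp_all add: dist_norm)
    then have "a + y \<in> F k" "a \<in> F k" using e(2) by blast+
    then have "norm (blinfun_apply (L n) (a + y)) \<le> real k" "norm (blinfun_apply (L n) a) \<le> real k"
      by (auto simp: F_def)
    moreover have "blinfun_apply (L n) y = blinfun_apply (L n) (a + y) - blinfun_apply (L n) a"
      by (simp add: blinfun.add_right)
    ultimately show ?thesis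
      using norm_triangle_ineq4[of "blinfun_apply (L n) (a + y)" "blinfun_apply (L n) a"] by simp
  qed
  \<comment> \<open>Rescaling \<open>x\<close> to norm \<open>e / 2\<close> turns the bound
    \<open>2 * k\<close> into \<open>4 * k / e\<close>.\<close>
  have "norm (L n) \<le> 4 * real k / e" for n
  proof (rule norm_blinfun_bound)
    fix x :: 'a
    show "norm (blinfun_apply (L n) x) \<le> 4 * real k / e * norm x"
    proof (cases "x = 0")
      case False
      have "norm ((e / (2 * norm x)) *\<^sub>R x) < e" using False e by simp
      from small[OF this, of n] have "e / (2 * norm x) * norm (blinfun_apply (L n) x) \<le> 2 * real k"
        using e by (simp add: blinfun.scaleR_right)
      then show ?thesis using False e by (simp add: field_simps)
    qed simp
  qed (use e in auto)
  then show ?thesis by (auto simp: bounded_iff)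
qed

lemma norm_blinfun_le: "norm L \<le> K \<Longrightarrow> norm (blinfun_apply L x) \<le> K * norm x"
  by (rule order_trans[OF norm_blinfun mult_right_mono]) auto

text \<open>Reduces differentiation to algebra with difference quotients, for which the semigroup
  law supplies exact identities.\<close>

lemma has_vector_derivative_iff_tendsto:
  "(f has_vector_derivative d) (at t within S) \<longleftrightarrow>
     ((\<lambda>s. (f s - f t) /\<^sub>R (s - t)) \<longlongrightarrow> d) (at t within S)"
proof -
  have "(f has_vector_derivative d) (at t within S) \<longleftrightarrow>
     ((\<lambda>s. (1 / norm (s - t)) *\<^sub>R (f s - (f t + (s - t) *\<^sub>R d))) \<longlongrightarrow> 0) (at t within S)"
    by (simp add: has_vector_derivative_def has_derivative_within bounded_linear_scaleR_left)
  also have "\<dots> \<longleftrightarrow> ((\<lambda>s. norm ((1 / norm (s - t)) *\<^sub>R (f s - (f t + (s - t) *\<^sub>R d)))) \<longlongrightarrow> 0) (at t within S)"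
    by (rule tendsto_norm_zero_iff[symmetric])
  also have "\<dots> \<longleftrightarrow> ((\<lambda>s. norm ((f s - f t) /\<^sub>R (s - t) - d)) \<longlongrightarrow> 0) (at t within S)"
  proof (rule tendsto_cong)
    have "norm ((1 / norm (s - t)) *\<^sub>R (f s - (f t + (s - t) *\<^sub>R d)))
        = norm ((f s - f t) /\<^sub>R (s - t) - d)" if "s \<noteq> t" for s
    proof -
      have "(f s - f t) /\<^sub>R (s - t) - d = (1 / (s - t)) *\<^sub>R (f s - (f t + (s - t) *\<^sub>R d))"
        using that by (simp add: scaleR_diff_right scaleR_add_right inverse_eq_divide diff_diff_eq[symmetric])
      then show ?thesis by simp
    qed
    then show "\<forall>\<^sub>F s in at t within S. norm ((1 / norm (s - t)) *\<^sub>R (f s - (f t + (s - t) *\<^sub>R d)))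
        = norm ((f s - f t) /\<^sub>R (s - t) - d)"
      by (auto simp: eventually_at_filter)
  qed
  also have "\<dots> \<longleftrightarrow> ((\<lambda>s. (f s - f t) /\<^sub>R (s - t)) \<longlongrightarrow> d) (at t within S)"
    by (simp add: tendsto_norm_zero_iff Lim_null[of _ d, symmetric])
  finally show ?thesis .
qed

lemma tendsto_abs_diff_0: "((\<lambda>s. \<bar>s - t\<bar>) \<longlongrightarrow> 0) (at (t::real) within S)"
proof -
  have "((\<lambda>s. \<bar>s - t\<bar>) \<longlongrightarrow> \<bar>t - t\<bar>) (at t within S)" by (intro tendsto_intros)
  then show ?thesis by simp
qed

section \<open>Orbits of strongly continuous semigroups\<close>

context
  fixes T :: "real \<Rightarrow> 'x::complex_banach \<Rightarrow>\<^sub>L 'x"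
  assumes T: "C0_semigroup T"
begin

lemma semigroup_0: "T 0 = id_blinfun"
  using T by (simp add: C0_semigroup_def)

lemma semigroup_add: "s \<ge> 0 \<Longrightarrow> t \<ge> 0 \<Longrightarrow> T (s + t) x = T s (T t x)"
  using T by (simp add: C0_semigroup_def)

lemma semigroup_tendsto_0: "((\<lambda>t. T t x) \<longlongrightarrow> x) (at 0 within {0..})"
proof -
  have "((\<lambda>t. T t x) \<longlongrightarrow> x) (at_right 0)" using T by (simp add: C0_semigroup_def)
  moreover have "{0..} - {0} = {0::real<..} - {0}" by auto
  then have "at (0::real) within {0..} = at_right 0" by (simp add: at_within_def)
  ultimately show ?thesis by simp
qed

text \<open>If the norms were unbounded on every interval \<open>[0, d]\<close>, some
  \<open>s n\<close> tending to \<open>0\<close> would have \<open>norm (T (s n)) > n\<close>,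
  although \<open>T (s n) x\<close> converges for each \<open>x\<close>; this contradicts uniform
  boundedness. The bound near \<open>0\<close> spreads to \<open>[0, b]\<close> through
  \<open>T s = T d o T (s - d)\<close>.\<close>

lemma semigroup_locally_bounded:
  obtains M where "M > 0" "\<And>s. 0 \<le> s \<Longrightarrow> s \<le> b \<Longrightarrow> norm (T s) \<le> M"
proof -
  have "\<exists>d>0. \<exists>M. \<forall>s. 0 \<le> s \<and> s \<le> d \<longrightarrow> norm (T s) \<le> M"
  proof (rule ccontr)
    assume "\<not> ?thesis"
    then have "\<exists>s. 0 \<le> s \<and> s \<le> d \<and> norm (T s) > M" if "d > 0" for d M
      using that by (auto simp: not_le)
    then have "\<exists>s. 0 \<le> s \<and> s \<le> inverse (real (Suc n)) \<and> norm (T s) > real n" for n by simp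
    then obtain s where s: "\<And>n. 0 \<le> s n" "\<And>n. s n \<le> inverse (real (Suc n))" "\<And>n. norm (T (s n)) > real n"
      by metis
    have s0: "s \<longlonglongrightarrow> 0"
      by (rule tendsto_sandwich[OF _ _ tendsto_const LIMSEQ_inverse_real_of_nat]) (use s in auto)
    have "bounded (range (\<lambda>n. T (s n)))"
    proof (rule uniform_boundedness)
      fix x
      have "((\<lambda>t. T t x) \<longlongrightarrow> T 0 x) (at 0 within {0..})"
        using semigroup_tendsto_0 by (simp add: semigroup_0)
      then have "(\<lambda>n. T (s n) x) \<longlonglongrightarrow> T 0 x"
        using continuous_within_tendsto_compose[of 0 "{0..}" "\<lambda>t. T t x" s sequentially] s0 s(1)
        by (simp add: continuous_within)
      then show "bounded (range (\<lambda>n. T (s n) x))" by (rule convergent_imp_bounded)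
    qed
    then obtain B where "\<And>n. norm (T (s n)) \<le> B" by (auto simp: bounded_iff)
    moreover obtain n where "B < real n" using reals_Archimedean2 by blast
    ultimately show False using s(3)[of n] by (meson less_le_trans not_less order.asym)
  qed
  then obtain d M where d: "d > 0" and M: "\<And>s. 0 \<le> s \<Longrightarrow> s \<le> d \<Longrightarrow> norm (T s) \<le> M" by blast
  have M0: "M \<ge> 0" using M[of 0] d by (smt (verit) norm_ge_zero)
  have *: "\<exists>K. \<forall>s. 0 \<le> s \<and> s \<le> real n * d \<longrightarrow> norm (T s) \<le> K" for n
  proof (induction n)
    case 0
    show ?case by (rule exI[of _ "norm (T 0)"]) auto
  next
    case (Suc n)
    then obtain K where K: "\<And>s. 0 \<le> s \<Longrightarrow> s \<le> real n * d \<Longrightarrow> norm (T s) \<le> K" by blast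
    have "norm (T s) \<le> max M (M * K)" if s: "0 \<le> s" "s \<le> real (Suc n) * d" for s
    proof (cases "s \<le> d")
      case False
      have "T s = T d o\<^sub>L T (s - d)"
        by (rule blinfun_eqI) (use False d semigroup_add[of d "s - d"] in simp)
      then have "norm (T s) \<le> norm (T d) * norm (T (s - d))" by (metis norm_blinfun_compose)
      also have "\<dots> \<le> M * K"
        by (rule mult_mono) (use False d s M[of d] K[of "s - d"] M0 in \<open>auto simp: algebra_simps\<close>)
      finally show ?thesis by simp
    next
      case True
      then show ?thesis using M[of s] s by simp
    qed
    then show ?case by blast
  qed
  obtain n where "b \<le> real n * d" using d reals_Archimedean3 less_imp_le by blast
  with * obtain K where "\<And>s. 0 \<le> s \<Longrightarrow> s \<le> b \<Longrightarrow> norm (T s) \<le> K" by (meson order_trans)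
  then have "norm (T s) \<le> max K 1" if "0 \<le> s" "s \<le> b" for s
    using that by (meson max.coboundedI1)
  then show thesis using that[of "max K 1"] by simp
qed

text \<open>Factoring out the operator at the smaller time treats left and right limits at once;
  only the increment \<open>|s - t|\<close> from time \<open>0\<close> remains.\<close>

lemma semigroup_split:
  assumes "0 \<le> s" "0 \<le> t"
  shows "norm (T s x - T t x) = norm (T (min s t) (T \<bar>s - t\<bar> x - x))"
  using assms semigroup_add[of t "s - t" x] semigroup_add[of s "t - s" x]
  by (cases "s \<le> t") (auto simp: blinfun.diff_right norm_minus_commute)

lemma semigroup_continuous:
  assumes "t \<ge> 0"
  shows "((\<lambda>s. T s x) \<longlongrightarrow> T t x) (at t within {0..})"
proof -
  obtain M where M: "M > 0" "\<And>s. 0 \<le> s \<Longrightarrow> s \<le> t \<Longrightarrow> norm (T s) \<le> M"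
    using semigroup_locally_bounded[of t] by blast
  have "((\<lambda>s. T \<bar>s - t\<bar> x) \<longlongrightarrow> T 0 x) (at t within {0..})"
    using continuous_within_tendsto_compose[of 0 "{0..}" "\<lambda>t. T t x" "\<lambda>s. \<bar>s - t\<bar>" "at t within {0..}"]
      tendsto_abs_diff_0 semigroup_tendsto_0
    by (simp add: continuous_within semigroup_0)
  then have "((\<lambda>s. M * norm (T \<bar>s - t\<bar> x - x)) \<longlongrightarrow> M * norm (T 0 x - x)) (at t within {0..})"
    by (intro tendsto_mult tendsto_norm tendsto_diff tendsto_const)
  then have lim: "((\<lambda>s. M * norm (T \<bar>s - t\<bar> x - x)) \<longlongrightarrow> 0) (at t within {0..})"
    by (simp add: semigroup_0)
  have "\<forall>\<^sub>F s in at t within {0..}. norm (T s x - T t x) \<le> M * norm (T \<bar>s - t\<bar> x - x)"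
    unfolding eventually_at_filter
  proof (intro always_eventually allI impI)
    fix s :: real assume "s \<in> {0..}"
    then have "norm (T s x - T t x) \<le> norm (T (min s t)) * norm (T \<bar>s - t\<bar> x - x)"
      using assms norm_blinfun by (simp add: semigroup_split)
    also have "\<dots> \<le> M * norm (T \<bar>s - t\<bar> x - x)"
      using \<open>s \<in> {0..}\<close> assms by (intro mult_right_mono M) auto
    finally show "norm (T s x - T t x) \<le> M * norm (T \<bar>s - t\<bar> x - x)" .
  qed
  from Lim_null_comparison[OF this lim] show ?thesis by (rule LIM_zero_cancel)
qed

text \<open>Joint continuity: strong continuity handles the moving time for a fixed vector, local
  boundedness the moving vector.\<close>

lemma semigroup_tendsto_compose:
  assumes f: "(f \<longlongrightarrow> l) F" and m: "(m \<longlongrightarrow> t) F" and m0: "\<forall>\<^sub>F r in F. m r \<ge> 0" and t: "t \<ge> 0"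
  shows "((\<lambda>r. T (m r) (f r)) \<longlongrightarrow> T t l) F"
proof -
  obtain M where M: "M > 0" "\<And>s. 0 \<le> s \<Longrightarrow> s \<le> t + 1 \<Longrightarrow> norm (T s) \<le> M"
    using semigroup_locally_bounded[of "t + 1"] by blast
  have ev: "\<forall>\<^sub>F r in F. m r < t + 1" using order_tendstoD(2)[OF m] by simp
  have "\<forall>\<^sub>F r in F. norm (T (m r) (f r - l)) \<le> M * norm (f r - l)"
    using ev m0
  proof eventually_elim
    case (elim r)
    have "norm (T (m r) (f r - l)) \<le> norm (T (m r)) * norm (f r - l)" by (rule norm_blinfun)
    also have "\<dots> \<le> M * norm (f r - l)" using elim by (intro mult_right_mono M) auto
    finally show ?case .
  qed
  moreover have "((\<lambda>r. M * norm (f r - l)) \<longlongrightarrow> 0) F"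
    using tendsto_mult_right_zero[OF tendsto_norm_zero[OF LIM_zero[OF f]]] .
  ultimately have 1: "((\<lambda>r. T (m r) (f r - l)) \<longlongrightarrow> 0) F" by (rule Lim_null_comparison)
  have 2: "((\<lambda>r. T (m r) l) \<longlongrightarrow> T t l) F"
    using continuous_within_tendsto_compose[of t "{0..}" "\<lambda>t. T t l" m F] m m0
      semigroup_continuous[OF t] by (simp add: continuous_within)
  have "((\<lambda>r. T (m r) (f r - l) + T (m r) l) \<longlongrightarrow> 0 + T t l) F" by (intro tendsto_intros 1 2)
  then show ?thesis by (simp add: blinfun.diff_right)
qed

text \<open>The generator only gives the right derivative at \<open>0\<close>. For \<open>s\<close>
  on either side of \<open>t\<close> the quotient at \<open>t\<close> is \<open>T (min s t)\<close>
  applied to the quotient at \<open>0\<close> with increment \<open>|s - t|\<close>, so joint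
  continuity gives the limit.\<close>

lemma semigroup_has_vector_derivative:
  assumes "(x, y) \<in> generator T" "t \<ge> 0"
  shows "((\<lambda>s. T s x) has_vector_derivative T t y) (at t within {0..})"
proof -
  have D: "((\<lambda>h. (T h x - x) /\<^sub>R h) \<longlongrightarrow> y) (at_right 0)" using assms by (simp add: generator_def)
  have "filterlim (\<lambda>s. \<bar>s - t\<bar>) (at_right 0) (at t within {0..})"
    unfolding filterlim_at using tendsto_abs_diff_0[of t "{0..}"]
    by (auto simp: eventually_at_filter)
  from filterlim_compose[OF D this]
  have "((\<lambda>s. (T \<bar>s - t\<bar> x - x) /\<^sub>R \<bar>s - t\<bar>) \<longlongrightarrow> y) (at t within {0..})" .
  moreover have "((\<lambda>s. min s t) \<longlongrightarrow> min t t) (at t within {0..})" by (intro tendsto_intros)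
  ultimately have "((\<lambda>s. T (min s t) ((T \<bar>s - t\<bar> x - x) /\<^sub>R \<bar>s - t\<bar>)) \<longlongrightarrow> T t y) (at t within {0..})"
    using assms(2) by (intro semigroup_tendsto_compose) (auto simp: eventually_at_filter)
  moreover have "T (min s t) ((T \<bar>s - t\<bar> x - x) /\<^sub>R \<bar>s - t\<bar>) = (T s x - T t x) /\<^sub>R (s - t)"
    if "0 \<le> s" "s \<noteq> t" for s
  proof (cases "s < t")
    case True
    then have "T t x = T s (T (t - s) x)" using semigroup_add[of s "t - s" x] that by simp
    moreover have "inverse (s - t) = - inverse (t - s)"
      by (metis inverse_minus_eq minus_diff_eq)
    ultimately show ?thesis using True
      by (simp add: blinfun.scaleR_right blinfun.diff_right algebra_simps)
  next
    case False
    then have "T s x = T t (T (s - t) x)" using semigroup_add[of t "s - t" x] that assms(2) by simp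
    then show ?thesis using False by (simp add: blinfun.scaleR_right blinfun.diff_right)
  qed
  then have "\<forall>\<^sub>F s in at t within {0..}. T (min s t) ((T \<bar>s - t\<bar> x - x) /\<^sub>R \<bar>s - t\<bar>) = (T s x - T t x) /\<^sub>R (s - t)"
    by (auto simp: eventually_at_filter)
  ultimately show ?thesis
    unfolding has_vector_derivative_iff_tendsto by (rule Lim_transform_eventually)
qed

lemma generator_semigroup:
  assumes "(x, y) \<in> generator T" "t \<ge> 0"
  shows "(T t x, T t y) \<in> generator T"
proof -
  have "((\<lambda>h. (T h x - x) /\<^sub>R h) \<longlongrightarrow> y) (at_right 0)" using assms by (simp add: generator_def)
  then have "((\<lambda>h. T t ((T h x - x) /\<^sub>R h)) \<longlongrightarrow> T t y) (at_right 0)"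
    by (intro tendsto_intros)
  moreover have "T t ((T h x - x) /\<^sub>R h) = (T h (T t x) - T t x) /\<^sub>R h" if "h > 0" for h
    using that assms semigroup_add[of t h x] semigroup_add[of h t x]
    by (simp add: blinfun.scaleR_right blinfun.diff_right add.commute)
  then have "\<forall>\<^sub>F h in at_right 0. T t ((T h x - x) /\<^sub>R h) = (T h (T t x) - T t x) /\<^sub>R h"
    by (auto simp: eventually_at_filter)
  ultimately have "((\<lambda>h. (T h (T t x) - T t x) /\<^sub>R h) \<longlongrightarrow> T t y) (at_right 0)"
    by (rule Lim_transform_eventually)
  then show ?thesis by (simp add: generator_def)
qed

lemma generator_single_valued: "(x, y) \<in> generator T \<Longrightarrow> (x, z) \<in> generator T \<Longrightarrow> y = z"
  by (auto simp: generator_def intro: tendsto_unique[OF trivial_limit_at_right_real])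

text \<open>The map \<open>s \<mapsto> T (t - s) (v s)\<close> has derivative zero.\<close>

lemma cauchy_problem_unique:
  assumes t: "t \<ge> 0"
    and v: "\<And>s. s \<ge> 0 \<Longrightarrow> (v has_vector_derivative w s) (at s within {0..})"
    and gen: "\<And>s. s \<ge> 0 \<Longrightarrow> (v s, w s) \<in> generator T"
  shows "v t = T t (v 0)"
proof -
  define g where "g s = T (t - s) (v s)" for s
  have "(g has_vector_derivative 0) (at s within {0..t})" if s: "s \<in> {0..t}" for s
  proof -
    have v': "((\<lambda>r. (v r - v s) /\<^sub>R (r - s)) \<longlongrightarrow> w s) (at s within {0..t})"
      using has_vector_derivative_within_subset[OF v, of s "{0..t}"] s
      by (auto simp: has_vector_derivative_iff_tendsto)
    have m: "((\<lambda>r. t - r) \<longlongrightarrow> t - s) (at s within {0..t})" by (intro tendsto_intros)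
    have 1: "((\<lambda>r. T (t - r) ((v r - v s) /\<^sub>R (r - s))) \<longlongrightarrow> T (t - s) (w s)) (at s within {0..t})"
      using s by (intro semigroup_tendsto_compose v' m) (auto simp: eventually_at_filter)
    have "((\<lambda>r. T r (v s)) has_vector_derivative T (t - s) (w s)) (at (t - s) within {0..})"
      using semigroup_has_vector_derivative[OF gen] s by simp
    then have "((\<lambda>r. T r (v s)) has_vector_derivative T (t - s) (w s))
        (at (t - s) within (\<lambda>r. t - r) ` {0..t})"
      by (rule has_vector_derivative_within_subset) (simp add: image_subset_iff)
    moreover have "((\<lambda>r. t - r) has_vector_derivative (- 1)) (at s within {0..t})"
      by (auto intro!: derivative_eq_intros)
    ultimately have "(((\<lambda>r. T r (v s)) \<circ> (\<lambda>r. t - r)) has_vector_derivative (- 1) *\<^sub>R T (t - s) (w s))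
        (at s within {0..t})"
      by (intro vector_diff_chain_within)
    then have 2: "((\<lambda>r. (T (t - r) (v s) - T (t - s) (v s)) /\<^sub>R (r - s)) \<longlongrightarrow> - T (t - s) (w s))
        (at s within {0..t})"
      by (simp add: has_vector_derivative_iff_tendsto)
    \<comment> \<open>Product rule by hand: the quotient of \<open>g\<close> splits into the change
      of \<open>v\<close> and the change of the semigroup, whose limits cancel.\<close>
    have "((\<lambda>r. T (t - r) ((v r - v s) /\<^sub>R (r - s)) + (T (t - r) (v s) - T (t - s) (v s)) /\<^sub>R (r - s))
        \<longlongrightarrow> T (t - s) (w s) + - T (t - s) (w s)) (at s within {0..t})"
      by (intro tendsto_add 1 2)
    then show ?thesis
      unfolding has_vector_derivative_iff_tendsto g_def
      by (simp add: blinfun.scaleR_right blinfun.diff_right algebra_simps)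
  qed
  then obtain c where "\<And>s. s \<in> {0..t} \<Longrightarrow> g s = c"
    using has_vector_derivative_zero_constant[of "{0..t}" g] by blast
  then have "g t = g 0" using t by simp
  then show ?thesis by (simp add: g_def semigroup_0)
qed

end

section \<open>Resolvents and the Cayley transform as graphs\<close>

lemma scaleC_minus_one: "(- 1) *\<^sub>C (x::'x::complex_banach) = - x"
  using scaleC_of_real[of "-1" x] by simp

lemma scaleC_one: "1 *\<^sub>C (x::'x::complex_banach) = x"
  using scaleC_of_real[of 1 x] by simp

lemma scaleC_zero: "0 *\<^sub>C (x::'x::complex_banach) = 0"
  using scaleC_of_real[of 0 x] by simp

lemma graph_of_inject: "graph_of L = graph_of L' \<longleftrightarrow> L = L'"
  by (auto simp: graph_of_def set_eq_iff intro: blinfun_eqI)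

lemma resolvent_eqI: "graph_of R = (affine_op z (-1) A)\<inverse> \<Longrightarrow> resolvent A z = R"
  unfolding resolvent_def by (rule the_equality) (auto intro: iffD1[OF graph_of_inject])

lemma graph_resolvent:
  assumes "z \<in> resolvent_set A"
  shows "complex_linear (resolvent A z)" "graph_of (resolvent A z) = (affine_op z (-1) A)\<inverse>"
  using assms resolvent_eqI unfolding resolvent_set_def by auto

lemma resolvent_apply:
  assumes "z \<in> resolvent_set A" "(x, y) \<in> A"
  shows "resolvent A z (z *\<^sub>C x - y) = x"
proof -
  have "(z *\<^sub>C x - y, x) \<in> (affine_op z (-1) A)\<inverse>"
    using assms(2) by (force simp: affine_op_def scaleC_minus_one)
  then have "(z *\<^sub>C x - y, x) \<in> graph_of (resolvent A z)"
    using graph_resolvent(2)[OF assms(1)] by simp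
  then show ?thesis by (simp add: graph_of_def)
qed

lemma resolvent_range:
  assumes "z \<in> resolvent_set A"
  shows "(resolvent A z u, z *\<^sub>C resolvent A z u - u) \<in> A"
proof -
  have "(u, resolvent A z u) \<in> (affine_op z (-1) A)\<inverse>"
    using graph_resolvent(2)[OF assms] by (force simp: graph_of_def)
  then obtain y where y: "(resolvent A z u, y) \<in> A" "u = z *\<^sub>C resolvent A z u - y"
    by (auto simp: affine_op_def scaleC_minus_one)
  have "y = z *\<^sub>C resolvent A z u - u" by (subst (2) y(2)) simp
  then show ?thesis using y(1) by simp
qed

lemma resolventI:
  assumes "complex_linear R" "\<And>x y. (x, y) \<in> A \<Longrightarrow> R (z *\<^sub>C x - y) = x"
    "\<And>u. (R u, z *\<^sub>C R u - u) \<in> A"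
  shows "z \<in> resolvent_set A" "resolvent A z = R"
proof -
  have "graph_of R = (affine_op z (-1) A)\<inverse>"
  proof (rule set_eqI, clarify)
    fix u x
    have "(u, x) \<in> (affine_op z (-1) A)\<inverse> \<longleftrightarrow> (\<exists>y. u = z *\<^sub>C x - y \<and> (x, y) \<in> A)"
      by (auto simp: affine_op_def scaleC_minus_one)
    also have "\<dots> \<longleftrightarrow> x = R u"
      using assms(2) assms(3)[of u] by force
    also have "\<dots> \<longleftrightarrow> (u, x) \<in> graph_of R" by (auto simp: graph_of_def)
    finally show "(u, x) \<in> graph_of R \<longleftrightarrow> (u, x) \<in> (affine_op z (-1) A)\<inverse>" ..
  qed
  then show "z \<in> resolvent_set A" "resolvent A z = R"
    using assms(1) resolvent_eqI by (auto simp: resolvent_set_def)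
qed

text \<open>If \<open>x = R u\<close> with \<open>R\<close> the resolvent at \<open>1\<close>, then
  \<open>A x = x - u\<close>, so \<open>(I + A) x = 2 x - u\<close>. As \<open>A\<close> is a
  relation, single-valuedness makes the composite a graph.\<close>

lemma cayley_eq:
  assumes "1 \<in> resolvent_set A" and sv: "\<And>x y y'. (x, y) \<in> A \<Longrightarrow> (x, y') \<in> A \<Longrightarrow> y = y'"
  shows "cayley A = 2 *\<^sub>R resolvent A 1 - id_blinfun"
  unfolding cayley_def
proof (rule the_equality)
  let ?R = "resolvent A 1"
  show *: "graph_of (2 *\<^sub>R ?R - id_blinfun) = (affine_op 1 (- 1) A)\<inverse> O affine_op 1 1 A"
  proof (rule set_eqI, clarify)
    fix u w
    have A: "(?R u, ?R u - u) \<in> A" using resolvent_range[OF assms(1), of u] by (simp add: scaleC_one)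
    have "(u, w) \<in> (affine_op 1 (- 1) A)\<inverse> O affine_op 1 1 A \<longleftrightarrow> (?R u, w) \<in> affine_op 1 1 A"
      unfolding graph_resolvent(2)[OF assms(1), symmetric] by (auto simp: graph_of_def)
    also have "\<dots> \<longleftrightarrow> (\<exists>y. (?R u, y) \<in> A \<and> w = ?R u + y)"
      by (auto simp: affine_op_def scaleC_one)
    also have "\<dots> \<longleftrightarrow> w = 2 *\<^sub>R ?R u - u"
      using A sv[OF A] by (auto simp: scaleR_2 algebra_simps)
    also have "\<dots> \<longleftrightarrow> (u, w) \<in> graph_of (2 *\<^sub>R ?R - id_blinfun)"
      by (auto simp: graph_of_def blinfun.diff_left blinfun.scaleR_left)
    finally show "(u, w) \<in> graph_of (2 *\<^sub>R ?R - id_blinfun) \<longleftrightarrow>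
        (u, w) \<in> (affine_op 1 (- 1) A)\<inverse> O affine_op 1 1 A" ..
  qed
  show "C = 2 *\<^sub>R ?R - id_blinfun" if "graph_of C = (affine_op 1 (- 1) A)\<inverse> O affine_op 1 1 A" for C
    using that * graph_of_inject by metis
qed

section \<open>Operators commuting with the resolvent\<close>

lemma resolvent_commute_semigroup:
  assumes T: "C0_semigroup T" and 0: "0 \<in> resolvent_set (generator T)" and t: "t \<ge> 0"
  shows "resolvent (generator T) 0 (T t x) = T t (resolvent (generator T) 0 x)"
proof -
  have "(T t (resolvent (generator T) 0 x), - T t x) \<in> generator T"
    using generator_semigroup[OF T resolvent_range[OF 0] t, of x]
    by (simp add: scaleC_zero blinfun.minus_right)
  from resolvent_apply[OF 0 this] show ?thesis by (simp add: scaleC_zero)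
qed

text \<open>\<open>t \<mapsto> S T(t) x\<close> and \<open>t \<mapsto> T(t) S x\<close> solve the same Cauchy problem for \<open>x\<close> in the domain.\<close>

lemma commute_resolvent_semigroup:
  assumes T: "C0_semigroup T" and 0: "0 \<in> resolvent_set (generator T)" and t: "t \<ge> 0"
    and S: "\<And>x. blinfun_apply S (resolvent (generator T) 0 x) = resolvent (generator T) 0 (S x)"
  shows "S (T t x) = T t (S x)"
proof -
  let ?B = "resolvent (generator T) 0"
  have B: "(?B u, - u) \<in> generator T" for u
    using resolvent_range[OF 0, of u] by (simp add: scaleC_zero)
  have inj: "u = u'" if "?B u = ?B u'" for u u'
    using generator_single_valued[OF T, of "?B u" "- u" "- u'"] B[of u] B[of u'] that by simp
  \<comment> \<open>First for vectors in the range of \<open>B\<close>, that is in the domain, where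
    both orbits are differentiable.\<close>
  have 1: "S (T t (?B u)) = T t (S (?B u))" for u
  proof -
    have "((\<lambda>s. S (T s (?B u))) has_vector_derivative S (T s (- u))) (at s within {0..})" if "s \<ge> 0" for s
      by (rule bounded_linear.has_vector_derivative[OF blinfun.bounded_linear_right])
        (rule semigroup_has_vector_derivative[OF T B that])
    moreover have "(S (T s (?B u)), S (T s (- u))) \<in> generator T" if "s \<ge> 0" for s
    proof -
      have "S (T s (?B u)) = ?B (S (T s u))"
        by (simp add: resolvent_commute_semigroup[OF T 0 that, symmetric] S)
      then show ?thesis using B[of "S (T s u)"] by (simp add: blinfun.minus_right)
    qed
    ultimately have "S (T t (?B u)) = T t (S (T 0 (?B u)))"
      using cauchy_problem_unique[OF T t, of "\<lambda>s. S (T s (?B u))" "\<lambda>s. S (T s (- u))"] by blast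
    then show ?thesis by (simp add: semigroup_0[OF T])
  qed
  show ?thesis
  \<comment> \<open>The case above concerns \<open>B x\<close>; once \<open>B\<close> is moved to
    the left on both sides, its injectivity cancels it.\<close>
  proof (rule inj)
    show "?B (S (T t x)) = ?B (T t (S x))"
      using 1[of x] by (simp add: S[symmetric] resolvent_commute_semigroup[OF T 0 t])
  qed
qed

lemma blinfun_power_commute:
  assumes "\<And>x. blinfun_apply S (blinfun_apply L x) = L (S x)"
  shows "S (blinfun_power L n x) = blinfun_power L n (S x)"
  by (induction n) (simp_all add: assms)

text \<open>If the integral in the definition does not exist then it is \<open>0\<close>, which commutes too.\<close>

lemma neg_inv_powr_commute:
  assumes S: "\<And>s x. s \<ge> 0 \<Longrightarrow> blinfun_apply S (resolvent A (complex_of_real s) x) = resolvent A (complex_of_real s) (S x)"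
  shows "S (neg_inv_powr A a x) = neg_inv_powr A a (S x)"
proof -
  define I where "I = integral {0<..} (\<lambda>s. (s powr (- frac a)) *\<^sub>R resolvent A (complex_of_real s))"
  have I: "S (I y) = I (S y)" for y
  proof (cases "(\<lambda>s. (s powr (- frac a)) *\<^sub>R resolvent A (complex_of_real s)) integrable_on {0<..}")
    case True
    define f where "f s = (s powr (- frac a)) *\<^sub>R resolvent A (complex_of_real s)" for s
    have f: "(f has_integral I) {0<..}" using True unfolding I_def f_def by (rule integrable_integral)
    \<comment> \<open>The integrand is operator valued; evaluating at a vector and applying
      \<open>S\<close> are bounded linear in the operator, so they pass inside the integral.\<close>
    have "((\<lambda>s. S (f s y)) has_integral S (I y)) {0<..}"
      using has_integral_linear[OF f, of "\<lambda>L. S (blinfun_apply L y)"]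
      by (simp add: o_def bounded_linear_compose[OF blinfun.bounded_linear_right blinfun.bounded_linear_left])
    moreover have "((\<lambda>s. f s (S y)) has_integral I (S y)) {0<..}"
      using has_integral_linear[OF f, of "\<lambda>L. blinfun_apply L (S y)"]
      by (simp add: o_def blinfun.bounded_linear_left)
    moreover have "S (f s y) = f s (S y)" if "s \<in> {0<..}" for s
      using S[of s y] that by (simp add: f_def blinfun.scaleR_left blinfun.scaleR_right)
    ultimately have "((\<lambda>s. f s (S y)) has_integral S (I y)) {0<..}"
      by (metis (no_types, lifting) has_integral_cong)
    then show ?thesis using \<open>((\<lambda>s. f s (S y)) has_integral I (S y)) {0<..}\<close> by (rule has_integral_unique)
  next
    case False
    then have "I = 0" by (simp add: I_def not_integrable_integral)
    then show ?thesis by simp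
  qed
  have "S (blinfun_power (resolvent A 0) k y) = blinfun_power (resolvent A 0) k (S y)" for k y
    by (rule blinfun_power_commute) (use S[of 0] in simp)
  then show ?thesis
    unfolding neg_inv_powr_def I_def[symmetric]
    by (simp add: blinfun.scaleR_left blinfun.scaleR_right I)
qed

text \<open>Adding an integer leaves \<open>frac a\<close>, and with it the integral, unchanged;
  only the integer power grows by two.\<close>

lemma neg_inv_powr_add_2:
  assumes "a \<ge> 0"
  shows "neg_inv_powr A (a + 2) = resolvent A 0 o\<^sub>L (resolvent A 0 o\<^sub>L neg_inv_powr A a)"
proof -
  have "nat \<lfloor>a + 2\<rfloor> = Suc (Suc (nat \<lfloor>a\<rfloor>))" using assms by linarith
  moreover have "frac (a + 2) = frac a" by (simp add: frac_def)
  ultimately show ?thesis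
    unfolding neg_inv_powr_def by (intro blinfun_eqI) simp
qed

section \<open>Landau bounds with explicit constants\<close>

lemma bigo_one_over_realD:
  fixes f :: "real \<Rightarrow> real"
  assumes "f \<in> O(\<lambda>t. 1 / t)" and "\<And>t. f t \<ge> 0"
  shows "\<exists>c t\<^sub>0. c > 0 \<and> t\<^sub>0 > 0 \<and> (\<forall>t\<ge>t\<^sub>0. f t \<le> c / t)"
proof -
  obtain c where c: "c > 0" "\<forall>\<^sub>F t in at_top. norm (f t) \<le> c * norm (1 / t)"
    using landau_o.bigE[OF assms(1)] by blast
  then obtain N where "\<And>t. t \<ge> N \<Longrightarrow> norm (f t) \<le> c * norm (1 / t)"
    by (auto simp: eventually_at_top_linorder)
  \<comment> \<open>The threshold is at least \<open>1\<close>, so \<open>t\<close> is positive and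
    the absolute values disappear.\<close>
  then have "f t \<le> c / t" if "t \<ge> max N 1" for t
    using that assms(2)[of t] by fastforce
  then show ?thesis using c by (intro exI[of _ c] exI[of _ "max N 1"]) auto
qed

lemma bigo_one_over_natI:
  assumes "\<And>n. n > 0 \<Longrightarrow> 0 \<le> f n \<and> f n \<le> c / real n"
  shows "f \<in> O(\<lambda>n. 1 / real n)"
  by (rule bigoI[of _ c], rule eventually_sequentiallyI[of 1]) (use assms in \<open>auto simp: Suc_le_eq\<close>)

section \<open>Normal operators on Hilbert spaces\<close>

text \<open>The type of bounded operators is only real-linear, so Riesz representation and adjoints
  are set up for the underlying real Hilbert space; for complex-linear maps the adjoint is the usual
  one, see \<open>cinner_adj\<close>.\<close>

definition rinner :: "'h::complex_hilbert \<Rightarrow> 'h \<Rightarrow> real" where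
  "rinner x y = Re (cinner x y)"

lemma rinner_commute: "rinner x y = rinner y x"
  by (metis cinner_commute cnj.sel(1) rinner_def)

lemma rinner_self: "rinner x x = (norm x)\<^sup>2"
  by (simp add: rinner_def cinner_self)

lemma rinner_add_left: "rinner (x + y) z = rinner x z + rinner y z"
  by (simp add: rinner_def cinner_add_left)

lemma rinner_scaleR_left: "rinner (r *\<^sub>R x) y = r * rinner x y"
  by (simp add: rinner_def cinner_scaleC_left scaleC_of_real[symmetric])

lemma rinner_minus_left: "rinner (- x) y = - rinner x y"
  using rinner_scaleR_left[of "-1" x y] by simp

lemma rinner_add_right: "rinner z (x + y) = rinner z x + rinner z y"
  using rinner_add_left rinner_commute by metis

lemma rinner_scaleR_right: "rinner y (r *\<^sub>R x) = r * rinner y x"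
  using rinner_scaleR_left rinner_commute by metis

lemma norm_add_sq: "(norm (x + y :: 'h::complex_hilbert))\<^sup>2 = (norm x)\<^sup>2 + 2 * rinner x y + (norm y)\<^sup>2"
  by (simp add: rinner_self[symmetric] rinner_add_left rinner_add_right rinner_commute)

lemma norm_diff_sq: "(norm (x - y :: 'h::complex_hilbert))\<^sup>2 = (norm x)\<^sup>2 - 2 * rinner x y + (norm y)\<^sup>2"
  using norm_add_sq[of x "- y"]
  by (simp add: rinner_commute[of x "- y"] rinner_minus_left rinner_commute[of y x])

lemma rinner_Cauchy_Schwarz: "\<bar>rinner x y\<bar> \<le> norm x * norm y"
proof (cases "y = 0")
  case True
  then show ?thesis using rinner_scaleR_right[of x 0 y] by simp
next
  case False
  define r where "r = rinner x y / (norm y)\<^sup>2"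
  have "0 \<le> (norm (x - r *\<^sub>R y))\<^sup>2" by simp
  also have "\<dots> = (norm x)\<^sup>2 - 2 * r * rinner x y + r\<^sup>2 * (norm y)\<^sup>2"
    by (simp add: norm_diff_sq rinner_scaleR_right power_mult_distrib)
  also have "\<dots> = (norm x)\<^sup>2 - (rinner x y)\<^sup>2 / (norm y)\<^sup>2"
    using False by (simp add: r_def power2_eq_square field_simps)
  finally have "(rinner x y)\<^sup>2 \<le> (norm x * norm y)\<^sup>2"
    using False by (simp add: field_simps power_mult_distrib)
  then show ?thesis using abs_le_square_iff[of "rinner x y" "norm x * norm y"] by simp
qed

interpretation rinner: bounded_bilinear "rinner :: 'h::complex_hilbert \<Rightarrow> 'h \<Rightarrow> real"
  by unfold_locales
    (auto intro!: exI[of _ 1] simp: rinner_add_left rinner_add_right rinner_scaleR_left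
      rinner_scaleR_right rinner_Cauchy_Schwarz)

lemma rinner_eqI:
  assumes "\<And>x. rinner x y = rinner x z"
  shows "y = z"
proof -
  have "(norm (y - z))\<^sup>2 = 0"
    using assms[of "y - z"] by (simp add: rinner_self[symmetric] rinner.diff_right)
  then show ?thesis by simp
qed

text \<open>The representing vector minimizes \<open>\<parallel>x\<parallel>\<^sup>2 - 2 f x\<close>.\<close>

lemma riesz_representation:
  fixes f :: "'h::complex_hilbert \<Rightarrow> real"
  assumes f: "bounded_linear f"
  shows "\<exists>u. \<forall>x. f x = rinner x u"
proof -
  interpret f: bounded_linear f by fact
  obtain K where K: "\<And>x. norm (f x) \<le> norm x * K" using f.bounded by blast
  define I where "I x = (norm x)\<^sup>2 - 2 * f x" for x
  have I_ge: "- K\<^sup>2 \<le> I x" for x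
  proof -
    have "f x \<le> norm x * K" using K[of x] by simp
    moreover have "0 \<le> (norm x - K)\<^sup>2" by simp
    ultimately show ?thesis unfolding I_def by (simp add: power2_diff algebra_simps)
  qed
  define d where "d = Inf (range I)"
  have d_le: "d \<le> I x" for x
    unfolding d_def by (rule cInf_lower) (use I_ge in \<open>auto simp: bdd_below_def\<close>)
  have "\<exists>x. I x < d + inverse (real (Suc n))" for n
    using cInf_lessD[of "range I" "d + inverse (real (Suc n))"] by (auto simp: d_def)
  then obtain x where x: "\<And>n. I (x n) < d + inverse (real (Suc n))" by metis
  \<comment> \<open>Parallelogram law: testing the infimum at the midpoint makes a minimizing
    sequence Cauchy.\<close>
  have par: "(norm (a - b))\<^sup>2 \<le> 2 * (I a - d + (I b - d))" for a b
  proof -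
    have "d \<le> I ((1/2) *\<^sub>R (a + b))" by (rule d_le)
    also have "\<dots> = (norm (a + b))\<^sup>2 / 4 - f a - f b"
      by (simp add: I_def f.scaleR f.add power_divide add_divide_distrib)
    finally have "4 * d \<le> (norm (a + b))\<^sup>2 - 4 * f a - 4 * f b" by simp
    then show ?thesis unfolding norm_add_sq norm_diff_sq I_def by argo
  qed
  have "Cauchy x"
  proof (rule CauchyI)
    fix e :: real assume e: "e > 0"
    obtain N where N: "inverse (real (Suc N)) < e\<^sup>2 / 4"
      using reals_Archimedean[of "e\<^sup>2 / 4"] e by auto
    have "norm (x m - x n) < e" if "m \<ge> N" "n \<ge> N" for m n
    proof -
      have "inverse (real (Suc k)) < e\<^sup>2 / 4" if "N \<le> k" for k
        using N that by (smt (verit) le_imp_inverse_le of_nat_0_less_iff of_nat_le_iff Suc_le_mono zero_less_Suc)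
      then have I_lt: "I (x k) < d + e\<^sup>2 / 4" if "N \<le> k" for k
        using x[of k] that by fastforce
      have "(norm (x m - x n))\<^sup>2 < e\<^sup>2"
        using par[of "x m" "x n"] I_lt[OF that(1)] I_lt[OF that(2)] by argo
      then show ?thesis using e by (simp add: power_less_imp_less_base)
    qed
    then show "\<exists>N. \<forall>m\<ge>N. \<forall>n\<ge>N. norm (x m - x n) < e" by blast
  qed
  then obtain u where u: "x \<longlonglongrightarrow> u" using Cauchy_convergent_iff convergent_def by blast
  have "(\<lambda>n. I (x n)) \<longlonglongrightarrow> I u" unfolding I_def by (intro tendsto_intros f.tendsto u)
  moreover have "(\<lambda>n. d + inverse (real (Suc n))) \<longlonglongrightarrow> d + 0"
    by (intro tendsto_add tendsto_const LIMSEQ_inverse_real_of_nat)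
  ultimately have "I u \<le> d + 0"
    by (rule LIMSEQ_le) (use x less_imp_le in blast)
  then have min: "I u \<le> I y" for y using d_le[of y] by simp
  have "f y = rinner y u" for y
  proof (rule ccontr)
    define c where "c = f y - rinner y u"
    assume "\<not> ?thesis"
    then have c: "c \<noteq> 0" by (simp add: c_def)
    have *: "0 \<le> r\<^sup>2 * (norm y)\<^sup>2 - 2 * r * c" for r
      using min[of "u + r *\<^sub>R y"]
      by (simp add: I_def norm_add_sq f.add f.scaleR c_def rinner_commute[of u]
          rinner_scaleR_left power_mult_distrib algebra_simps)
    \<comment> \<open>\<open>r = c / q\<close> minimizes \<open>r^2 q - 2 r c\<close>, with value
      \<open>- c^2 / q\<close>; the added \<open>1\<close> keeps \<open>q\<close> positive when
      \<open>y = 0\<close>.\<close>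
    define q where "q = (norm y)\<^sup>2 + 1"
    have q: "q > 0" by (simp add: q_def add_nonneg_pos)
    have "r\<^sup>2 * (norm y)\<^sup>2 \<le> r\<^sup>2 * q" for r :: real by (simp add: q_def mult_left_mono)
    then have "0 \<le> (c / q)\<^sup>2 * q - 2 * (c / q) * c" using *[of "c / q"] by (smt (verit))
    then have "0 \<le> - (c\<^sup>2 / q)" using q by (simp add: power2_eq_square field_simps)
    then show False using c q by (simp add: divide_le_0_iff zero_le_divide_iff)
  qed
  then show ?thesis by blast
qed

section \<open>Adjoints and normal contractions\<close>

lemma adjoint_exists:
  fixes L :: "'h::complex_hilbert \<Rightarrow>\<^sub>L 'h"
  shows "\<exists>L'. \<forall>x y. rinner (blinfun_apply L x) y = rinner x (blinfun_apply L' y)"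
proof -
  have "\<exists>u. \<forall>x. rinner (L x) y = rinner x u" for y
    by (rule riesz_representation)
      (intro bounded_linear_compose[OF rinner.bounded_linear_left blinfun.bounded_linear_right])
  then obtain g where g: "\<And>x y. rinner (L x) y = rinner x (g y)" by metis
  have "bounded_linear g"
  proof (rule bounded_linear_intro)
    show "g (y + z) = g y + g z" for y z
      by (rule rinner_eqI) (simp add: g[symmetric] rinner_add_right)
    show "g (r *\<^sub>R y) = r *\<^sub>R g y" for r y
      by (rule rinner_eqI) (simp add: g[symmetric] rinner_scaleR_right)
    show "norm (g y) \<le> norm y * norm L" for y
    proof (cases "g y = 0")
      case False
      have "(norm (g y))\<^sup>2 = rinner (L (g y)) y" by (simp add: g rinner_self)
      also have "\<dots> \<le> norm (L (g y)) * norm y" using rinner_Cauchy_Schwarz abs_le_iff by blast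
      also have "\<dots> \<le> norm L * norm (g y) * norm y" by (intro mult_right_mono norm_blinfun) auto
      finally show ?thesis using False by (simp add: power2_eq_square mult_ac)
    qed simp
  qed
  then have "\<forall>x y. rinner (L x) y = rinner x (Blinfun g y)" by (simp add: bounded_linear_Blinfun_apply g)
  then show ?thesis by blast
qed

definition adj :: "('h::complex_hilbert \<Rightarrow>\<^sub>L 'h) \<Rightarrow> 'h \<Rightarrow>\<^sub>L 'h" where
  "adj L = (SOME L'. \<forall>x y. rinner (blinfun_apply L x) y = rinner x (blinfun_apply L' y))"

lemma adj_right: "rinner (blinfun_apply L x) y = rinner x (adj L y)"
  using someI_ex[OF adjoint_exists[of L]] unfolding adj_def by blast

lemma adj_left: "rinner (adj L x) y = rinner x (blinfun_apply L y)"
  by (metis adj_right rinner_commute)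

lemma adj_adj: "adj (adj L) = L"
  by (intro blinfun_eqI rinner_eqI) (metis adj_left adj_right)

lemma adj_commute:
  assumes "\<And>x. blinfun_apply S (blinfun_apply L x) = L (S x)"
  shows "adj S (adj L x) = adj L (adj S x)"
  by (rule rinner_eqI) (simp add: adj_right[symmetric] assms)

abbreviation normal :: "('h::complex_hilbert \<Rightarrow>\<^sub>L 'h) \<Rightarrow> bool" where
  "normal L \<equiv> \<forall>x. blinfun_apply L (adj L x) = adj L (L x)"

lemma normal_norm_adj:
  assumes "normal L"
  shows "norm (adj L x) = norm (blinfun_apply L x)"
proof -
  have "(norm (adj L x))\<^sup>2 = (norm (L x))\<^sup>2"
    using assms adj_left[of L x "adj L x"] adj_right[of L x "L x"] by (simp add: rinner_self[symmetric])
  then show ?thesis by simp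
qed

text \<open>The sequence \<open>\<parallel>N\<^sup>n x\<parallel>\<close> is logarithmically convex, so it is decreasing if it is bounded.\<close>

lemma normal_power_bounded_contraction:
  assumes N: "normal N" and K: "\<And>n. norm (blinfun_apply (blinfun_power N n) x) \<le> K"
  shows "norm (N x) \<le> norm x"
proof (rule ccontr)
  assume "\<not> ?thesis"
  then have gt: "norm (N x) > norm x" by simp
  then have x: "norm x > 0" by (metis blinfun.zero_right less_irrefl norm_zero zero_less_norm_iff)
  define a where "a n = norm (blinfun_apply (blinfun_power N n) x)" for n
  define q where "q = norm (N x) / norm x"
  have q: "q > 1" using gt x by (simp add: q_def)
  have convex: "(a (Suc n))\<^sup>2 \<le> a (Suc (Suc n)) * a n" for n
  proof -
    let ?y = "blinfun_power N n x"
    have "(a (Suc n))\<^sup>2 = rinner ?y (adj N (N ?y))"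
      by (simp add: a_def rinner_self[symmetric] adj_right)
    also have "\<dots> \<le> norm ?y * norm (adj N (N ?y))"
      using rinner_Cauchy_Schwarz abs_le_iff by blast
    also have "\<dots> = a (Suc (Suc n)) * a n" by (simp add: a_def normal_norm_adj[OF N])
    finally show ?thesis .
  qed
  \<comment> \<open>By logarithmic convexity the ratio of consecutive terms never drops below its
    first value \<open>q > 1\<close>, which forces geometric growth.\<close>
  have grow: "a n > 0 \<and> a (Suc n) \<ge> q * a n" for n
  proof (induction n)
    case 0
    show ?case using x by (simp add: a_def q_def)
  next
    case (Suc n)
    have pos: "a (Suc n) > 0" using Suc q by (smt (verit) mult_le_cancel_right1)
    have "q * a (Suc n) * a n \<le> a (Suc n) * a (Suc n)"
      using mult_left_mono[OF conjunct2[OF Suc], of "a (Suc n)"] pos by (simp add: mult_ac)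
    also have "\<dots> \<le> a (Suc (Suc n)) * a n" using convex[of n] by (simp add: power2_eq_square)
    finally show ?case using Suc pos by simp
  qed
  have pow: "a n \<ge> q ^ n * a 0" for n
  proof (induction n)
    case (Suc n)
    have "q * (q ^ n * a 0) \<le> q * a n" using Suc q by (intro mult_left_mono) auto
    then show ?case using grow[of n] by (simp add: mult_ac)
  qed simp
  obtain n where "K / a 0 < q ^ n" using real_arch_pow[OF q] by blast
  then have "K < q ^ n * a 0" using grow[of 0] by (simp add: field_simps)
  then show False using K[of n] pow[of n] unfolding a_def by linarith
qed

text \<open>The scalar model is \<open>s^n (1 - s^2) \<le> 2 / n\<close> for
  \<open>0 \<le> s \<le> 1\<close>. With \<open>u k\<close> the squared norm of
  \<open>C^k x\<close>, the squared norm \<open>v k\<close> of \<open>E (C^k x)\<close> is the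
  second difference of \<open>u\<close>. As \<open>v\<close> decreases and \<open>u\<close>
  decreases from \<open>u 0\<close> and stays nonnegative, a weighted sum forces \<open>v n\<close>
  to be of order \<open>1 / n^2\<close>.\<close>

lemma normal_contraction_powers_decay:
  fixes C :: "'h::complex_hilbert \<Rightarrow>\<^sub>L 'h"
  assumes C: "normal C" and contr: "\<And>x. norm (C x) \<le> norm x" and n: "n > 0"
  defines "E \<equiv> \<lambda>x. x - adj C (C x)"
  shows "norm (blinfun_apply (blinfun_power C n) (E x)) \<le> 2 / real n * norm x"
proof -
  define p where "p k = blinfun_apply (blinfun_power C k) x" for k
  define u where "u k = (norm (p k))\<^sup>2" for k
  define v where "v k = (norm (E (p k)))\<^sup>2" for k
  have E: "C (E y) = E (C y)" for y
    using C by (simp add: E_def blinfun.diff_right)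
  have v: "v k = u k - 2 * u (Suc k) + u (Suc (Suc k))" for k
    by (simp add: v_def u_def E_def norm_diff_sq p_def normal_norm_adj[OF C] adj_right[symmetric] rinner_self)
  have v_dec: "v (Suc k) \<le> v k" for k
    using contr[of "E (p k)"] by (simp add: v_def p_def E)
  have u_dec: "u (Suc k) \<le> u k" for k
    using contr[of "p k"] by (simp add: u_def p_def)
  \<comment> \<open>Summation by parts: the sum of \<open>(k + 1) * v k\<close> over
    \<open>k < n\<close> equals the right-hand side, and each of these \<open>v k\<close> is at
    least \<open>v n\<close>.\<close>
  have "real (n * (n + 1)) / 2 * v n \<le> u 0 - u n - real n * (u n - u (Suc n))" for n
  proof (induction n)
    case (Suc n)
    have "real (Suc n * (Suc n + 1)) / 2 * v (Suc n) \<le> real (Suc n * (Suc n + 1)) / 2 * v n"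
      by (intro mult_left_mono v_dec) auto
    also have "\<dots> = real (n * (n + 1)) / 2 * v n + (real n + 1) * v n" by (simp add: field_simps)
    also have "\<dots> \<le> u 0 - u n - real n * (u n - u (Suc n)) + (real n + 1) * v n" using Suc by simp
    also have "\<dots> = u 0 - u (Suc n) - real (Suc n) * (u (Suc n) - u (Suc (Suc n)))"
      by (simp add: v algebra_simps)
    finally show ?case .
  qed simp
  from this[of n] have "real (n * (n + 1)) / 2 * v n \<le> u 0"
    using u_dec[of n] by (smt (verit) mult_nonneg_nonneg of_nat_0_le_iff u_def zero_le_power2)
  moreover have "(real n)\<^sup>2 / 4 * v n \<le> real (n * (n + 1)) / 2 * v n"
    by (rule mult_right_mono) (auto simp: v_def power2_eq_square field_simps)
  ultimately have "(real n / 2 * norm (E (p n)))\<^sup>2 \<le> (norm x)\<^sup>2"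
    by (simp add: u_def v_def p_def power_mult_distrib power_divide)
  then have "real n / 2 * norm (E (p n)) \<le> norm x" by (rule power2_le_imp_le) simp
  moreover have "E (p n) = blinfun_power C n (E x)"
    unfolding p_def by (induction n) (simp_all add: E[symmetric])
  ultimately show ?thesis using n by (simp add: field_simps)
qed

text \<open>
  Discrete substitute for the scalar implication \<open>m q\<^sup>n \<le> c / n \<Longrightarrow> m \<le> K (1 - q\<^sup>2)\<close>. Put
  \<open>Q\<^sub>j = N\<^sub>j\<^sup>* N\<^sub>j\<close>, so that \<open>Q\<^sub>j\<^sub>+\<^sub>1 = Q\<^sub>j\<^sup>2\<close>; then the increments of \<open>\<parallel>(1 - Q\<^sub>j)\<^sup>2 M x\<parallel>\<^sup>2\<close> are at most those of
  \<open>- 20 c\<^sup>2 \<parallel>(1 - Q\<^sub>j) x\<parallel>\<^sup>2 / 4\<^sup>j\<close>.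
\<close>

lemma normal_dyadic_decay_bound:
  fixes N :: "nat \<Rightarrow> 'h::complex_hilbert \<Rightarrow>\<^sub>L 'h"
  assumes dbl: "\<And>j x. N (Suc j) x = N j (N j x)"
    and nrm: "\<And>j. normal (N j)"
    and contr: "\<And>j x. norm (N j x) \<le> norm x"
    and MN: "\<And>j x. blinfun_apply M (N j x) = N j (M x)"
    and MN': "\<And>j x. blinfun_apply M (adj (N j) x) = adj (N j) (M x)"
    and decay: "\<And>j x. norm (N j (M x)) \<le> c / 2 ^ j * norm x"
    and c: "c \<ge> 0"
  shows "norm (M x) \<le> sqrt (4 * (norm M)\<^sup>2 + 20 * c\<^sup>2) * norm (x - adj (N 0) (N 0 x))"
proof -
  define Q where "Q j = adj (N j) o\<^sub>L N j" for j
  define E where "E j = id_blinfun - Q j" for j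
  have E: "E j y = y - Q j y" for j y by (simp add: E_def blinfun.diff_left)
  have QQ: "Q (Suc j) y = Q j (Q j y)" for j y
  proof -
    have "adj (N (Suc j)) z = adj (N j) (adj (N j) z)" for z
      by (rule rinner_eqI) (simp add: adj_right[symmetric] dbl)
    then show ?thesis using nrm[of j] by (simp add: Q_def dbl)
  qed
  have ES: "E (Suc j) y = E j y + Q j (E j y)" for j y
    by (simp add: E QQ blinfun.diff_right)
  have Qin: "rinner (Q j y) z = rinner (N j y) (N j z)" for j y z
    by (simp add: Q_def adj_left)
  have Qin': "rinner y (Q j z) = rinner (N j y) (N j z)" for j y z
    by (simp add: Q_def adj_right)
  have QN: "norm (Q j y) \<le> norm (N j y)" for j y
    using normal_norm_adj[OF nrm, of j "N j y"] contr[of j "N j y"] by (simp add: Q_def)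
  have Qc: "norm (Q j y) \<le> norm y" for j y using QN contr order_trans by blast
  have MQ: "M (Q j y) = Q j (M y)" for j y by (simp add: Q_def MN MN')
  have ME: "M (E j y) = E j (M y)" for j y by (simp add: E blinfun.diff_right MQ)
  have QE: "Q j (E j y) = E j (Q j y)" for j y by (simp add: E blinfun.diff_right)
  define \<Theta> where "\<Theta> j = (norm (M x))\<^sup>2 - (norm (E j (E j (M x))))\<^sup>2" for j
  define \<Psi> where "\<Psi> j = (norm (E j x))\<^sup>2 / 4 ^ j" for j
  have step: "\<Theta> j - \<Theta> (Suc j) \<le> 20 * c\<^sup>2 * (\<Psi> j - \<Psi> (Suc j))" for j
  proof -
    let ?z = "E j (E j (M x))" and ?y = "E j (E j x)" and ?p = "E j x"
    \<comment> \<open>\<open>E (Suc j) = (1 + Q j) E j\<close>, the operator form of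
      \<open>1 - q^2 = (1 + q) (1 - q)\<close>, is used twice.\<close>
    have "E (Suc j) (E (Suc j) (M x)) = ?z + (2 *\<^sub>R Q j ?z + Q j (Q j ?z))"
      by (simp add: ES QE[symmetric] blinfun.add_right scaleR_2)
    then have "\<Theta> j - \<Theta> (Suc j) = (norm (?z + (2 *\<^sub>R Q j ?z + Q j (Q j ?z))))\<^sup>2 - (norm ?z)\<^sup>2"
      by (simp add: \<Theta>_def)
    \<comment> \<open>This is the quadratic form of
      \<open>(1 + Q)^4 - 1 = 4 Q + 6 Q^2 + 4 Q^3 + Q^4\<close> at \<open>?z\<close>. The form of
      \<open>Q\<close> dominates those of its powers, whence \<open>15 = 4 + 6 + 4 + 1\<close>
      below.\<close>
    also have "\<dots> = 4 * (norm (N j ?z))\<^sup>2 + 6 * (norm (Q j ?z))\<^sup>2 + 4 * (norm (N j (Q j ?z)))\<^sup>2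
        + (norm (Q j (Q j ?z)))\<^sup>2"
      using Qin[of j ?z "Q j ?z"]
      by (simp add: norm_add_sq rinner_add_right rinner_scaleR_right rinner_scaleR_left Qin' Qin
          rinner_self power_mult_distrib blinfun.scaleR_right)
    also have "\<dots> \<le> 15 * (norm (N j ?z))\<^sup>2"
    proof -
      have le: "b \<le> norm (N j ?z) \<Longrightarrow> 0 \<le> b \<Longrightarrow> b\<^sup>2 \<le> (norm (N j ?z))\<^sup>2" for b by (rule power_mono)
      have "(norm (Q j ?z))\<^sup>2 \<le> (norm (N j ?z))\<^sup>2" by (intro le QN) simp
      moreover have "(norm (N j (Q j ?z)))\<^sup>2 \<le> (norm (N j ?z))\<^sup>2"
        using contr[of j "Q j ?z"] QN[of j ?z] by (intro le) auto
      moreover have "(norm (Q j (Q j ?z)))\<^sup>2 \<le> (norm (N j ?z))\<^sup>2"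
        using Qc[of j "Q j ?z"] QN[of j ?z] by (intro le) auto
      ultimately show ?thesis by linarith
    qed
    \<comment> \<open>\<open>M\<close> commutes with \<open>E j\<close>, so \<open>?z = M ?y\<close>
      and the decay hypothesis applies; \<open>15 = 20 * 3 / 4\<close> prepares the comparison with
      \<open>\<Psi>\<close>.\<close>
    also have "\<dots> \<le> 15 * (c / 2 ^ j * norm ?y)\<^sup>2"
      using decay[of j ?y] by (intro mult_left_mono power_mono) (simp_all add: ME)
    also have "\<dots> = 20 * c\<^sup>2 * (3 / 4 * (norm ?y)\<^sup>2 / 4 ^ j)"
      by (simp add: power_mult_distrib power_divide power_mult[symmetric] mult.commute[of j]
          power_mult[of 2 2 j, simplified])
    also have "\<dots> \<le> 20 * c\<^sup>2 * (\<Psi> j - \<Psi> (Suc j))"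
    proof (rule mult_left_mono)
      \<comment> \<open>Operator form of
        \<open>1 - (1 + q)^2 / 4 - 3 (1 - q)^2 / 4 = q - q^2\<close>, which is nonnegative for
        \<open>q\<close> in \<open>[0, 1]\<close>.\<close>
      have "(norm (N j ?p))\<^sup>2 - (norm (Q j ?p))\<^sup>2 \<ge> 0" using QN[of j ?p] by simp
      moreover have "(norm ?p)\<^sup>2 - (norm (?p + Q j ?p))\<^sup>2 / 4 - 3 / 4 * (norm (?p - Q j ?p))\<^sup>2
          = (norm (N j ?p))\<^sup>2 - (norm (Q j ?p))\<^sup>2"
        by (simp add: norm_add_sq norm_diff_sq Qin' rinner_self field_simps)
      ultimately have "3 / 4 * (norm ?y)\<^sup>2 \<le> (norm ?p)\<^sup>2 - (norm (E (Suc j) x))\<^sup>2 / 4"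
        unfolding ES E[of j ?p] by linarith
      from divide_right_mono[OF this, of "4 ^ j"]
      show "3 / 4 * (norm ?y)\<^sup>2 / 4 ^ j \<le> \<Psi> j - \<Psi> (Suc j)"
        by (simp add: \<Psi>_def diff_divide_distrib)
    qed simp
    finally show ?thesis .
  qed
  have tele: "\<Theta> 0 \<le> \<Theta> J + 20 * c\<^sup>2 * \<Psi> 0" for J
  proof -
    have "\<Theta> 0 + 20 * c\<^sup>2 * \<Psi> J \<le> \<Theta> J + 20 * c\<^sup>2 * \<Psi> 0"
    proof (induction J)
      case (Suc J)
      then show ?case using step[of J] by (simp add: right_diff_distrib)
    qed simp
    moreover have "0 \<le> 20 * c\<^sup>2 * \<Psi> J" by (simp add: \<Psi>_def)
    ultimately show ?thesis by linarith
  qed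
  \<comment> \<open>Since \<open>1 - (1 - Q)^2 = 2 Q - Q^2\<close>, the difference is controlled by
    \<open>N J (M x)\<close>, so that the bound tends to \<open>0\<close> as \<open>J\<close>
    grows.\<close>
  have \<Theta>_le: "\<Theta> J \<le> 15 * c * norm x * norm (M x) * (1 / 2) ^ J" for J
  proof -
    let ?m = "M x" and ?e = "E J (E J (M x))"
    have "?m - ?e = 2 *\<^sub>R Q J ?m - Q J (Q J ?m)" by (simp add: E blinfun.diff_right scaleR_2)
    then have "norm (?m - ?e) \<le> 2 * norm (Q J ?m) + norm (Q J (Q J ?m))"
      by (metis norm_scaleR norm_triangle_ineq4 abs_numeral)
    also have "\<dots> \<le> 3 * norm (N J ?m)" using QN[of J ?m] Qc[of J "Q J ?m"] by linarith
    also have "\<dots> \<le> 3 * (c / 2 ^ J * norm x)" using decay[of J x] by simp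
    finally have 1: "norm ?m - norm ?e \<le> 3 * (c / 2 ^ J * norm x)"
      using norm_triangle_ineq2[of ?m ?e] by linarith
    have "norm (E J y) \<le> 2 * norm y" for y
      using Qc[of J y] norm_triangle_ineq4[of y "Q J y"] by (simp add: E)
    from this[of "E J ?m"] this[of ?m] have 2: "norm ?m + norm ?e \<le> 5 * norm ?m" by linarith
    have "\<Theta> J = (norm ?m - norm ?e) * (norm ?m + norm ?e)"
      by (simp add: \<Theta>_def power2_eq_square algebra_simps)
    also have "\<dots> \<le> 3 * (c / 2 ^ J * norm x) * (norm ?m + norm ?e)"
      by (intro mult_right_mono 1) simp
    also have "\<dots> \<le> 3 * (c / 2 ^ J * norm x) * (5 * norm ?m)"
      by (intro mult_left_mono 2) (use c in simp)
    finally show ?thesis by (simp add: power_one_over field_simps)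
  qed
  have "(\<lambda>J. 15 * c * norm x * norm (M x) * (1 / 2) ^ J + 20 * c\<^sup>2 * \<Psi> 0)
      \<longlonglongrightarrow> 15 * c * norm x * norm (M x) * 0 + 20 * c\<^sup>2 * \<Psi> 0"
    by (intro tendsto_add tendsto_mult tendsto_const LIMSEQ_realpow_zero) auto
  then have "\<Theta> 0 \<le> 15 * c * norm x * norm (M x) * 0 + 20 * c\<^sup>2 * \<Psi> 0"
    by (rule LIMSEQ_le_const) (meson \<Theta>_le add_right_mono order_trans tele)
  then have "(norm (M x))\<^sup>2 \<le> (norm (E 0 (E 0 (M x))))\<^sup>2 + 20 * c\<^sup>2 * (norm (E 0 x))\<^sup>2"
    by (simp add: \<Theta>_def \<Psi>_def)
  \<comment> \<open>\<open>E 0\<close> has norm at most \<open>2\<close>, which produces the term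
    \<open>4 * (norm M)^2\<close>.\<close>
  also have "(norm (E 0 (E 0 (M x))))\<^sup>2 \<le> (2 * (norm M * norm (E 0 x)))\<^sup>2"
  proof (rule power_mono)
    let ?w = "M (E 0 x)"
    have "norm (E 0 ?w) \<le> norm ?w + norm (Q 0 ?w)" unfolding E by (rule norm_triangle_ineq4)
    also have "\<dots> \<le> 2 * norm ?w" using Qc[of 0 ?w] by simp
    also have "\<dots> \<le> 2 * (norm M * norm (E 0 x))" using norm_blinfun[of M "E 0 x"] by simp
    finally show "norm (E 0 (E 0 (M x))) \<le> 2 * (norm M * norm (E 0 x))" by (simp add: ME)
  qed simp
  finally have "(norm (M x))\<^sup>2 \<le> (sqrt (4 * (norm M)\<^sup>2 + 20 * c\<^sup>2) * norm (E 0 x))\<^sup>2"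
    by (simp add: power_mult_distrib algebra_simps)
  then have "norm (M x) \<le> sqrt (4 * (norm M)\<^sup>2 + 20 * c\<^sup>2) * norm (E 0 x)"
    by (rule power2_le_imp_le) simp
  then show ?thesis by (simp add: E Q_def)
qed

section \<open>Complex adjoints and resolvents of accretive operators\<close>

lemma cinner_adj:
  assumes "complex_linear L"
  shows "cinner (blinfun_apply L x) y = cinner x (adj L y)"
proof -
  have L: "L (c *\<^sub>C x) = c *\<^sub>C L x" for c x using assms by (simp add: complex_linear_def)
  have Re: "Re (cinner (L x) y) = Re (cinner x (adj L y))" for x
    using adj_right[of L x y] by (simp add: rinner_def)
  \<comment> \<open>Replacing \<open>x\<close> by \<open>\<i> *\<^sub>C x\<close> in the real
    identity recovers the imaginary parts; here complex linearity enters.\<close>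
  have "Re (\<i> * cinner (L x) y) = Re (\<i> * cinner x (adj L y))"
    using Re[of "\<i> *\<^sub>C x"] by (simp only: L cinner_scaleC_left)
  then show ?thesis using Re[of x] by (simp add: complex_eq_iff)
qed

text \<open>The set equality \<open>A A\<^sup>* = A\<^sup>* A\<close> reads \<open>{(B B\<^sup>* v, v)} = {(B\<^sup>* B v, v)}\<close> in terms of \<open>B = (- A)\<^sup>-\<^sup>1\<close>.\<close>

lemma normal_op_resolvent_0:
  assumes A: "normal_op A" and 0: "0 \<in> resolvent_set A"
  shows "normal (resolvent A 0)"
proof -
  let ?B = "resolvent A 0"
  have cl: "complex_linear ?B" by (rule graph_resolvent(1)[OF 0])
  have AB: "(x, y) \<in> A \<longleftrightarrow> x = ?B (- y)" for x y
    using resolvent_apply[OF 0, of x y] resolvent_range[OF 0, of "- y"] by (auto simp: scaleC_zero)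
  have AB': "(y, z) \<in> adjoint_op A \<longleftrightarrow> y = adj ?B (- z)" for y z
  proof -
    have "(y, z) \<in> adjoint_op A \<longleftrightarrow> (\<forall>w. cinner w y = cinner (?B (- w)) z)"
      by (auto simp: adjoint_op_def AB)
    also have "\<dots> \<longleftrightarrow> (\<forall>w. cinner w y = cinner w (adj ?B (- z)))"
    proof -
      have "cinner (?B (- w)) z = cinner w (adj ?B (- z))" for w
      proof -
        have m: "cinner (- u) v = - cinner u v" for u v :: 'a
          using cinner_scaleC_left[of "-1" u v] by (simp add: scaleC_minus_one)
        have m': "cinner u (- v) = - cinner u v" for u v :: 'a
          using m[of v u] cinner_commute[of u "- v"] cinner_commute[of u v] by simp
        show ?thesis
          by (simp add: cinner_adj[OF cl] m m' blinfun.minus_right)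
      qed
      then show ?thesis by simp
    qed
    also have "\<dots> \<longleftrightarrow> y = adj ?B (- z)" by (auto intro: rinner_eqI simp: rinner_def)
    finally show ?thesis .
  qed
  have "?B (adj ?B v) = adj ?B (?B v)" for v
  proof -
    have "(?B (adj ?B v), v) \<in> A O adjoint_op A"
      by (rule relcompI[where b = "- adj ?B v"]) (auto simp: AB AB' blinfun.minus_right)
    then have "(?B (adj ?B v), v) \<in> adjoint_op A O A" using A by (simp add: normal_op_def)
    then obtain y where "?B (adj ?B v) = adj ?B (- y)" "y = ?B (- v)" by (auto simp: AB AB')
    then show ?thesis by (simp add: blinfun.minus_right)
  qed
  then show ?thesis by blast
qed

text \<open>Lax-Milgram argument: coercivity of \<open>I + L\<close> makes
  \<open>x - e (x + L x - u)\<close> a strict contraction in \<open>x\<close> for small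
  \<open>e\<close>, and its fixed point solves the equation.\<close>

lemma accretive_one_plus_inverse:
  fixes L :: "'h::complex_hilbert \<Rightarrow>\<^sub>L 'h"
  assumes acc: "\<And>x. rinner (L x) x \<ge> 0"
  obtains G where "\<And>x. blinfun_apply G (x + L x) = x" "\<And>u. G u + L (G u) = u"
proof -
  define K where "K = 1 + norm L"
  have K: "K \<ge> 1" by (simp add: K_def)
  have lower: "(norm x)\<^sup>2 \<le> rinner (x + L x) x" for x
    using acc[of x] by (simp add: rinner_add_left rinner_self)
  have upper: "norm (x + L x) \<le> K * norm x" for x
    using norm_triangle_ineq[of x "L x"] norm_blinfun[of L x] by (simp add: K_def algebra_simps)
  have bound: "norm x \<le> norm (x + L x)" for x
  proof (cases "x = 0")
    case False
    have "norm x * norm x \<le> norm (x + L x) * norm x"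
      using lower[of x] rinner_Cauchy_Schwarz[of "x + L x" x] by (simp add: power2_eq_square)
    then show ?thesis using False by simp
  qed simp
  have "\<exists>!x. x + L x = u" for u
  proof -
    \<comment> \<open>With \<open>e * K^2 = 1\<close> the squared Lipschitz constant
      \<open>1 - 2 e + e^2 K^2\<close> becomes \<open>1 - e\<close>.\<close>
    define e where "e = 1 / K\<^sup>2"
    define f where "f x = x - e *\<^sub>R ((x + L x) - u)" for x
    have e: "e > 0" "e \<le> 1" using K by (simp_all add: e_def)
    have "\<exists>!x. f x = x"
    proof (rule banach_fix_type)
      show "0 \<le> sqrt (1 - e)" using e by simp
      show "sqrt (1 - e) < 1" using e by simp
      show "\<forall>x y. dist (f x) (f y) \<le> sqrt (1 - e) * dist x y"
      proof (intro allI)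
        fix x y :: 'h
        define w where "w = x - y"
        have "f x - f y = w - e *\<^sub>R (w + L w)"
          by (simp add: f_def w_def blinfun.diff_right scaleR_diff_right[symmetric]
              del: scaleR_diff_right) (simp add: algebra_simps)
        then have "(norm (f x - f y))\<^sup>2
            = (norm w)\<^sup>2 - 2 * e * rinner (w + L w) w + e\<^sup>2 * (norm (w + L w))\<^sup>2"
          by (simp add: norm_diff_sq rinner_scaleR_right rinner_commute[of w] power_mult_distrib)
        also have "\<dots> \<le> (norm w)\<^sup>2 - 2 * e * (norm w)\<^sup>2 + e\<^sup>2 * (K * norm w)\<^sup>2"
          by (intro add_mono diff_mono mult_left_mono lower power_mono upper) (use e in auto)
        also have "e\<^sup>2 * (K * norm w)\<^sup>2 = e * (norm w)\<^sup>2"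
          using K by (simp add: e_def power2_eq_square field_simps)
        finally have "(norm (f x - f y))\<^sup>2 \<le> (sqrt (1 - e) * norm w)\<^sup>2"
          using e by (simp add: power_mult_distrib algebra_simps)
        then have "norm (f x - f y) \<le> sqrt (1 - e) * norm w"
          by (rule power2_le_imp_le) (use e in simp)
        then show "dist (f x) (f y) \<le> sqrt (1 - e) * dist x y" by (simp add: dist_norm w_def)
      qed
    qed
    moreover have "f x = x \<longleftrightarrow> x + L x = u" for x using e by (simp add: f_def)
    ultimately show ?thesis by simp
  qed
  then obtain g where g: "\<And>u. g u + L (g u) = u" "\<And>x u. x + L x = u \<Longrightarrow> x = g u" by metis
  have "bounded_linear g"
  proof (rule bounded_linear_intro)
    show "g (u + v) = g u + g v" for u v
      using g(1)[of u] g(1)[of v] by (intro g(2)[symmetric]) (simp add: blinfun.add_right algebra_simps)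
    show "g (r *\<^sub>R u) = r *\<^sub>R g u" for r u
      using g(1)[of u] by (intro g(2)[symmetric]) (simp add: blinfun.scaleR_right scaleR_add_right[symmetric])
    show "norm (g u) \<le> norm u * 1" for u using bound[of "g u"] g(1)[of u] by simp
  qed
  then have "blinfun_apply (Blinfun g) = g" by (rule bounded_linear_Blinfun_apply)
  then show thesis using that[of "Blinfun g"] g by metis
qed

lemma commute_inverse:
  assumes G: "\<And>x. blinfun_apply G (x + blinfun_apply L x) = x" "\<And>u. G u + L (G u) = u"
    and S: "\<And>x. blinfun_apply S (L x) = L (S x)"
  shows "S (G u) = G (S u)"
proof -
  have "S u = S (G u) + L (S (G u))" using G(2)[of u] S by (metis blinfun.add_right)
  then show ?thesis using G(1) by metis
qed

text \<open>\<open>B\<close> stands for \<open>(- A)^(-1)\<close>, so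
  \<open>s I - A = (I + s B) B^(-1)\<close> and the resolvent at \<open>s\<close> is
  \<open>B (I + s B)^(-1)\<close>. Accretivity of \<open>B\<close> makes \<open>I + s B\<close>
  invertible.\<close>

lemma accretive_resolvent:
  assumes AB: "\<And>x y. (x, y) \<in> A \<longleftrightarrow> x = blinfun_apply B (- y)" and cl: "complex_linear B"
    and acc: "\<And>x. rinner (B x) x \<ge> 0" and s: "s \<ge> 0"
  obtains G where "\<And>x. blinfun_apply G (x + s *\<^sub>R B x) = x" "\<And>u. G u + s *\<^sub>R B (G u) = u"
    "complex_of_real s \<in> resolvent_set A" "resolvent A (complex_of_real s) = B o\<^sub>L G"
proof -
  have "rinner ((s *\<^sub>R B) x) x \<ge> 0" for x
    using acc s by (simp add: blinfun.scaleR_left rinner_scaleR_left)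
  from accretive_one_plus_inverse[OF this] obtain G
    where G: "\<And>x. blinfun_apply G (x + s *\<^sub>R B x) = x" "\<And>u. G u + s *\<^sub>R B (G u) = u"
    by (auto simp: blinfun.scaleR_left)
  have B: "B (c *\<^sub>C x) = c *\<^sub>C B x" for c x using cl by (simp add: complex_linear_def)
  have comm: "s *\<^sub>R c *\<^sub>C x = c *\<^sub>C s *\<^sub>R (x::'a)" for c x
    by (simp add: scaleC_of_real[symmetric] scaleC_scaleC mult.commute)
  have "complex_linear (B o\<^sub>L G)"
    unfolding complex_linear_def
  proof (intro allI)
    fix c x
    have "c *\<^sub>C G x + s *\<^sub>R B (c *\<^sub>C G x) = c *\<^sub>C x"
      by (simp add: B comm scaleC_add_right[symmetric] G)
    then have "G (c *\<^sub>C x) = c *\<^sub>C G x" using G(1) by metis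
    then show "(B o\<^sub>L G) (c *\<^sub>C x) = c *\<^sub>C (B o\<^sub>L G) x" by (simp add: B)
  qed
  moreover have "(B o\<^sub>L G) (complex_of_real s *\<^sub>C x - y) = x" if "(x, y) \<in> A" for x y
  proof -
    have x: "x = - B y" using that AB by (simp add: blinfun.minus_right)
    have "complex_of_real s *\<^sub>C x - y = - (y + s *\<^sub>R B y)" by (simp add: x scaleC_of_real)
    then have "(B o\<^sub>L G) (complex_of_real s *\<^sub>C x - y) = - B (G (y + s *\<^sub>R B y))"
      by (simp only: blinfun_apply_blinfun_compose blinfun.minus_right)
    then show ?thesis by (simp add: G x)
  qed
  moreover have "((B o\<^sub>L G) u, complex_of_real s *\<^sub>C (B o\<^sub>L G) u - u) \<in> A" for u
  proof -
    have "complex_of_real s *\<^sub>C (B o\<^sub>L G) u - u = - G u"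
      using G(2)[of u] by (simp add: scaleC_of_real algebra_simps)
    then show ?thesis using AB by simp
  qed
  ultimately show thesis using that[OF G] resolventI[of "B o\<^sub>L G" A "complex_of_real s"] by blast
qed

section \<open>Case (a): normal generators on a Hilbert space\<close>

lemma cayley_decay_hilbert:
  fixes T :: "real \<Rightarrow> 'h::complex_hilbert \<Rightarrow>\<^sub>L 'h"
  assumes T: "C0_semigroup T" and bdd: "uniformly_bounded T" and A: "A = generator T"
    and 0: "0 \<in> resolvent_set A" and normal: "normal_op A" and a: "\<alpha> > 0"
    and O: "(\<lambda>t. norm (T t o\<^sub>L neg_inv_powr A \<alpha>)) \<in> O(\<lambda>t. 1 / t)"
  shows "(\<lambda>n. norm (blinfun_power (cayley A) n o\<^sub>L neg_inv_powr A (\<alpha> + 2))) \<in> O(\<lambda>n. 1 / real n)"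
proof -
  define B where "B = resolvent A 0"
  define M where "M = neg_inv_powr A \<alpha>"
  have AB: "(x, y) \<in> A \<longleftrightarrow> x = B (- y)" for x y
    using resolvent_apply[OF 0, of x y] resolvent_range[OF 0, of "- y"] by (auto simp: scaleC_zero B_def)
  have AB1: "(B u, - u) \<in> generator T" for u using AB[of "B u" "- u"] by (simp add: A)
  have cl: "complex_linear B" unfolding B_def by (rule graph_resolvent(1)[OF 0])
  have nB: "B (adj B x) = adj B (B x)" for x using normal_op_resolvent_0[OF normal 0] by (simp add: B_def)
  have zero_res: "0 \<in> resolvent_set (generator T)" using 0 A by simp
  have commT: "blinfun_apply S (T t x) = T t (S x)" if "\<And>x. blinfun_apply S (B x) = B (S x)" "t \<ge> 0" for S t x
    by (rule commute_resolvent_semigroup[OF T zero_res that(2)]) (use that(1) in \<open>simp add: B_def A\<close>)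
  have BT: "B (T t x) = T t (B x)" if "t \<ge> 0" for t x by (rule commT) (use that in auto)
  \<comment> \<open>Normality passes from \<open>B\<close> to \<open>T t\<close>:
    \<open>adj B\<close> commutes with \<open>B\<close>, hence with \<open>T t\<close>; taking
    adjoints, \<open>adj (T t)\<close> commutes with \<open>B\<close>, hence with
    \<open>T t\<close>.\<close>
  have B'T: "adj B (T t x) = T t (adj B x)" if "t \<ge> 0" for t x
    by (rule commT) (use that nB in auto)
  have T'B: "adj (T t) (B x) = B (adj (T t) x)" if "t \<ge> 0" for t x
    using adj_commute[of "adj B" "T t"] B'T[OF that] by (simp add: adj_adj)
  have nT: "T t (adj (T t) x) = adj (T t) (T t x)" if "t \<ge> 0" for t x
    using commT[of "adj (T t)" t x] T'B that by simp
  \<comment> \<open>The powers of \<open>T t\<close> are the operators \<open>T (n * t)\<close>,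
    hence bounded, and a power bounded normal operator is a contraction.\<close>
  have contr: "norm (T t x) \<le> norm x" if "t \<ge> 0" for t x
  proof -
    obtain K where K: "\<And>t. t \<ge> 0 \<Longrightarrow> norm (T t) \<le> K"
      using bdd by (auto simp: uniformly_bounded_def bounded_iff)
    have "blinfun_power (T t) n x = T (real n * t) x" for n
    proof (induction n)
      case (Suc n)
      then show ?case using semigroup_add[OF T, of t "real n * t" x] that by (simp add: distrib_right)
    qed (simp add: semigroup_0[OF T])
    moreover have "norm (T (real n * t) x) \<le> K * norm x" for n
      by (rule norm_blinfun_le) (use K that in simp)
    ultimately have "norm (blinfun_power (T t) n x) \<le> K * norm x" for n by simp
    then show ?thesis using normal_power_bounded_contraction[of "T t" x] nT[OF that] by blast
  qed
  \<comment> \<open>As \<open>T s\<close> is a contraction, \<open>rinner (T s x - x) x\<close> is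
    never positive; divide by \<open>s\<close> and let \<open>s\<close> tend to \<open>0\<close> at
    \<open>x = B u\<close>.\<close>
  have acc: "rinner (B u) u \<ge> 0" for u
  proof -
    have "((\<lambda>s. rinner ((T s (B u) - B u) /\<^sub>R s) (B u)) \<longlongrightarrow> rinner (- u) (B u)) (at_right 0)"
      using AB1[of u] by (intro rinner.tendsto tendsto_const) (simp add: generator_def)
    moreover have "rinner ((T s (B u) - B u) /\<^sub>R s) (B u) \<le> 0" if "s > 0" for s
    proof -
      have "rinner (T s (B u)) (B u) \<le> norm (T s (B u)) * norm (B u)"
        using rinner_Cauchy_Schwarz abs_le_iff by blast
      also have "\<dots> \<le> norm (B u) * norm (B u)" by (intro mult_right_mono contr) (use that in auto)
      also have "\<dots> = rinner (B u) (B u)" by (simp add: rinner_self power2_eq_square)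
      finally show ?thesis
        using that by (simp add: rinner_scaleR_left rinner.diff_left mult_le_0_iff)
    qed
    then have "\<forall>\<^sub>F s in at_right 0. rinner ((T s (B u) - B u) /\<^sub>R s) (B u) \<le> 0"
      by (auto simp: eventually_at_filter)
    ultimately have "rinner (- u) (B u) \<le> 0"
      by (rule tendsto_upperbound[OF _ _ trivial_limit_at_right_real])
    then show ?thesis by (simp add: rinner_minus_left rinner_commute)
  qed
  \<comment> \<open>By the form \<open>B (I + s B)^(-1)\<close> of the resolvent, whatever commutes
    with \<open>B\<close> commutes with all resolvents at \<open>s \<ge> 0\<close>, and then with
    \<open>M\<close>.\<close>
  have commR: "blinfun_apply S (resolvent A (complex_of_real s) x) = resolvent A (complex_of_real s) (S x)"
    if S: "\<And>x. blinfun_apply S (B x) = B (S x)" and s: "s \<ge> 0" for S s x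
  proof -
    obtain G where G: "\<And>x. blinfun_apply G (x + s *\<^sub>R B x) = x" "\<And>u. G u + s *\<^sub>R B (G u) = u"
      "complex_of_real s \<in> resolvent_set A" "resolvent A (complex_of_real s) = B o\<^sub>L G"
      by (rule accretive_resolvent[OF AB cl acc s]) (rule that; assumption)
    have "S (G u) = G (S u)" for u
      by (rule commute_inverse[of G "s *\<^sub>R B"]) (simp_all add: G S blinfun.scaleR_left blinfun.scaleR_right)
    then show ?thesis by (simp add: G S)
  qed
  have commM: "blinfun_apply S (M x) = M (S x)" if "\<And>x. blinfun_apply S (B x) = B (S x)" for S x
    unfolding M_def by (rule neg_inv_powr_commute) (rule commR[OF that])
  obtain c t\<^sub>0 where c: "c > 0" and t\<^sub>0: "t\<^sub>0 > 0" and dec: "\<And>t. t \<ge> t\<^sub>0 \<Longrightarrow> norm (T t o\<^sub>L M) \<le> c / t"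
    using bigo_one_over_realD[OF O norm_ge_zero] by (auto simp: M_def)

  text \<open>The symbol of \<open>I - T(t\<^sub>0)\<^sup>* T(t\<^sub>0)\<close> is comparable to \<open>\<bar>Re \<lambda>\<bar>\<close> near \<open>i\<real>\<close>.\<close>
  define Q where "Q x = adj (T t\<^sub>0) (T t\<^sub>0 x)" for x
  define K where "K = sqrt (4 * (norm M)\<^sup>2 + 20 * (c / t\<^sub>0)\<^sup>2)"
  have M_le: "norm (M x) \<le> K * norm (x - Q x)" for x
  proof -
    \<comment> \<open>Along the times \<open>2^j * t\<^sub>0\<close> doubling the time squares the
      operator, and \<open>c / t\<close> becomes \<open>(c / t\<^sub>0) / 2^j\<close>.\<close>
    define N where "N j = T (2 ^ j * t\<^sub>0)" for j :: nat
    have pos: "2 ^ j * t\<^sub>0 \<ge> 0" for j :: nat using t\<^sub>0 by simp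
    have "norm (M x) \<le> sqrt (4 * (norm M)\<^sup>2 + 20 * (c / t\<^sub>0)\<^sup>2) * norm (x - adj (N 0) (N 0 x))"
    proof (rule normal_dyadic_decay_bound)
      show "N (Suc j) x = N j (N j x)" for j x
      proof -
        have "2 ^ Suc j * t\<^sub>0 = 2 ^ j * t\<^sub>0 + 2 ^ j * t\<^sub>0" by simp
        then show ?thesis unfolding N_def using semigroup_add[OF T pos pos, of j j x] by presburger
      qed
      show "normal (N j)" for j using nT[OF pos] by (simp add: N_def)
      show "norm (N j x) \<le> norm x" for j x using contr[OF pos] by (simp add: N_def)
      show "M (N j x) = N j (M x)" for j x using commM[of "N j" x] BT[OF pos] by (simp add: N_def)
      show "M (adj (N j) x) = adj (N j) (M x)" for j x
        using commM[of "adj (N j)" x] T'B[OF pos] by (simp add: N_def)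
      show "norm (N j (M x)) \<le> c / t\<^sub>0 / 2 ^ j * norm x" for j x
      proof -
        have "t\<^sub>0 \<le> 2 ^ j * t\<^sub>0" using t\<^sub>0 by simp
        then have "norm (N j o\<^sub>L M) \<le> c / t\<^sub>0 / 2 ^ j"
          using dec[of "2 ^ j * t\<^sub>0"] by (simp add: N_def field_simps)
        from norm_blinfun_le[OF this, of x] show ?thesis by simp
      qed
    qed (use c t\<^sub>0 in simp)
    then show ?thesis by (simp add: N_def K_def Q_def)
  qed
  \<comment> \<open>On symbols this is \<open>1 - exp (2 t\<^sub>0 Re \<lambda>) \<le> 2 t\<^sub>0
    |Re \<lambda>|\<close> divided by \<open>|\<lambda>|^2\<close>. The operator version writes the
    squared norm of \<open>z\<close> as the decrease of \<open>h\<close> over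
    \<open>[0, t\<^sub>0]\<close> and applies the mean value theorem.\<close>
  have defect_le: "norm (adj B (B x) - Q (adj B (B x))) \<le> t\<^sub>0 * norm (B x + adj B x)" for x
  proof -
    define y where "y = adj B (B x)"
    define v where "v = adj B x - Q (adj B x)"
    define z where "z = y - Q y"
    have QB: "Q (B u) = B (Q u)" for u
      using t\<^sub>0 by (simp add: Q_def BT[symmetric] T'B)
    \<comment> \<open>This second form shows that \<open>y\<close> lies in the domain, with image
      \<open>- adj B x\<close> under \<open>A\<close>.\<close>
    have y: "y = B (adj B x)" by (simp add: y_def nB)
    have z: "z = B v" by (simp add: z_def v_def y QB blinfun.diff_right)
    define h where "h s = rinner (T s y) (T s z)" for s
    have h': "(h has_derivative (\<lambda>r. r * - rinner (T s (B x + adj B x)) (T s z))) (at s within {0..t\<^sub>0})"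
      if s: "s \<in> {0..t\<^sub>0}" for s
    proof -
      have "((\<lambda>s. T s y) has_vector_derivative T s (- adj B x)) (at s within {0..t\<^sub>0})"
        using semigroup_has_vector_derivative[OF T AB1[of "adj B x"], of s] s unfolding y
        by (auto intro: has_vector_derivative_within_subset)
      moreover have "((\<lambda>s. T s z) has_vector_derivative T s (- v)) (at s within {0..t\<^sub>0})"
        using semigroup_has_vector_derivative[OF T AB1[of v], of s] s unfolding z
        by (auto intro: has_vector_derivative_within_subset)
      ultimately have "(h has_vector_derivative rinner (T s y) (T s (- v)) + rinner (T s (- adj B x)) (T s z))
          (at s within {0..t\<^sub>0})"
        unfolding h_def by (rule rinner.has_vector_derivative)
      \<comment> \<open>Moving \<open>adj B\<close> across the inner product turns \<open>v\<close>
        into \<open>z = B v\<close>, so that the two terms of the derivative combine to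
        \<open>B x + adj B x\<close>.\<close>
      moreover have "rinner (T s y) (T s v) = rinner (T s (B x)) (T s z)"
      proof -
        have "rinner (T s y) (T s v) = rinner (adj B (T s (B x))) (T s v)"
          using s by (simp add: y_def B'T)
        also have "\<dots> = rinner (T s (B x)) (T s z)" using s by (simp add: adj_left BT z)
        finally show ?thesis .
      qed
      ultimately show ?thesis
        by (simp add: has_vector_derivative_def blinfun.minus_right blinfun.add_right rinner.minus_right
            rinner.minus_left rinner_add_left algebra_simps)
    qed
    obtain s where s: "s \<in> {0<..<t\<^sub>0}"
      and eq: "h t\<^sub>0 - h 0 = (t\<^sub>0 - 0) * - rinner (T s (B x + adj B x)) (T s z)"
      using mvt_simple[OF t\<^sub>0, of h "\<lambda>s r. r * - rinner (T s (B x + adj B x)) (T s z)"] h' by auto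
    have "(norm z)\<^sup>2 = h 0 - h t\<^sub>0"
      by (simp add: h_def semigroup_0[OF T] rinner_self[symmetric])
        (simp add: z_def Q_def rinner.diff_left adj_left)
    also have "\<dots> = t\<^sub>0 * rinner (T s (B x + adj B x)) (T s z)" using eq by simp
    also have "\<dots> \<le> t\<^sub>0 * (norm (B x + adj B x) * norm z)"
    proof -
      have "rinner (T s (B x + adj B x)) (T s z) \<le> norm (T s (B x + adj B x)) * norm (T s z)"
        using rinner_Cauchy_Schwarz abs_le_iff by blast
      also have "\<dots> \<le> norm (B x + adj B x) * norm z"
        by (intro mult_mono contr) (use s in auto)
      finally show ?thesis using t\<^sub>0 by simp
    qed
    finally have "norm z * norm z \<le> t\<^sub>0 * norm (B x + adj B x) * norm z"
      by (simp add: power2_eq_square mult_ac)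
    then have "norm z \<le> t\<^sub>0 * norm (B x + adj B x)"
      using t\<^sub>0 by (cases "z = 0") auto
    then show ?thesis by (simp add: z_def y_def)
  qed

  obtain G where G: "\<And>x. blinfun_apply G (x + 1 *\<^sub>R B x) = x" "\<And>u. G u + 1 *\<^sub>R B (G u) = u"
    and R1: "complex_of_real 1 \<in> resolvent_set A" "resolvent A (complex_of_real 1) = B o\<^sub>L G"
    by (rule accretive_resolvent[OF AB cl acc zero_le_one]) (rule that; assumption)
  define C where "C = cayley A"
  have C: "C x = 2 *\<^sub>R B (G x) - x" for x
  proof -
    have "C = 2 *\<^sub>R resolvent A 1 - id_blinfun"
      unfolding C_def by (rule cayley_eq) (use R1 generator_single_valued[OF T] A in auto)
    then show ?thesis using R1 by (simp add: blinfun.diff_left blinfun.scaleR_left)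
  qed
  \<comment> \<open>The Cayley transform in terms of \<open>B\<close>:
    \<open>C (I + B) = B - I\<close>. Contractivity and the defect identity below both rest on
    it.\<close>
  have C1: "C (x + B x) = B x - x" for x
    using G(1)[of x] by (simp add: C scaleR_2)
  have commG: "blinfun_apply S (G u) = G (S u)" if "\<And>x. blinfun_apply S (B x) = B (S x)" for S u
    by (rule commute_inverse[of G B]) (use G that in simp_all)
  have commC: "blinfun_apply S (C x) = C (S x)" if "\<And>x. blinfun_apply S (B x) = B (S x)" for S x
    using commG[OF that] that by (simp add: C blinfun.diff_right blinfun.scaleR_right)
  have CB: "C (B x) = B (C x)" for x using commC[of B] by simp
  have C'B: "adj C (B x) = B (adj C x)" for x
    using adj_commute[of "adj B" C] commC[of "adj B"] nB by (simp add: adj_adj)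
  have nC: "C (adj C x) = adj C (C x)" for x using commC[of "adj C"] C'B by simp
  have C'B': "adj C (adj B x) = adj B (adj C x)" for x using adj_commute[of C B] CB by simp
  have contrC: "norm (C x) \<le> norm x" for x
  proof -
    define w where "w = G x"
    have x: "x = w + B w" using G(2)[of x] by (simp add: w_def)
    have "(norm (C x))\<^sup>2 \<le> (norm x)\<^sup>2"
      using acc[of w] unfolding x C1 by (simp add: norm_add_sq norm_diff_sq rinner_commute)
    then show ?thesis by (rule power2_le_imp_le) simp
  qed
  define E where "E x = x - adj C (C x)" for x
  define K' where "K' = (1 + norm (adj B)) * (1 + norm B) / 2"
  have one_plus: "norm (x + L x) \<le> (1 + norm L) * norm x" for L :: "'h \<Rightarrow>\<^sub>L 'h" and x
    using norm_triangle_ineq[of x "L x"] norm_blinfun[of L x] by (simp add: algebra_simps)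
  \<comment> \<open>From \<open>C (I + B) = B - I\<close> and its adjoint,
    \<open>(I + adj B) (I + B) (I - adj C C) = 2 (B + adj B)\<close>; \<open>K'\<close> is half the
    product of the norm bounds of the first two factors.\<close>
  have P_le: "norm (B x + adj B x) \<le> K' * norm (E x)" for x
  proof -
    define e where "e = E x + B (E x)"
    have e: "e = (x + B x) - adj C (B x - x)"
      by (simp add: e_def E_def C1[symmetric] blinfun.diff_right blinfun.add_right C'B CB algebra_simps)
    have "e + adj B e = 2 *\<^sub>R (B x + adj B x)"
    proof -
      have "adj C (y + adj B y) = adj B y - y" for y
      proof (rule rinner_eqI)
        fix u
        have "rinner u (adj C (y + adj B y)) = rinner (C u + B (C u)) y"
          by (simp add: adj_right[symmetric] rinner_add_right rinner_add_left)
        also have "C u + B (C u) = C (u + B u)" by (simp add: CB blinfun.add_right)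
        finally show "rinner u (adj C (y + adj B y)) = rinner u (adj B y - y)"
          by (simp add: C1 rinner.diff_left rinner.diff_right adj_right)
      qed
      from this[of "B x - x"] have "adj C (B x - x) + adj B (adj C (B x - x)) = adj B (B x - x) - (B x - x)"
        by (simp add: blinfun.add_right C'B')
      then show ?thesis
        unfolding e by (simp add: blinfun.diff_right blinfun.add_right scaleR_2 algebra_simps)
    qed
    then have "2 * norm (B x + adj B x) = norm (e + adj B e)" by simp
    also have "\<dots> \<le> (1 + norm (adj B)) * norm e" by (rule one_plus)
    also have "\<dots> \<le> (1 + norm (adj B)) * ((1 + norm B) * norm (E x))"
      unfolding e_def by (intro mult_left_mono one_plus) simp
    finally show ?thesis by (simp add: K'_def)
  qed
  have K0: "K \<ge> 0" "K' \<ge> 0" by (simp_all add: K_def K'_def)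
  have final: "norm (blinfun_power C n o\<^sub>L neg_inv_powr A (\<alpha> + 2)) \<le> (K * (t\<^sub>0 * (K' * 2))) / real n"
    if n: "n > 0" for n
  proof (rule norm_blinfun_bound)
    fix x
    let ?y = "blinfun_power C n x"
    have "(blinfun_power C n o\<^sub>L neg_inv_powr A (\<alpha> + 2)) x = blinfun_power C n (B (B (M x)))"
      using a by (simp add: neg_inv_powr_add_2 B_def M_def)
    also have "\<dots> = B (B (M ?y))"
      using blinfun_power_commute[of _ C] commM[of C] CB by metis
    finally have "norm ((blinfun_power C n o\<^sub>L neg_inv_powr A (\<alpha> + 2)) x) = norm (B (B (M ?y)))" by simp
    \<comment> \<open>Normality trades one factor \<open>B\<close> for \<open>adj B\<close>, which
      produces the operator \<open>adj B B\<close> of the defect estimate.\<close>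
    also have "\<dots> = norm (adj B (B (M ?y)))"
      using normal_norm_adj[of B "B (M ?y)"] nB by simp
    also have "adj B (B (M ?y)) = M (adj B (B ?y))"
      using commM[of B] commM[of "adj B"] nB by simp
    also have "norm \<dots> \<le> K * norm (adj B (B ?y) - Q (adj B (B ?y)))" by (rule M_le)
    also have "\<dots> \<le> K * (t\<^sub>0 * norm (B ?y + adj B ?y))"
      by (intro mult_left_mono defect_le K0)
    also have "\<dots> \<le> K * (t\<^sub>0 * (K' * norm (E ?y)))"
      by (intro mult_left_mono P_le K0) (use t\<^sub>0 in simp)
    also have "E ?y = blinfun_power C n (E x)"
    proof -
      have "E (C u) = C (E u)" for u by (simp add: E_def blinfun.diff_right nC)
      then show ?thesis by (induction n) simp_all
    qed
    also have "norm \<dots> \<le> 2 / real n * norm x"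
      using normal_contraction_powers_decay[of C n x] nC contrC n by (simp add: E_def)
    then have "K * (t\<^sub>0 * (K' * norm (blinfun_power C n (E x)))) \<le> K * (t\<^sub>0 * (K' * (2 / real n * norm x)))"
      by (intro mult_left_mono K0) (use t\<^sub>0 in simp_all)
    finally show "norm ((blinfun_power C n o\<^sub>L neg_inv_powr A (\<alpha> + 2)) x)
        \<le> (K * (t\<^sub>0 * (K' * 2))) / real n * norm x"
      by (simp add: mult_ac)
  qed (use K0 t\<^sub>0 in simp)
  show ?thesis
    by (rule bigo_one_over_natI[where c = "K * (t\<^sub>0 * (K' * 2))"]) (use final in \<open>simp add: C_def\<close>)
qed

section \<open>Scalar estimates\<close>

text \<open>With \<open>y = 2 |Re z| / |1 - z|^2\<close> the squared modulus of the quotient is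
  \<open>1 - 2 y \<le> (1 - y)^2\<close>, and
  \<open>(1 - y)^n n y \<le> (1 - y)^n (1 + y)^n \<le> 1\<close> by Bernoulli. The lower bound
  \<open>d\<close> then replaces \<open>|1 - z|\<close> by \<open>(1 + 1 / d) |z|\<close>.\<close>

lemma norm_cayley_power:
  fixes z :: complex
  assumes z: "Re z < 0" and d: "d > 0" "d \<le> cmod z" and n: "n > 0"
  shows "cmod ((1 + z) / (1 - z)) ^ n * (- Re z) \<le> (1 + 1 / d)\<^sup>2 * (cmod z)\<^sup>2 / real n"
proof -
  define D where "D = (cmod (1 - z))\<^sup>2"
  define y where "y = 2 * (- Re z) / D"
  have "1 - z \<noteq> 0" using z by auto
  then have D: "D > 0" by (simp add: D_def)
  have sq: "(cmod (1 + z))\<^sup>2 = D - 4 * (- Re z)"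
    unfolding D_def cmod_power2 by (simp add: power2_eq_square algebra_simps)
  have y0: "y \<ge> 0" unfolding y_def using z D by (intro divide_nonneg_pos) auto
  have y1: "y \<le> 1 / 2"
  proof -
    have "0 \<le> (cmod (1 + z))\<^sup>2" by simp
    then show ?thesis unfolding sq using D by (simp add: y_def field_simps)
  qed
  have "(cmod ((1 + z) / (1 - z)))\<^sup>2 = 1 - 2 * y"
    using D by (simp add: norm_divide power_divide sq D_def[symmetric] y_def field_simps)
  also have "\<dots> \<le> (1 - y)\<^sup>2" by (simp add: power2_eq_square algebra_simps)
  finally have r: "cmod ((1 + z) / (1 - z)) \<le> 1 - y" by (rule power2_le_imp_le) (use y1 in simp)
  have "(1 - y) ^ n * (real n * y) \<le> (1 - y) ^ n * (1 + real n * y)"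
    using y1 by (intro mult_left_mono) auto
  also have "\<dots> \<le> (1 - y) ^ n * (1 + y) ^ n"
    using y0 y1 by (intro mult_left_mono Bernoulli_inequality) auto
  also have "\<dots> = (1 - y\<^sup>2) ^ n"
    by (simp add: power_mult_distrib[symmetric] power2_eq_square algebra_simps)
  also have "\<dots> \<le> 1" using y0 y1 by (intro power_le_one) (auto simp: power2_eq_square intro: mult_le_one)
  finally have "(1 - y) ^ n * (real n * y) \<le> 1" .
  moreover have "cmod ((1 + z) / (1 - z)) ^ n * (real n * y) \<le> (1 - y) ^ n * (real n * y)"
    using r y0 by (intro mult_right_mono power_mono) auto
  ultimately have "cmod ((1 + z) / (1 - z)) ^ n * (real n * y) \<le> 1" by linarith
  then have "cmod ((1 + z) / (1 - z)) ^ n * (- Re z) * (2 * real n) \<le> D"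
    unfolding y_def using D by (simp add: field_simps)
  also have "D \<le> ((1 + 1 / d) * cmod z)\<^sup>2"
    unfolding D_def
  proof (rule power_mono)
    have "cmod (1 - z) \<le> 1 + cmod z" using norm_triangle_ineq4[of 1 z] by simp
    also have "1 \<le> cmod z / d" using d by simp
    finally show "cmod (1 - z) \<le> (1 + 1 / d) * cmod z" by (simp add: algebra_simps)
  qed simp
  finally have "cmod ((1 + z) / (1 - z)) ^ n * (- Re z) * (2 * real n) \<le> (1 + 1 / d)\<^sup>2 * (cmod z)\<^sup>2"
    by (simp add: power_mult_distrib)
  moreover have "0 \<le> cmod ((1 + z) / (1 - z)) ^ n * (- Re z) * real n"
    using z by (intro mult_nonneg_nonneg) auto
  ultimately have "cmod ((1 + z) / (1 - z)) ^ n * (- Re z) * real n \<le> (1 + 1 / d)\<^sup>2 * (cmod z)\<^sup>2"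
    by argo
  then show ?thesis using n by (simp add: field_simps)
qed

text \<open>The decay at \<open>t = 1 / w\<close> gives \<open>v \<le> exp 1 * c * w\<close> if this
  time is admissible. Otherwise \<open>t\<^sub>0 * w > 1\<close>, so the trivial bound
  \<open>m\<close> is at most \<open>m * t\<^sub>0 * w\<close>.\<close>

lemma exp_decay_imp_linear_bound:
  fixes v :: real
  assumes v: "v \<le> m" "m \<ge> 0" and w: "w > 0" and c: "c \<ge> 0" and t\<^sub>0: "t\<^sub>0 > 0"
    and dec: "\<And>t. t \<ge> t\<^sub>0 \<Longrightarrow> exp (- (t * w)) * v \<le> c / t"
  shows "v \<le> (exp 1 * c + m * t\<^sub>0) * w"
proof (cases "t\<^sub>0 \<le> 1 / w")
  case True
  have "exp (- 1) * v \<le> c * w" using dec[OF True] w by simp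
  then have "v \<le> exp 1 * (c * w)" by (simp add: exp_minus field_simps)
  moreover have "0 \<le> m * t\<^sub>0 * w" using v w t\<^sub>0 by simp
  ultimately show ?thesis by (simp add: algebra_simps)
next
  case False
  then have "1 \<le> t\<^sub>0 * w" using w by (simp add: field_simps)
  then have "m * 1 \<le> m * (t\<^sub>0 * w)" using v by (intro mult_left_mono) auto
  moreover have "0 \<le> exp 1 * c * w" using c w by simp
  ultimately show ?thesis using v by (simp add: algebra_simps)
qed

text \<open>Makes a lower bound for the modulus of the symbol a bound for the resolvents, uniform in
  \<open>s \<ge> 0\<close>.\<close>

lemma cmod_le_cmod_diff_of_real:
  assumes "Re u < 0" "s \<ge> 0"
  shows "cmod u \<le> cmod (complex_of_real s - u)"
proof (rule power2_le_imp_le)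
  have "s * Re u \<le> 0" using assms by (simp add: mult_nonneg_nonpos)
  then have "2 * (s * Re u) \<le> s * s" using zero_le_square[of s] by linarith
  then show "(cmod u)\<^sup>2 \<le> (cmod (complex_of_real s - u))\<^sup>2"
    unfolding cmod_power2 by (simp add: power2_eq_square algebra_simps)
qed simp

section \<open>Multiplication operators on \<open>C\<^sub>0(\<Omega>)\<close>\<close>

lemma c0_multiplication:
  fixes \<psi> :: "'v::topological_space \<Rightarrow> complex"
  assumes cont: "continuous_on UNIV \<psi>" and b: "\<And>x. cmod (\<psi> x) \<le> b"
  shows "\<exists>L. complex_linear L \<and> (\<forall>f x. c0_apply (blinfun_apply L f) x = \<psi> x * c0_apply f x)"
proof -
  have b0: "b \<ge> 0" using b[of undefined] norm_ge_zero order_trans by blast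
  have ap: "c0_apply (C0 (\<lambda>x. \<psi> x * c0_apply f x)) = (\<lambda>x. \<psi> x * c0_apply f x)" for f
  proof (rule c0_memI)
    show "continuous_on UNIV (\<lambda>x. \<psi> x * c0_apply f x)"
      by (intro continuous_intros cont c0_continuous)
  next
    fix e :: real assume e: "e > 0"
    \<comment> \<open>\<open>b + 1\<close> avoids a division by zero when
      \<open>b = 0\<close>.\<close>
    then have "e / (b + 1) > 0" using b0 by simp
    then obtain K where K: "compact K" "\<And>x. x \<notin> K \<Longrightarrow> cmod (c0_apply f x) < e / (b + 1)"
      using c0_vanish by blast
    have "cmod (\<psi> x * c0_apply f x) < e" if "x \<notin> K" for x
    proof -
      have "cmod (\<psi> x) * cmod (c0_apply f x) \<le> b * (e / (b + 1))"
        using K(2)[OF that] b by (intro mult_mono) (auto simp: b0)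
      also have "\<dots> < e" using e b0 by (simp add: field_simps)
      finally show ?thesis by (simp add: norm_mult)
    qed
    then show "\<exists>K. compact K \<and> (\<forall>x. x \<notin> K \<longrightarrow> cmod (\<psi> x * c0_apply f x) < e)" using K(1) by blast
  qed
  define g where "g f = C0 (\<lambda>x. \<psi> x * c0_apply f x)" for f
  have g: "c0_apply (g f) x = \<psi> x * c0_apply f x" for f x by (simp add: g_def ap)
  have "bounded_linear g"
  proof (rule bounded_linear_intro)
    show "norm (g f) \<le> norm f * b" for f
    proof (rule c0_norm_least)
      fix x
      have "cmod (\<psi> x) * cmod (c0_apply f x) \<le> b * norm f"
        by (intro mult_mono b c0_norm_upper b0) simp
      then show "cmod (c0_apply (g f) x) \<le> norm f * b" by (simp add: g norm_mult mult.commute)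
    qed
  qed (rule c0_eqI; simp add: g c0_apply_simps algebra_simps)+
  then have "blinfun_apply (Blinfun g) = g" by (rule bounded_linear_Blinfun_apply)
  then show ?thesis
    by (intro exI[of _ "Blinfun g"]) (auto simp: g complex_linear_def c0_apply_scaleC intro!: c0_eqI)
qed

lemma bounded_linear_c0_apply: "bounded_linear (\<lambda>f. c0_apply f x)"
  by (rule bounded_linear_intro[where K = 1]) (simp_all add: c0_apply_simps c0_norm_upper)

text \<open>At a fixed point \<open>x\<close> the orbit of a domain element solves a scalar linear
  equation with coefficient \<open>\<phi> x\<close>. A general \<open>h\<close> is
  \<open>- \<phi> f\<close> with \<open>f = B h\<close> in the domain, and multiplication by
  \<open>\<phi> x\<close> carries the formula from \<open>f\<close> to \<open>h\<close>.\<close>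

lemma c0_semigroup_apply:
  fixes \<phi> :: "'v::topological_space \<Rightarrow> complex"
  assumes T: "C0_semigroup T" and gen: "generator T = C0_mult_op \<phi>" and t: "t \<ge> 0"
    and 0: "0 \<in> resolvent_set (generator T)"
  shows "c0_apply (T t h) x = exp (complex_of_real t * \<phi> x) * c0_apply h x"
proof -
  let ?B = "resolvent (generator T) 0"
  define f where "f = ?B h"
  have B: "- c0_apply u x = \<phi> x * c0_apply (?B u) x" for u x
    using resolvent_range[OF 0, of u] by (simp add: gen C0_mult_op_def scaleC_zero c0_apply_simps)
  have fg: "(f, - h) \<in> generator T"
    using resolvent_range[OF 0, of h] by (simp add: f_def scaleC_zero)
  define u where "u s = exp (- (complex_of_real s * \<phi> x)) * c0_apply (T s f) x" for s
  have "(u has_vector_derivative 0) (at s within {0..})" if s: "s \<ge> 0" for s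
  proof -
    have "((\<lambda>s. c0_apply (T s f) x) has_vector_derivative c0_apply (T s (- h)) x) (at s within {0..})"
      by (rule bounded_linear.has_vector_derivative[OF bounded_linear_c0_apply])
        (rule semigroup_has_vector_derivative[OF T fg s])
    moreover have "c0_apply (T s (- h)) x = \<phi> x * c0_apply (T s f) x"
      using generator_semigroup[OF T fg s] by (simp add: gen C0_mult_op_def)
    moreover have "((\<lambda>s. exp (- (complex_of_real s * \<phi> x))) has_vector_derivative
        - \<phi> x * exp (- (complex_of_real s * \<phi> x))) (at s within {0..})"
      by (rule has_vector_derivative_at_within)
        (rule has_vector_derivative_real_field, auto intro!: derivative_eq_intros)
    ultimately show ?thesis
      unfolding u_def using has_vector_derivative_mult by (fastforce simp: algebra_simps)
  qed
  then obtain k where k: "\<And>s. s \<in> {0..} \<Longrightarrow> u s = k"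
    using has_vector_derivative_zero_constant[of "{0..}" u] by auto
  have "u t = u 0" using k t by simp
  then have f: "c0_apply (T t f) x = exp (complex_of_real t * \<phi> x) * c0_apply f x"
    by (simp add: u_def semigroup_0[OF T] exp_minus field_simps)
  have "\<phi> x * c0_apply (T t f) x = - c0_apply (T t h) x"
    using B[of "T t h" x] by (simp add: f_def resolvent_commute_semigroup[OF T 0 t])
  then show ?thesis
    using B[of h x] f by (simp add: f_def[symmetric]) (metis minus_equation_iff mult.left_commute mult_minus_right)
qed

section \<open>Case (b)(ii): decay on the space of continuous functions vanishing at
  infinity\<close>

lemma cayley_decay_C0:
  fixes \<phi> :: "'v::topological_space \<Rightarrow> complex"
  assumes cont: "continuous_on UNIV \<phi>" and range: "closure (range \<phi>) \<subseteq> {z. Re z < 0}"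
    and T: "C0_semigroup T" and gen: "generator T = C0_mult_op \<phi>" and A: "A = C0_mult_op \<phi>"
    and a: "\<alpha> > 0" and decay: "(\<lambda>t. norm (T t o\<^sub>L neg_inv_powr A \<alpha>)) \<in> O(\<lambda>t. 1 / t)"
  shows "(\<lambda>n. norm (blinfun_power (cayley A) n o\<^sub>L neg_inv_powr A (\<alpha> + 2))) \<in> O(\<lambda>n. 1 / real n)"
proof -
  have Re: "Re (\<phi> x) < 0" for x using range closure_subset[of "range \<phi>"] by blast
  \<comment> \<open>A whole ball about \<open>0\<close> misses the range, so the symbol is bounded
    away from \<open>0\<close>.\<close>
  have "0 \<notin> closure (range \<phi>)" using range by auto
  then obtain d where d: "d > 0" "\<And>x. d \<le> cmod (\<phi> x)"
    by (auto simp: closure_approachable not_less)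
  have res: "complex_of_real s \<in> resolvent_set A \<and>
      (\<forall>f x. c0_apply (resolvent A (complex_of_real s) f) x = 1 / (complex_of_real s - \<phi> x) * c0_apply f x)"
    if s: "s \<ge> 0" for s
  proof -
    have ge: "d \<le> cmod (complex_of_real s - \<phi> x)" for x
      using cmod_le_cmod_diff_of_real[OF Re s] d(2)[of x] order_trans by blast
    then have nz: "complex_of_real s - \<phi> x \<noteq> 0" for x using d(1) by (metis norm_zero not_le)
    have "cmod (1 / (complex_of_real s - \<phi> x)) \<le> 1 / d" for x
      using ge[of x] d(1) by (simp add: norm_divide frac_le)
    moreover have "continuous_on UNIV (\<lambda>x. 1 / (complex_of_real s - \<phi> x))"
      by (intro continuous_intros cont) (use nz in auto)
    ultimately obtain L where L: "complex_linear L"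
      "\<And>f x. c0_apply (blinfun_apply L f) x = 1 / (complex_of_real s - \<phi> x) * c0_apply f x"
      using c0_multiplication[of "\<lambda>x. 1 / (complex_of_real s - \<phi> x)" "1 / d"] by blast
    have "L (complex_of_real s *\<^sub>C f - g) = f" if "(f, g) \<in> A" for f g
    proof (rule c0_eqI)
      fix x
      have "c0_apply g x = \<phi> x * c0_apply f x" using that by (simp add: A C0_mult_op_def)
      then show "c0_apply (L (complex_of_real s *\<^sub>C f - g)) x = c0_apply f x"
        using nz[of x] by (simp add: L c0_apply_simps c0_apply_scaleC field_simps)
    qed
    moreover have "(L u, complex_of_real s *\<^sub>C L u - u) \<in> A" for u
    proof -
      have "c0_apply (complex_of_real s *\<^sub>C L u - u) x = \<phi> x * c0_apply (L u) x" for x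
        using nz[of x] by (simp add: L c0_apply_simps c0_apply_scaleC field_simps)
      then show ?thesis by (simp add: A C0_mult_op_def)
    qed
    ultimately show ?thesis using resolventI[OF L(1)] L(2) by simp
  qed
  define B where "B = resolvent A 0"
  define M where "M = neg_inv_powr A \<alpha>"
  have B: "c0_apply (B f) x = - (c0_apply f x / \<phi> x)" for f x using res[of 0] by (simp add: B_def)
  have sv: "y = y'" if "(x, y) \<in> A" "(x, y') \<in> A" for x y y'
    using that by (auto simp: A C0_mult_op_def intro!: c0_eqI)
  have C: "c0_apply (cayley A f) x = (1 + \<phi> x) / (1 - \<phi> x) * c0_apply f x" for f x
  proof -
    have nz: "1 - \<phi> x \<noteq> 0" using Re[of x] by auto
    have "cayley A = 2 *\<^sub>R resolvent A 1 - id_blinfun"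
      by (rule cayley_eq) (use res[of 1] sv in auto)
    then have "c0_apply (cayley A f) x = 2 * (c0_apply f x / (1 - \<phi> x)) - c0_apply f x"
      using res[of 1] by (simp add: blinfun.diff_left blinfun.scaleR_left c0_apply_simps scaleR_conv_of_real)
    then show ?thesis using nz by (simp add: field_simps)
  qed
  have Cn: "c0_apply (blinfun_power (cayley A) n f) x = ((1 + \<phi> x) / (1 - \<phi> x)) ^ n * c0_apply f x" for n f x
    by (induction n) (simp_all add: C)
  have zero: "0 \<in> resolvent_set (generator T)" using res[of 0] A gen by simp
  have \<phi>0: "\<phi> x \<noteq> 0" for x using d(1) d(2)[of x] by auto
  obtain c t\<^sub>0 where c: "c > 0" and t\<^sub>0: "t\<^sub>0 > 0" and dec: "\<And>t. t \<ge> t\<^sub>0 \<Longrightarrow> norm (T t o\<^sub>L M) \<le> c / t"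
    using bigo_one_over_realD[OF decay norm_ge_zero] by (auto simp: M_def)
  define k where "k = exp 1 * c + norm M * t\<^sub>0"
  have k0: "k \<ge> 0" using c t\<^sub>0 by (simp add: k_def)
  have M_le: "cmod (c0_apply (M h) x) \<le> (k * norm h) * (- Re (\<phi> x))" for h x
  proof -
    \<comment> \<open>The scalar lemma is used at one point, with \<open>w = - Re (\<phi> x)\<close>
      and decay constant \<open>c * norm h\<close>.\<close>
    have "cmod (c0_apply (M h) x) \<le> (exp 1 * (c * norm h) + norm M * norm h * t\<^sub>0) * (- Re (\<phi> x))"
    proof (rule exp_decay_imp_linear_bound[OF _ _ _ _ t\<^sub>0])
      show "cmod (c0_apply (M h) x) \<le> norm M * norm h"
        using c0_norm_upper norm_blinfun order_trans by blast
      fix t assume t: "t\<^sub>0 \<le> t"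
      have "exp (- (t * - Re (\<phi> x))) * cmod (c0_apply (M h) x) = cmod (c0_apply (T t (M h)) x)"
        using t t\<^sub>0 by (simp add: c0_semigroup_apply[OF T gen _ zero] norm_mult)
      also have "\<dots> \<le> norm ((T t o\<^sub>L M) h)" using c0_norm_upper by simp
      also have "\<dots> \<le> c / t * norm h" by (rule norm_blinfun_le[OF dec[OF t]])
      finally show "exp (- (t * - Re (\<phi> x))) * cmod (c0_apply (M h) x) \<le> c * norm h / t" by simp
    qed (use Re c in auto)
    then show ?thesis by (simp add: k_def algebra_simps)
  qed
  have final: "norm (blinfun_power (cayley A) n o\<^sub>L neg_inv_powr A (\<alpha> + 2)) \<le> (k * (1 + 1 / d)\<^sup>2) / real n"
    if n: "n > 0" for n
  proof (intro norm_blinfun_bound c0_norm_least)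
    fix h x
    let ?r = "cmod ((1 + \<phi> x) / (1 - \<phi> x)) ^ n"
    have "cmod (c0_apply ((blinfun_power (cayley A) n o\<^sub>L neg_inv_powr A (\<alpha> + 2)) h) x)
        = ?r * cmod (c0_apply (M h) x) / (cmod (\<phi> x))\<^sup>2"
      using a by (simp add: neg_inv_powr_add_2 B_def[symmetric] M_def[symmetric] Cn B norm_mult norm_divide
          norm_power power2_eq_square)
    \<comment> \<open>The factor \<open>- Re (\<phi> x)\<close> gained from \<open>M\<close> is the
      one that \<open>norm_cayley_power\<close> asks for, and the two inverses \<open>B\<close>
      cancel \<open>|\<phi> x|^2\<close>.\<close>
    also have "\<dots> \<le> ?r * ((k * norm h) * (- Re (\<phi> x))) / (cmod (\<phi> x))\<^sup>2"
      by (intro divide_right_mono mult_left_mono M_le) auto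
    also have "\<dots> = (k * norm h) * (?r * (- Re (\<phi> x))) / (cmod (\<phi> x))\<^sup>2" by (simp add: mult_ac)
    also have "\<dots> \<le> (k * norm h) * ((1 + 1 / d)\<^sup>2 * (cmod (\<phi> x))\<^sup>2 / real n) / (cmod (\<phi> x))\<^sup>2"
      by (intro divide_right_mono mult_left_mono norm_cayley_power Re d n) (use k0 in auto)
    also have "\<dots> = (k * (1 + 1 / d)\<^sup>2) / real n * norm h"
      using \<phi>0[of x] by simp
    finally show "cmod (c0_apply ((blinfun_power (cayley A) n o\<^sub>L neg_inv_powr A (\<alpha> + 2)) h) x)
        \<le> (k * (1 + 1 / d)\<^sup>2) / real n * norm h" .
  qed (use k0 in simp)
  show ?thesis
    by (rule bigo_one_over_natI[where c = "k * (1 + 1 / d)\<^sup>2"]) (use final in simp)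
qed

section \<open>Multiplication operators on \<open>L\<^sup>p(\<Omega>, \<mu>)\<close>\<close>

text \<open>Two mean value inequalities in the closed left half-plane: \<open>exp\<close> is
  1-Lipschitz there, and this bounds the derivative of \<open>exp u - u * exp b\<close> along the
  segment. The quadratic remainder gives norm differentiability of orbits below.\<close>

lemma norm_exp_taylor:
  fixes a b :: complex
  assumes a: "Re a \<le> 0" and b: "Re b \<le> 0"
  shows "cmod (exp a - exp b - (a - b) * exp b) \<le> (cmod (a - b))\<^sup>2"
proof -
  let ?S = "{z. Re z \<le> 0}"
  have conv: "convex ?S" by (rule convex_halfspace_Re_le)
  have 1: "cmod (exp u - exp v) \<le> 1 * cmod (u - v)" if "u \<in> ?S" "v \<in> ?S" for u v
    by (rule field_differentiable_bound[OF conv _ _ that, of exp exp])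
      (auto intro: DERIV_subset[OF DERIV_exp])
  have seg: "closed_segment b a \<subseteq> ?S"
    using a b conv by (simp add: closed_segment_subset)
  have "cmod ((exp a - a * exp b) - (exp b - b * exp b)) \<le> cmod (a - b) * cmod (a - b)"
  proof (rule field_differentiable_bound[where S = "closed_segment b a" and f' = "\<lambda>u. exp u - exp b"])
    fix u assume u: "u \<in> closed_segment b a"
    show "((\<lambda>u. exp u - u * exp b) has_field_derivative exp u - exp b) (at u within closed_segment b a)"
      by (auto intro!: derivative_eq_intros)
    have "cmod (exp u - exp b) \<le> cmod (u - b)" using 1[of u b] u seg b by auto
    also have "\<dots> \<le> cmod (a - b)" using segment_bound(1)[OF u] by simp
    finally show "cmod (exp u - exp b) \<le> cmod (a - b)" .
  qed auto
  then show ?thesis by (simp add: power2_eq_square algebra_simps)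
qed

lemma Lp_measurable: "f \<in> Lp_functions \<mu> p \<Longrightarrow> f \<in> borel_measurable \<mu>"
  by (simp add: Lp_functions_def)

section \<open>Multiplication by functions on \<open>L^p\<close>\<close>

context
  fixes \<mu> :: "'w measure" and p :: real and J :: "('w \<Rightarrow> complex) \<Rightarrow> 'x::complex_banach"
  assumes p: "1 \<le> p" and J: "is_Lp_space \<mu> p J"
begin

lemma Lp_dominated:
  assumes f: "f \<in> Lp_functions \<mu> p" and g: "g \<in> borel_measurable \<mu>" and b: "b \<ge> 0"
    and le: "\<And>x. x \<in> space \<mu> \<Longrightarrow> cmod (g x) \<le> b * cmod (f x)"
  shows "g \<in> Lp_functions \<mu> p" "norm (J g) \<le> b * norm (J f)"
proof -
  have fi: "integrable \<mu> (\<lambda>x. cmod (f x) powr p)" using f by (simp add: Lp_functions_def)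
  have le': "cmod (g x) powr p \<le> b powr p * cmod (f x) powr p" if "x \<in> space \<mu>" for x
    using powr_mono2[of p "cmod (g x)" "b * cmod (f x)"] le[OF that] p b by (simp add: powr_mult)
  have gi: "integrable \<mu> (\<lambda>x. cmod (g x) powr p)"
    by (rule Bochner_Integration.integrable_bound[of _ "\<lambda>x. b powr p * cmod (f x) powr p"])
      (use fi g le' in auto)
  then show gL: "g \<in> Lp_functions \<mu> p" using g by (simp add: Lp_functions_def)
  have "(\<integral>x. cmod (g x) powr p \<partial>\<mu>) \<le> (\<integral>x. b powr p * cmod (f x) powr p \<partial>\<mu>)"
    by (rule integral_mono) (use gi fi le' in auto)
  then have "Lp_norm \<mu> p g \<le> (b powr p * (\<integral>x. cmod (f x) powr p \<partial>\<mu>)) powr (1 / p)"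
    unfolding Lp_norm_def by (intro powr_mono2) (use p in auto)
  also have "\<dots> = b * Lp_norm \<mu> p f"
    using p b by (simp add: powr_mult powr_powr Lp_norm_def)
  finally show "norm (J g) \<le> b * norm (J f)" using J gL f by (simp add: is_Lp_space_def)
qed

lemma Lp_add:
  assumes f: "f \<in> Lp_functions \<mu> p" and g: "g \<in> Lp_functions \<mu> p"
  shows "(\<lambda>x. f x + g x) \<in> Lp_functions \<mu> p"
proof -
  have "cmod (f x + g x) powr p \<le> 2 powr p * (cmod (f x) powr p + cmod (g x) powr p)" for x
  proof -
    have "cmod (f x + g x) \<le> 2 * max (cmod (f x)) (cmod (g x))"
      using norm_triangle_ineq[of "f x" "g x"] by linarith
    then have "cmod (f x + g x) powr p \<le> (2 * max (cmod (f x)) (cmod (g x))) powr p"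
      using p by (intro powr_mono2) auto
    also have "\<dots> = 2 powr p * max (cmod (f x)) (cmod (g x)) powr p"
      by (rule powr_mult)
    also have "\<dots> \<le> 2 powr p * (cmod (f x) powr p + cmod (g x) powr p)"
      by (intro mult_left_mono) (auto simp: max_def)
    finally show ?thesis .
  qed
  then have "AE x in \<mu>. norm (cmod (f x + g x) powr p) \<le> norm (2 powr p * (cmod (f x) powr p + cmod (g x) powr p))"
    by simp
  moreover have i: "integrable \<mu> (\<lambda>x. 2 powr p * (cmod (f x) powr p + cmod (g x) powr p))"
    using f g by (simp add: Lp_functions_def)
  moreover have m: "(\<lambda>x. cmod (f x + g x) powr p) \<in> borel_measurable \<mu>"
    using Lp_measurable[OF f] Lp_measurable[OF g] by measurable
  ultimately have "integrable \<mu> (\<lambda>x. cmod (f x + g x) powr p)"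
    using Bochner_Integration.integrable_bound[OF i m] by blast
  then show ?thesis using f g by (auto simp: Lp_functions_def intro!: borel_measurable_add)
qed

lemma Lp_bounded_mult:
  assumes f: "f \<in> Lp_functions \<mu> p" and \<psi>: "\<psi> \<in> borel_measurable \<mu>"
    and b: "\<And>x. x \<in> space \<mu> \<Longrightarrow> cmod (\<psi> x) \<le> b" "b \<ge> 0"
  shows "(\<lambda>x. \<psi> x * f x) \<in> Lp_functions \<mu> p" "norm (J (\<lambda>x. \<psi> x * f x)) \<le> b * norm (J f)"
proof -
  have "cmod (\<psi> x * f x) \<le> b * cmod (f x)" if "x \<in> space \<mu>" for x
    using b(1)[OF that] by (simp add: norm_mult mult_right_mono)
  moreover have "(\<lambda>x. \<psi> x * f x) \<in> borel_measurable \<mu>"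
    using Lp_measurable[OF f] \<psi> by simp
  ultimately show "(\<lambda>x. \<psi> x * f x) \<in> Lp_functions \<mu> p" "norm (J (\<lambda>x. \<psi> x * f x)) \<le> b * norm (J f)"
    using Lp_dominated[OF f _ b(2)] by blast+
qed

lemma Lp_cmult: "f \<in> Lp_functions \<mu> p \<Longrightarrow> (\<lambda>x. c * f x) \<in> Lp_functions \<mu> p"
  by (rule Lp_bounded_mult[of f "\<lambda>_. c" "cmod c"]) auto

lemma J_add: "f \<in> Lp_functions \<mu> p \<Longrightarrow> g \<in> Lp_functions \<mu> p \<Longrightarrow> J (\<lambda>x. f x + g x) = J f + J g"
  using J by (simp add: is_Lp_space_def)

lemma J_cmult: "f \<in> Lp_functions \<mu> p \<Longrightarrow> J (\<lambda>x. c * f x) = c *\<^sub>C J f"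
  using J by (simp add: is_Lp_space_def)

lemma Lp_diff:
  assumes "f \<in> Lp_functions \<mu> p" "g \<in> Lp_functions \<mu> p"
  shows "(\<lambda>x. f x - g x) \<in> Lp_functions \<mu> p" "J (\<lambda>x. f x - g x) = J f - J g"
  using Lp_add[OF assms(1) Lp_cmult[OF assms(2), of "-1"]]
    J_add[OF assms(1) Lp_cmult[OF assms(2), of "-1"]] J_cmult[OF assms(2), of "-1"]
  by (simp_all add: scaleC_minus_one)

lemma J_surj: obtains f where "f \<in> Lp_functions \<mu> p" "x = J f"
proof -
  have "x \<in> J ` Lp_functions \<mu> p" using J by (simp add: is_Lp_space_def)
  then show thesis using that by blast
qed

lemma Lp_multiplication:
  assumes \<psi>: "\<psi> \<in> borel_measurable \<mu>" and b: "\<And>x. x \<in> space \<mu> \<Longrightarrow> cmod (\<psi> x) \<le> b" "b \<ge> 0"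
  shows "\<exists>L. complex_linear L \<and> (\<forall>f\<in>Lp_functions \<mu> p. blinfun_apply L (J f) = J (\<lambda>x. \<psi> x * f x))"
proof -
  note m = Lp_bounded_mult[OF _ \<psi> b]
  \<comment> \<open>Each class is given a chosen representative; the bound by \<open>b\<close>,
    applied to a difference of two representatives, shows that the result is independent of the
    choice.\<close>
  define rep where "rep x = (SOME f. f \<in> Lp_functions \<mu> p \<and> x = J f)" for x
  have "\<exists>f. f \<in> Lp_functions \<mu> p \<and> x = J f" for x using J_surj by metis
  then have rep: "rep x \<in> Lp_functions \<mu> p" "J (rep x) = x" for x
    using someI_ex[of "\<lambda>f. f \<in> Lp_functions \<mu> p \<and> x = J f"] by (auto simp: rep_def)
  define h where "h x = J (\<lambda>w. \<psi> w * rep x w)" for x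
  have h: "h (J f) = J (\<lambda>w. \<psi> w * f w)" if f: "f \<in> Lp_functions \<mu> p" for f
  proof -
    define g where "g w = rep (J f) w - f w" for w
    have g: "g \<in> Lp_functions \<mu> p" "J g = 0"
      using Lp_diff[OF rep(1) f, of "J f"] by (simp_all add: g_def[abs_def] rep(2))
    have "h (J f) - J (\<lambda>w. \<psi> w * f w) = J (\<lambda>w. \<psi> w * rep (J f) w - \<psi> w * f w)"
      unfolding h_def by (rule Lp_diff(2)[OF m(1)[OF rep(1)] m(1)[OF f], symmetric])
    also have "(\<lambda>w. \<psi> w * rep (J f) w - \<psi> w * f w) = (\<lambda>w. \<psi> w * g w)"
      by (simp add: g_def algebra_simps)
    finally have "norm (h (J f) - J (\<lambda>w. \<psi> w * f w)) \<le> b * norm (J g)" using m(2)[OF g(1)] by simp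
    then show ?thesis using g(2) by simp
  qed
  have "bounded_linear h"
  proof (rule bounded_linear_intro)
    fix x y
    obtain f g where f: "f \<in> Lp_functions \<mu> p" "x = J f" and g: "g \<in> Lp_functions \<mu> p" "y = J g"
      using J_surj by metis
    show "h (x + y) = h x + h y"
      using J_add[OF m(1)[OF f(1)] m(1)[OF g(1)]] h[OF Lp_add[OF f(1) g(1)]]
      by (simp add: f g h J_add[symmetric] distrib_left)
    show "norm (h x) \<le> norm x * b" using m(2)[OF f(1)] by (simp add: f h mult.commute)
    fix r
    show "h (r *\<^sub>R x) = r *\<^sub>R h x"
      using J_cmult[OF m(1)[OF f(1)], of "complex_of_real r"] h[OF Lp_cmult[OF f(1), of "complex_of_real r"]]
      by (simp add: f h J_cmult scaleC_of_real mult.left_commute)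
  qed
  then have ap: "blinfun_apply (Blinfun h) = h" by (rule bounded_linear_Blinfun_apply)
  have "complex_linear (Blinfun h)"
    unfolding complex_linear_def ap
  proof (intro allI)
    fix c x
    obtain f where f: "f \<in> Lp_functions \<mu> p" "x = J f" by (rule J_surj)
    show "h (c *\<^sub>C x) = c *\<^sub>C h x"
      using J_cmult[OF m(1)[OF f(1)], of c] h[OF Lp_cmult[OF f(1), of c]]
      by (simp add: f h J_cmult mult.left_commute)
  qed
  then show ?thesis using h by (intro exI[of _ "Blinfun h"]) (simp add: ap)
qed

lemma norm_J_powr:
  assumes "f \<in> Lp_functions \<mu> p"
  shows "ennreal (norm (J f) powr p) = (\<integral>\<^sup>+x. ennreal (cmod (f x) powr p) \<partial>\<mu>)"
proof -
  have "norm (J f) powr p = (\<integral>x. cmod (f x) powr p \<partial>\<mu>)"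
    using J p assms by (simp add: is_Lp_space_def Lp_norm_def powr_powr)
  then show ?thesis using assms
    by (subst nn_integral_eq_integral) (auto simp: Lp_functions_def)
qed

text \<open>The \<open>p\<close>-th power of the norm is the total mass of the measure with density
  \<open>|f|^p\<close>. It is additive over countably many pieces, so the local bounds add up with
  the same constant.\<close>

lemma Lp_countable_partition_bound:
  fixes X :: "'i::countable \<Rightarrow> 'w set"
  assumes f: "f \<in> Lp_functions \<mu> p" and g: "g \<in> Lp_functions \<mu> p" and k: "k \<ge> 0"
    and X: "\<And>i. X i \<in> sets \<mu>" "disjoint_family X" "(\<Union>i. X i) = space \<mu>"
    and le: "\<And>i. norm (J (\<lambda>x. indicator (X i) x * g x)) \<le> k * norm (J (\<lambda>x. indicator (X i) x * f x))"
  shows "norm (J g) \<le> k * norm (J f)"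
proof -
  define N where "N f = density \<mu> (\<lambda>x. ennreal (cmod (f x) powr p))" for f :: "'w \<Rightarrow> complex"
  have N: "emeasure (N f) S = ennreal (norm (J (\<lambda>x. indicator S x * f x)) powr p)"
    if f: "f \<in> Lp_functions \<mu> p" and S: "S \<in> sets \<mu>" for f S
  proof -
    have "(\<lambda>x. indicator S x * f x) \<in> Lp_functions \<mu> p"
      by (rule Lp_bounded_mult[OF f, of _ 1]) (use S in \<open>auto split: split_indicator\<close>)
    then have "ennreal (norm (J (\<lambda>x. indicator S x * f x)) powr p)
        = (\<integral>\<^sup>+x. ennreal (cmod (indicator S x * f x) powr p) \<partial>\<mu>)" by (rule norm_J_powr)
    also have "\<dots> = (\<integral>\<^sup>+x. ennreal (cmod (f x) powr p) * indicator S x \<partial>\<mu>)"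
      by (intro nn_integral_cong) (auto split: split_indicator)
    also have "\<dots> = emeasure (N f) S"
      unfolding N_def by (rule emeasure_density[symmetric]) (use Lp_measurable[OF f] S in auto)
    finally show ?thesis by simp
  qed
  have tot: "ennreal (norm (J f) powr p) = (\<integral>\<^sup>+i. emeasure (N f) (X i) \<partial>count_space UNIV)"
    if f: "f \<in> Lp_functions \<mu> p" for f
  proof -
    have "ennreal (norm (J f) powr p) = (\<integral>\<^sup>+x. ennreal (cmod (f x) powr p) * indicator (space \<mu>) x \<partial>\<mu>)"
      unfolding norm_J_powr[OF f] by (intro nn_integral_cong) auto
    also have "\<dots> = emeasure (N f) (space \<mu>)"
      unfolding N_def by (rule emeasure_density[symmetric]) (use Lp_measurable[OF f] in auto)
    also have "\<dots> = emeasure (N f) (\<Union>i. X i)" by (simp add: X)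
    also have "\<dots> = (\<integral>\<^sup>+i. emeasure (N f) (X i) \<partial>count_space UNIV)"
      by (rule emeasure_UN_countable) (use X in \<open>auto simp: N_def\<close>)
    finally show ?thesis .
  qed
  have "ennreal (norm (J g) powr p) = (\<integral>\<^sup>+i. emeasure (N g) (X i) \<partial>count_space UNIV)" by (rule tot[OF g])
  also have "\<dots> \<le> (\<integral>\<^sup>+i. ennreal (k powr p) * emeasure (N f) (X i) \<partial>count_space UNIV)"
  proof (rule nn_integral_mono)
    fix i
    have "norm (J (\<lambda>x. indicator (X i) x * g x)) powr p \<le> k powr p * norm (J (\<lambda>x. indicator (X i) x * f x)) powr p"
      using powr_mono2[OF _ _ le[of i], of p] p k by (simp add: powr_mult)
    then show "emeasure (N g) (X i) \<le> ennreal (k powr p) * emeasure (N f) (X i)"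
      by (simp add: N f g X ennreal_mult[symmetric] ennreal_leI)
  qed
  also have "\<dots> = ennreal (k powr p) * ennreal (norm (J f) powr p)"
    by (simp add: nn_integral_cmult tot[OF f])
  also have "\<dots> = ennreal ((k * norm (J f)) powr p)"
    using k by (simp add: ennreal_mult[symmetric] powr_mult)
  finally have "norm (J g) powr p \<le> (k * norm (J f)) powr p" by (simp add: ennreal_le_iff)
  then show ?thesis
    using powr_less_mono2[of p "k * norm (J f)" "norm (J g)"] p k
    by (meson linorder_not_less mult_nonneg_nonneg norm_ge_zero not_one_le_zero order_less_le_trans zero_less_one)
qed

text \<open>Lets the symbol be changed on a null set, so that bounds known almost everywhere may be
  assumed at every point.\<close>

lemma Lp_mult_op_cong_AE:
  assumes \<phi>: "\<phi> \<in> borel_measurable \<mu>" and \<phi>': "\<phi>' \<in> borel_measurable \<mu>"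
    and ae: "AE x in \<mu>. \<phi> x = \<phi>' x"
  shows "Lp_mult_op \<mu> p J \<phi> = Lp_mult_op \<mu> p J \<phi>'"
proof -
  have *: "Lp_mult_op \<mu> p J \<phi> \<subseteq> Lp_mult_op \<mu> p J \<phi>'"
    if \<phi>: "\<phi> \<in> borel_measurable \<mu>" and \<phi>': "\<phi>' \<in> borel_measurable \<mu>"
      and ae: "AE x in \<mu>. \<phi> x = \<phi>' x" for \<phi> \<phi>'
  proof (clarsimp simp: Lp_mult_op_def)
    fix f assume f: "f \<in> Lp_functions \<mu> p" and g: "(\<lambda>x. \<phi> x * f x) \<in> Lp_functions \<mu> p"
    have [measurable]: "f \<in> borel_measurable \<mu>" "\<phi> \<in> borel_measurable \<mu>" "\<phi>' \<in> borel_measurable \<mu>"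
      using Lp_measurable[OF f] \<phi> \<phi>' by auto
    have "integrable \<mu> (\<lambda>x. cmod (\<phi> x * f x) powr p) \<longleftrightarrow> integrable \<mu> (\<lambda>x. cmod (\<phi>' x * f x) powr p)"
      by (rule integrable_cong_AE) (use ae in auto)
    then have g': "(\<lambda>x. \<phi>' x * f x) \<in> Lp_functions \<mu> p"
      using g by (simp add: Lp_functions_def)
    have d: "(\<lambda>x. \<phi> x * f x - \<phi>' x * f x) \<in> Lp_functions \<mu> p"
      "J (\<lambda>x. \<phi> x * f x - \<phi>' x * f x) = J (\<lambda>x. \<phi> x * f x) - J (\<lambda>x. \<phi>' x * f x)"
      by (rule Lp_diff[OF g g'])+
    have "(\<integral>x. cmod (\<phi> x * f x - \<phi>' x * f x) powr p \<partial>\<mu>) = 0"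
      by (rule integral_eq_zero_AE) (use ae in auto)
    then have "norm (J (\<lambda>x. \<phi> x * f x - \<phi>' x * f x)) = 0"
      using J d(1) by (simp add: is_Lp_space_def Lp_norm_def)
    then have "J (\<lambda>x. \<phi> x * f x) = J (\<lambda>x. \<phi>' x * f x)" using d(2) by simp
    then show "\<exists>fa. J f = J fa \<and> J (\<lambda>x. \<phi> x * f x) = J (\<lambda>x. \<phi>' x * fa x) \<and>
        fa \<in> Lp_functions \<mu> p \<and> (\<lambda>x. \<phi>' x * fa x) \<in> Lp_functions \<mu> p"
      using f g' by blast
  qed
  from *[OF \<phi> \<phi>' ae] *[OF \<phi>' \<phi>] ae show ?thesis by (auto simp: eq_commute)
qed

text \<open>As \<open>\<phi>\<close> is bounded where \<open>f\<close> does not vanish, the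
  candidate orbit stays in the domain and is differentiable in norm, so uniqueness of the Cauchy
  problem identifies it.\<close>

lemma Lp_semigroup_apply:
  assumes T: "C0_semigroup T" and gen: "generator T = Lp_mult_op \<mu> p J \<phi>" and t: "t \<ge> 0"
    and [measurable]: "\<phi> \<in> borel_measurable \<mu>" and Re: "\<And>x. Re (\<phi> x) < 0"
    and f: "f \<in> Lp_functions \<mu> p" and K: "\<And>x. f x \<noteq> 0 \<Longrightarrow> cmod (\<phi> x) \<le> K"
  shows "T t (J f) = J (\<lambda>x. exp (complex_of_real t * \<phi> x) * f x)"
proof -
  have [measurable]: "f \<in> borel_measurable \<mu>" by (rule Lp_measurable[OF f])
  \<comment> \<open>\<open>K\<close> may be negative when \<open>f\<close> vanishes
    everywhere.\<close>
  define K' where "K' = max K 0"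
  have K': "K' \<ge> 0" "\<And>x. f x \<noteq> 0 \<Longrightarrow> cmod (\<phi> x) \<le> K'" using K by (fastforce simp: K'_def)+
  have Re': "Re (complex_of_real s * \<phi> x) \<le> 0" if "s \<ge> 0" for s x
    using Re[of x] that by (simp add: mult_nonneg_nonpos)
  define e where "e s x = exp (complex_of_real s * \<phi> x) * f x" for s x
  have [measurable]: "e s \<in> borel_measurable \<mu>" for s unfolding e_def by measurable
  have e: "e s \<in> Lp_functions \<mu> p" if "s \<ge> 0" for s
    by (rule Lp_dominated[OF f, where b = 1]) (use Re' that in \<open>auto simp: e_def norm_mult mult_left_le_one_le\<close>)
  have \<phi>e: "(\<lambda>x. \<phi> x * e s x) \<in> Lp_functions \<mu> p" if "s \<ge> 0" for s
  proof (rule Lp_dominated[OF f _ K'(1)])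
    fix x
    have "cmod (\<phi> x) * cmod (exp (complex_of_real s * \<phi> x)) \<le> K' * 1" if "f x \<noteq> 0"
      using K'(2)[OF that] K'(1) Re'[OF \<open>s \<ge> 0\<close>, of x] by (intro mult_mono) auto
    from mult_right_mono[OF this, of "cmod (f x)"]
    show "cmod (\<phi> x * e s x) \<le> K' * cmod (f x)"
      by (cases "f x = 0") (auto simp: e_def norm_mult mult.assoc)
  qed measurable
  have "J (e t) = T t (J (e 0))"
  proof (rule cauchy_problem_unique[OF T t])
    fix s :: real assume s: "s \<ge> 0"
    show "(J (e s), J (\<lambda>x. \<phi> x * e s x)) \<in> generator T"
      using e[OF s] \<phi>e[OF s] by (auto simp: gen Lp_mult_op_def)
    \<comment> \<open>The Taylor remainder is at most \<open>(r - s)^2 |\<phi>|^2\<close> times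
      \<open>|f|\<close>; dividing by \<open>|r - s|\<close> leaves one factor that tends to
      \<open>0\<close>.\<close>
    have "norm ((J (e r) - J (e s)) /\<^sub>R (r - s) - J (\<lambda>x. \<phi> x * e s x)) \<le> \<bar>r - s\<bar> * (K'\<^sup>2 * norm (J f))"
      if r: "r \<ge> 0" "r \<noteq> s" for r
    proof -
      define h where "h x = e r x - e s x - complex_of_real (r - s) * (\<phi> x * e s x)" for x
      have Jh: "J h = J (e r) - J (e s) - (r - s) *\<^sub>R J (\<lambda>x. \<phi> x * e s x)"
        unfolding h_def
        by (simp only: Lp_diff(2)[OF Lp_diff(1)[OF e[OF r(1)] e[OF s]] Lp_cmult[OF \<phi>e[OF s]]]
            Lp_diff(2)[OF e[OF r(1)] e[OF s]] J_cmult[OF \<phi>e[OF s]] scaleC_of_real)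
      have "norm (J h) \<le> ((r - s)\<^sup>2 * K'\<^sup>2) * norm (J f)"
      proof (rule Lp_dominated(2)[OF f])
        show "h \<in> borel_measurable \<mu>" unfolding h_def by measurable
        fix x
        show "cmod (h x) \<le> (r - s)\<^sup>2 * K'\<^sup>2 * cmod (f x)"
        proof (cases "f x = 0")
          case False
          let ?a = "complex_of_real r * \<phi> x" and ?b = "complex_of_real s * \<phi> x"
          have "h x = (exp ?a - exp ?b - (?a - ?b) * exp ?b) * f x"
            by (simp add: h_def e_def algebra_simps)
          moreover have "cmod (exp ?a - exp ?b - (?a - ?b) * exp ?b) \<le> (cmod (?a - ?b))\<^sup>2"
            by (rule norm_exp_taylor[OF Re'[OF r(1)] Re'[OF s]])
          moreover have "(cmod (?a - ?b))\<^sup>2 \<le> (r - s)\<^sup>2 * K'\<^sup>2"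
          proof -
            have "?a - ?b = complex_of_real (r - s) * \<phi> x" by (simp add: left_diff_distrib)
            then have "cmod (?a - ?b) = \<bar>r - s\<bar> * cmod (\<phi> x)" by (simp only: norm_mult norm_of_real)
            then show ?thesis using K'(2)[OF False] by (simp add: power_mult_distrib mult_left_mono power_mono)
          qed
          ultimately show ?thesis by (simp add: norm_mult mult_right_mono)
        qed (simp add: h_def e_def)
      qed simp
      moreover have "(J (e r) - J (e s)) /\<^sub>R (r - s) - J (\<lambda>x. \<phi> x * e s x) = (1 / (r - s)) *\<^sub>R J h"
        using r by (simp add: Jh scaleR_diff_right inverse_eq_divide)
      ultimately show ?thesis
        using r by (simp add: divide_le_eq power2_eq_square mult_ac abs_mult[symmetric])
    qed
    then have "\<forall>\<^sub>F r in at s within {0..}. norm ((J (e r) - J (e s)) /\<^sub>R (r - s) - J (\<lambda>x. \<phi> x * e s x))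
        \<le> \<bar>r - s\<bar> * (K'\<^sup>2 * norm (J f))"
      by (auto simp: eventually_at_filter)
    moreover have "((\<lambda>r. \<bar>r - s\<bar> * (K'\<^sup>2 * norm (J f))) \<longlongrightarrow> 0) (at s within {0..})"
      by (rule tendsto_mult_left_zero[OF tendsto_abs_diff_0])
    ultimately have "((\<lambda>r. (J (e r) - J (e s)) /\<^sub>R (r - s) - J (\<lambda>x. \<phi> x * e s x)) \<longlongrightarrow> 0) (at s within {0..})"
      by (rule Lim_null_comparison)
    then show "((\<lambda>s. J (e s)) has_vector_derivative J (\<lambda>x. \<phi> x * e s x)) (at s within {0..})"
      unfolding has_vector_derivative_iff_tendsto by (rule LIM_zero_cancel)
  qed
  then show ?thesis by (simp add: e_def[abs_def])
qed

end

text \<open>Every point of the closed right half-plane has a ball with null preimage. By Lindelof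
  countably many of these balls have the same union, so \<open>\<phi>\<close> avoids them all almost
  everywhere; the ball about \<open>0\<close> supplies \<open>d\<close>.\<close>

lemma AE_essential_range:
  assumes [measurable]: "\<phi> \<in> borel_measurable \<mu>" and er: "essential_range \<mu> \<phi> \<subseteq> {z. Re z < 0}"
  shows "\<exists>d>0. AE x in \<mu>. Re (\<phi> x) < 0 \<and> d \<le> cmod (\<phi> x)"
proof -
  have "\<exists>e>0. emeasure \<mu> {x \<in> space \<mu>. dist (\<phi> x) z < e} = 0" if "Re z \<ge> 0" for z
  proof -
    have "z \<notin> essential_range \<mu> \<phi>" using er that by auto
    then show ?thesis by (auto simp: essential_range_def)
  qed
  then obtain e where e: "\<And>z. Re z \<ge> 0 \<Longrightarrow> e z > 0"
    "\<And>z. Re z \<ge> 0 \<Longrightarrow> emeasure \<mu> {x \<in> space \<mu>. dist (\<phi> x) z < e z} = 0" by metis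
  define F where "F = (\<lambda>z. ball z (e z)) ` {z. Re z \<ge> 0}"
  obtain F' where F': "F' \<subseteq> F" "countable F'" "\<Union>F' = \<Union>F"
    using Lindelof[of F] by (auto simp: F_def)
  have ae: "AE x in \<mu>. \<forall>S\<in>F'. \<phi> x \<notin> S"
  proof (subst AE_ball_countable[OF F'(2)], intro ballI)
    fix S assume "S \<in> F'"
    then obtain z where z: "Re z \<ge> 0" "S = ball z (e z)" using F'(1) by (auto simp: F_def)
    have "{x \<in> space \<mu>. dist (\<phi> x) z < e z} \<in> null_sets \<mu>" using e(2)[OF z(1)] by (intro null_setsI) auto
    from AE_not_in[OF this] show "AE x in \<mu>. \<phi> x \<notin> S"
      using AE_space by eventually_elim (auto simp: z dist_commute)
  qed
  have *: "Re y < 0 \<and> e 0 \<le> cmod y" if "\<forall>S\<in>F'. y \<notin> S" for y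
  proof -
    have y: "y \<notin> ball z (e z)" if "Re z \<ge> 0" for z
      using \<open>\<forall>S\<in>F'. y \<notin> S\<close> F'(3) that unfolding F_def by blast
    show ?thesis using y[of y] y[of 0] e(1)[of y] by (force simp: not_less)
  qed
  have "AE x in \<mu>. Re (\<phi> x) < 0 \<and> e 0 \<le> cmod (\<phi> x)"
    using ae by eventually_elim (rule *)
  then show ?thesis using e(1)[of 0] by auto
qed

section \<open>Case (b)(i): resolvents, Cayley transform and decay on \<open>L^p\<close>\<close>

context
  fixes \<mu> :: "'w measure" and p :: real and J :: "('w \<Rightarrow> complex) \<Rightarrow> 'x::complex_banach"
    and \<phi> :: "'w \<Rightarrow> complex" and d :: real
  assumes p: "1 \<le> p" and J: "is_Lp_space \<mu> p J"
    and \<phi>[measurable]: "\<phi> \<in> borel_measurable \<mu>"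
    and Re: "\<And>x. Re (\<phi> x) < 0" and d: "d > 0" "\<And>x. d \<le> cmod (\<phi> x)"
begin

lemma norm_resolvent_symbol:
  assumes s: "s \<ge> 0"
  shows "cmod (1 / (complex_of_real s - \<phi> x)) \<le> 1 / d"
proof -
  have "d \<le> cmod (complex_of_real s - \<phi> x)"
    using d(2) cmod_le_cmod_diff_of_real[OF Re s] by (rule order_trans)
  then show ?thesis using d(1) by (simp add: norm_divide frac_le)
qed

lemma Lp_resolvent:
  assumes s: "s \<ge> 0"
  shows "complex_of_real s \<in> resolvent_set (Lp_mult_op \<mu> p J \<phi>)"
    "f \<in> Lp_functions \<mu> p \<Longrightarrow> resolvent (Lp_mult_op \<mu> p J \<phi>) (complex_of_real s) (J f)
       = J (\<lambda>x. 1 / (complex_of_real s - \<phi> x) * f x)"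
proof -
  let ?s = "complex_of_real s"
  have ge: "cmod (\<phi> x) \<le> cmod (?s - \<phi> x)" for x by (rule cmod_le_cmod_diff_of_real[OF Re s])
  then have nz: "?s - \<phi> x \<noteq> 0" for x using d(1) d(2)[of x] by (metis norm_zero not_le order_trans)
  note b = norm_resolvent_symbol[OF s]
  have m: "(\<lambda>x. 1 / (?s - \<phi> x)) \<in> borel_measurable \<mu>" by measurable
  have d0: "1 / d \<ge> 0" using d by simp
  obtain L where L: "complex_linear L"
    "\<And>f. f \<in> Lp_functions \<mu> p \<Longrightarrow> blinfun_apply L (J f) = J (\<lambda>x. 1 / (?s - \<phi> x) * f x)"
    using Lp_multiplication[OF p J m b d0] by blast
  have 1: "L (?s *\<^sub>C x - y) = x" if xy: "(x, y) \<in> Lp_mult_op \<mu> p J \<phi>" for x y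
  proof -
    obtain f where f: "x = J f" "y = J (\<lambda>w. \<phi> w * f w)" "f \<in> Lp_functions \<mu> p"
      "(\<lambda>w. \<phi> w * f w) \<in> Lp_functions \<mu> p"
      using xy by (auto simp: Lp_mult_op_def)
    note D = Lp_diff[OF p J Lp_cmult[OF p J f(3), of ?s] f(4)]
    have "?s *\<^sub>C x - y = J (\<lambda>w. ?s * f w - \<phi> w * f w)"
      by (simp add: D(2) f(1,2) J_cmult[OF p J f(3)])
    then have "L (?s *\<^sub>C x - y) = J (\<lambda>w. 1 / (?s - \<phi> w) * (?s * f w - \<phi> w * f w))"
      by (simp only: L(2)[OF D(1)])
    also have "(\<lambda>w. 1 / (?s - \<phi> w) * (?s * f w - \<phi> w * f w)) = f"
      using nz by (auto simp: fun_eq_iff field_simps)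
    finally show ?thesis using f(1) by simp
  qed
  have 2: "(L u, ?s *\<^sub>C L u - u) \<in> Lp_mult_op \<mu> p J \<phi>" for u
  proof -
    obtain f where f: "f \<in> Lp_functions \<mu> p" "u = J f" by (rule J_surj[OF p J])
    define g where "g w = 1 / (?s - \<phi> w) * f w" for w
    have g: "g \<in> Lp_functions \<mu> p"
      unfolding g_def by (rule Lp_bounded_mult(1)[OF p J f(1) m b d0])
    \<comment> \<open>Although \<open>\<phi>\<close> may be unbounded, this identity puts
      \<open>\<phi> g\<close> into \<open>L^p\<close>, so \<open>J g\<close> is in the
      domain.\<close>
    have eq: "\<phi> w * g w = ?s * g w - f w" for w
      using nz[of w] by (simp add: g_def field_simps)
    have "(\<lambda>w. \<phi> w * g w) \<in> Lp_functions \<mu> p" "J (\<lambda>w. \<phi> w * g w) = ?s *\<^sub>C J g - u"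
      unfolding eq using Lp_diff[OF p J Lp_cmult[OF p J g, of ?s] f(1)] J_cmult[OF p J g, of ?s] f(2)
      by simp_all
    moreover have "L u = J g" by (simp add: f(2) L(2)[OF f(1)] g_def[abs_def])
    ultimately show ?thesis using g by (auto simp: Lp_mult_op_def)
  qed
  show "?s \<in> resolvent_set (Lp_mult_op \<mu> p J \<phi>)" by (rule resolventI(1)[OF L(1) 1 2])
  show "resolvent (Lp_mult_op \<mu> p J \<phi>) ?s (J f) = J (\<lambda>x. 1 / (?s - \<phi> x) * f x)"
    if "f \<in> Lp_functions \<mu> p"
    using resolventI(2)[OF L(1) 1 2] L(2)[OF that] by simp
qed

lemma Lp_cayley_power:
  assumes f: "f \<in> Lp_functions \<mu> p"
    and sv: "\<And>x y y'. (x, y) \<in> Lp_mult_op \<mu> p J \<phi> \<Longrightarrow> (x, y') \<in> Lp_mult_op \<mu> p J \<phi> \<Longrightarrow> y = y'"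
  defines "r \<equiv> \<lambda>x. (1 + \<phi> x) / (1 - \<phi> x)"
  shows "(\<lambda>x. r x ^ n * f x) \<in> Lp_functions \<mu> p \<and>
    blinfun_power (cayley (Lp_mult_op \<mu> p J \<phi>)) n (J f) = J (\<lambda>x. r x ^ n * f x)"
proof -
  let ?A = "Lp_mult_op \<mu> p J \<phi>"
  have nz: "1 - \<phi> x \<noteq> 0" for x using Re[of x] by auto
  have C: "cayley ?A = 2 *\<^sub>R resolvent ?A 1 - id_blinfun"
    by (rule cayley_eq[OF _ sv]) (use Lp_resolvent(1)[of 1] in simp)
  have step: "(\<lambda>x. r x * g x) \<in> Lp_functions \<mu> p \<and> cayley ?A (J g) = J (\<lambda>x. r x * g x)"
    if g: "g \<in> Lp_functions \<mu> p" for g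
  proof -
    define h where "h x = 1 / (1 - \<phi> x) * g x" for x
    have "cmod (1 / (1 - \<phi> x)) \<le> 1 / d" for x
      using norm_resolvent_symbol[of 1 x] by simp
    then have h: "h \<in> Lp_functions \<mu> p"
      unfolding h_def using d(1) by (intro Lp_bounded_mult(1)[OF p J g, where b = "1 / d"]) auto
    have eq: "r x * g x = 2 * h x - g x" for x
      using nz[of x] by (simp add: r_def h_def field_simps)
    have "resolvent ?A 1 (J g) = J h" using Lp_resolvent(2)[OF zero_le_one g] by (simp add: h_def[abs_def])
    moreover have "2 *\<^sub>C J h = 2 *\<^sub>R J h" using scaleC_of_real[of 2 "J h"] by simp
    ultimately show ?thesis
      unfolding eq using Lp_diff[OF p J Lp_cmult[OF p J h, of 2] g] J_cmult[OF p J h, of 2]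
      by (simp add: C blinfun.diff_left blinfun.scaleR_left)
  qed
  show ?thesis
  proof (induction n)
    case (Suc n)
    then show ?case using step[of "\<lambda>x. r x ^ n * f x"] by (simp add: mult.assoc)
  qed (simp add: f)
qed

lemma cayley_decay_Lp_aux:
  assumes T: "C0_semigroup T" and gen: "generator T = A" and A: "A = Lp_mult_op \<mu> p J \<phi>"
    and a: "\<alpha> > 0" and decay: "(\<lambda>t. norm (T t o\<^sub>L neg_inv_powr A \<alpha>)) \<in> O(\<lambda>t. 1 / t)"
  shows "(\<lambda>n. norm (blinfun_power (cayley A) n o\<^sub>L neg_inv_powr A (\<alpha> + 2))) \<in> O(\<lambda>n. 1 / real n)"
proof -
  define M where "M = neg_inv_powr A \<alpha>"
  define r where "r x = (1 + \<phi> x) / (1 - \<phi> x)" for x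
  have gen': "generator T = Lp_mult_op \<mu> p J \<phi>" using gen A by simp
  \<comment> \<open>Single-valuedness is inherited from the generator, where limits are
    unique.\<close>
  have sv: "y = y'" if "(x, y) \<in> Lp_mult_op \<mu> p J \<phi>" "(x, y') \<in> Lp_mult_op \<mu> p J \<phi>" for x y y'
    using generator_single_valued[OF T] that gen' by blast
  have B: "(\<lambda>x. 1 / (0 - \<phi> x) * f x) \<in> Lp_functions \<mu> p \<and> resolvent A 0 (J f) = J (\<lambda>x. 1 / (0 - \<phi> x) * f x)"
    if f: "f \<in> Lp_functions \<mu> p" for f
  proof -
    have "cmod (1 / (0 - \<phi> x)) \<le> 1 / d" for x using d d(2)[of x] by (simp add: norm_divide frac_le)
    then have "(\<lambda>x. 1 / (0 - \<phi> x) * f x) \<in> Lp_functions \<mu> p"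
      using d(1) by (intro Lp_bounded_mult(1)[OF p J f, where b = "1 / d"]) auto
    then show ?thesis using Lp_resolvent(2)[of 0, OF _ f] by (simp add: A)
  qed
  have Cn: "(\<lambda>x. r x ^ n * f x) \<in> Lp_functions \<mu> p \<and>
      blinfun_power (cayley A) n (J f) = J (\<lambda>x. r x ^ n * f x)"
    if "f \<in> Lp_functions \<mu> p" for n f
    unfolding A r_def by (rule Lp_cayley_power[OF that sv])
  obtain c t\<^sub>0 where c: "c > 0" and t\<^sub>0: "t\<^sub>0 > 0" and dec: "\<And>t. t \<ge> t\<^sub>0 \<Longrightarrow> norm (T t o\<^sub>L M) \<le> c / t"
    using bigo_one_over_realD[OF decay norm_ge_zero] by (auto simp: M_def)
  \<comment> \<open>The factor \<open>2\<close> is the oscillation of \<open>Re \<phi>\<close> on a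
    piece, and \<open>(1 + 1 / d)^2\<close> comes from \<open>norm_cayley_power\<close>.\<close>
  define k where "k = 2 * (exp 1 * c + norm M * t\<^sub>0) * (1 + 1 / d)\<^sup>2"
  have k0: "k \<ge> 0" using c t\<^sub>0 by (simp add: k_def)

  text \<open>On each piece \<open>Re \<phi>\<close> is constant up to a factor \<open>2\<close>, and \<open>\<phi>\<close> is bounded.\<close>
  define X where "X i = {x \<in> space \<mu>. \<lfloor>log 2 (- Re (\<phi> x))\<rfloor> = fst i \<and> \<lfloor>cmod (\<phi> x)\<rfloor> = snd i}"
    for i :: "int \<times> int"
  have X: "X i \<in> sets \<mu>" for i unfolding X_def by measurable
  have disj: "disjoint_family X" by (auto simp: disjoint_family_on_def X_def prod_eq_iff)
  have un: "(\<Union>i. X i) = space \<mu>" by (auto simp: X_def)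
  have ind[measurable]: "(\<lambda>x. indicator (X i) x :: complex) \<in> borel_measurable \<mu>" for i
    using X by simp
  have ind_le: "cmod (indicator (X i) x) \<le> 1" for i x by (auto split: split_indicator)
  have PLp: "(\<lambda>x. indicator (X i) x * f x) \<in> Lp_functions \<mu> p" if "f \<in> Lp_functions \<mu> p" for i f
    by (rule Lp_bounded_mult(1)[OF p J that ind ind_le]) simp
  \<comment> \<open>Restriction to a piece is a multiplication operator, so it commutes with the
    resolvents and hence with \<open>M\<close>; the decay estimate can then be used piece by
    piece.\<close>
  have commM: "M (J (\<lambda>x. indicator (X i) x * f x)) = J (\<lambda>x. indicator (X i) x * g x)"
    if f: "f \<in> Lp_functions \<mu> p" and g: "g \<in> Lp_functions \<mu> p" and Mf: "M (J f) = J g" for i f g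
  proof -
    obtain P where P: "\<And>f. f \<in> Lp_functions \<mu> p \<Longrightarrow> blinfun_apply P (J f) = J (\<lambda>x. indicator (X i) x * f x)"
      using Lp_multiplication[OF p J ind ind_le zero_le_one] by blast
    have "P (M x) = M (P x)" for x
      unfolding M_def
    proof (rule neg_inv_powr_commute)
      fix s :: real and x assume s: "s \<ge> 0"
      obtain f where f: "f \<in> Lp_functions \<mu> p" "x = J f" by (rule J_surj[OF p J])
      let ?\<psi> = "\<lambda>x. 1 / (complex_of_real s - \<phi> x)"
      have "(\<lambda>x. ?\<psi> x * f x) \<in> Lp_functions \<mu> p"
        using d(1) norm_resolvent_symbol[OF s] by (intro Lp_bounded_mult(1)[OF p J f(1), where b = "1 / d"]) auto
      then show "P (resolvent A (complex_of_real s) x) = resolvent A (complex_of_real s) (P x)"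
        by (simp only: A f(2) Lp_resolvent(2)[OF s f(1)] P f(1) Lp_resolvent(2)[OF s PLp[OF f(1)]]
            mult.left_commute)
    qed
    then show ?thesis using P[OF f] P[OF g] Mf by metis
  qed
  have piece: "norm (J (\<lambda>x. indicator (X i) x * (r x ^ n * (1 / (0 - \<phi> x) * (1 / (0 - \<phi> x) * g x)))))
      \<le> k / real n * norm (J (\<lambda>x. indicator (X i) x * f x))"
    if n: "n > 0" and f: "f \<in> Lp_functions \<mu> p" and g: "g \<in> Lp_functions \<mu> p" and Mf: "M (J f) = J g"
    for n i f g
  proof -
    have [measurable]: "g \<in> borel_measurable \<mu>" by (rule Lp_measurable[OF g])
    define w where "w = 2 powr real_of_int (fst i)"
    have w: "w > 0" by (simp add: w_def)
    have Xi: "w \<le> - Re (\<phi> x)" "- Re (\<phi> x) \<le> 2 * w" "cmod (\<phi> x) \<le> real_of_int (snd i) + 1"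
      if "x \<in> X i" for x
    proof -
      have pos: "- Re (\<phi> x) > 0" using Re[of x] by simp
      have fl: "\<lfloor>log 2 (- Re (\<phi> x))\<rfloor> = fst i" "\<lfloor>cmod (\<phi> x)\<rfloor> = snd i"
        using that by (auto simp: X_def)
      have l: "real_of_int (fst i) \<le> log 2 (- Re (\<phi> x))" "log 2 (- Re (\<phi> x)) < real_of_int (fst i) + 1"
        using fl(1) by (simp_all add: floor_eq_iff)
      show "w \<le> - Re (\<phi> x)" unfolding w_def using l(1) pos by (simp add: le_log_iff)
      have "- Re (\<phi> x) < 2 powr (real_of_int (fst i) + 1)" using l(2) pos by (simp add: log_less_iff)
      then show "- Re (\<phi> x) \<le> 2 * w" by (simp add: w_def powr_add)
      show "cmod (\<phi> x) \<le> real_of_int (snd i) + 1" using fl(2) by linarith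
    qed
    define h where "h x = indicator (X i) x * g x" for x
    define f' where "f' x = indicator (X i) x * f x" for x
    have [measurable]: "h \<in> borel_measurable \<mu>" unfolding h_def by measurable
    have h: "h \<in> Lp_functions \<mu> p" unfolding h_def by (rule PLp[OF g])
    have Mh: "M (J f') = J h" unfolding h_def f'_def by (rule commM[OF f g Mf])
    have hX: "x \<in> X i" if "h x \<noteq> 0" for x using that by (auto simp: h_def split: split_indicator_asm)
    \<comment> \<open>The scalar lemma now acts on norms. With \<open>2 * w\<close> bounding
      \<open>- Re \<phi>\<close> from above on the piece, \<open>exp (t \<phi>)\<close> has modulus
      at least \<open>exp (- 2 t w)\<close> there.\<close>
    have "norm (J h) \<le> (exp 1 * (c * norm (J f')) + (norm M * norm (J f')) * t\<^sub>0) * (2 * w)"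
    proof (rule exp_decay_imp_linear_bound[OF _ _ _ _ t\<^sub>0])
      show "norm (J h) \<le> norm M * norm (J f')" unfolding Mh[symmetric] by (rule norm_blinfun)
      fix t assume t: "t\<^sub>0 \<le> t"
      then have t': "t \<ge> 0" using t\<^sub>0 by simp
      let ?e = "\<lambda>x. exp (complex_of_real t * \<phi> x) * h x"
      have e: "?e \<in> Lp_functions \<mu> p"
      proof (rule Lp_dominated(1)[OF p J h, where b = 1])
        show "cmod (?e x) \<le> 1 * cmod (h x)" for x
          using mult_nonneg_nonpos[OF t', of "Re (\<phi> x)"] Re[of x] by (simp add: norm_mult mult_left_le_one_le)
      qed auto
      have "norm (J h) \<le> exp (t * (2 * w)) * norm (J ?e)"
      proof (rule Lp_dominated(2)[OF p J e])
        fix x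
        show "cmod (h x) \<le> exp (t * (2 * w)) * cmod (?e x)"
        proof (cases "h x = 0")
          case False
          have "0 \<le> t * (2 * w + Re (\<phi> x))" using Xi(2)[OF hX[OF False]] t' by (intro mult_nonneg_nonneg) auto
          then have "1 \<le> exp (t * (2 * w)) * exp (t * Re (\<phi> x))"
            by (simp add: exp_add[symmetric] distrib_left)
          from mult_right_mono[OF this norm_ge_zero[of "h x"]]
          show ?thesis by (simp add: norm_mult mult.assoc)
        qed simp
      qed auto
      \<comment> \<open>The pieces also bound \<open>\<phi>\<close>, as the explicit form of the
        semigroup requires.\<close>
      also have "J ?e = T t (J h)"
        by (rule Lp_semigroup_apply[OF p J T gen' t' \<phi> Re h Xi(3)[OF hX], symmetric])
      also have "norm (T t (J h)) \<le> c / t * norm (J f')"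
        using norm_blinfun_le[OF dec[OF t], of "J f'"] by (simp add: Mh)
      finally have "norm (J h) \<le> exp (t * (2 * w)) * (c / t * norm (J f'))" by simp
      then have "exp (- (t * (2 * w))) * norm (J h) \<le> exp (- (t * (2 * w))) * (exp (t * (2 * w)) * (c / t * norm (J f')))"
        by (rule mult_left_mono) simp
      also have "\<dots> = c * norm (J f') / t" by (simp add: mult.assoc[symmetric] exp_add[symmetric])
      finally show "exp (- (t * (2 * w))) * norm (J h) \<le> c * norm (J f') / t" .
    qed (use w c in auto)
    then have Jh: "norm (J h) \<le> 2 * (exp 1 * c + norm M * t\<^sub>0) * w * norm (J f')"
      by (simp add: algebra_simps)
    \<comment> \<open>Here the lower bound \<open>w\<close> for \<open>- Re \<phi>\<close> enters;
      the resulting \<open>1 / w\<close> cancels the \<open>w\<close> gained from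
      \<open>M\<close>.\<close>
    have "norm (J (\<lambda>x. indicator (X i) x * (r x ^ n * (1 / (0 - \<phi> x) * (1 / (0 - \<phi> x) * g x)))))
        \<le> (1 + 1 / d)\<^sup>2 / (real n * w) * norm (J h)"
    proof (rule Lp_dominated(2)[OF p J h])
      show "(\<lambda>x. indicator (X i) x * (r x ^ n * (1 / (0 - \<phi> x) * (1 / (0 - \<phi> x) * g x)))) \<in> borel_measurable \<mu>"
        unfolding r_def by measurable
      show "0 \<le> (1 + 1 / d)\<^sup>2 / (real n * w)" using w by simp
      fix x
      show "cmod (indicator (X i) x * (r x ^ n * (1 / (0 - \<phi> x) * (1 / (0 - \<phi> x) * g x))))
          \<le> (1 + 1 / d)\<^sup>2 / (real n * w) * cmod (h x)"
      proof (cases "x \<in> X i")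
        case True
        have \<phi>0: "cmod (\<phi> x) > 0" using d(1) d(2)[of x] by linarith
        have "cmod (r x) ^ n * w \<le> cmod (r x) ^ n * (- Re (\<phi> x))"
          using Xi(1)[OF True] by (intro mult_left_mono) auto
        also have "\<dots> \<le> (1 + 1 / d)\<^sup>2 * (cmod (\<phi> x))\<^sup>2 / real n"
          unfolding r_def by (rule norm_cayley_power[OF Re d n])
        finally have "cmod (r x) ^ n / (cmod (\<phi> x))\<^sup>2 \<le> q / (real n * w)" if "q = (1 + 1 / d)\<^sup>2" for q
          unfolding that[symmetric] using \<phi>0 w n by (simp add: divide_simps mult_ac)
        then have "cmod (r x) ^ n / (cmod (\<phi> x))\<^sup>2 \<le> (1 + 1 / d)\<^sup>2 / (real n * w)" by blast
        from mult_right_mono[OF this norm_ge_zero[of "g x"]]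
        show ?thesis using True
          by (simp add: h_def norm_mult norm_divide norm_power power2_eq_square)
      qed (simp add: h_def)
    qed
    also have "\<dots> \<le> (1 + 1 / d)\<^sup>2 / (real n * w) * (2 * (exp 1 * c + norm M * t\<^sub>0) * w * norm (J f'))"
      by (rule mult_left_mono[OF Jh]) (use w in simp)
    also have "\<dots> = k / real n * norm (J f')" using w by (simp add: k_def)
    finally show ?thesis by (simp add: f'_def[abs_def])
  qed
  have final: "norm (blinfun_power (cayley A) n o\<^sub>L neg_inv_powr A (\<alpha> + 2)) \<le> k / real n" if n: "n > 0" for n
  proof (rule norm_blinfun_bound)
    fix x
    obtain f where f: "f \<in> Lp_functions \<mu> p" "x = J f" by (rule J_surj[OF p J])
    obtain g where g: "g \<in> Lp_functions \<mu> p" "M (J f) = J g" by (rule J_surj[OF p J])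
    note B1 = B[OF g(1)] note B2 = B[OF conjunct1[OF B1]]
    note C = Cn[OF conjunct1[OF B2], of n]
    have "(blinfun_power (cayley A) n o\<^sub>L neg_inv_powr A (\<alpha> + 2)) x
        = J (\<lambda>x. r x ^ n * (1 / (0 - \<phi> x) * (1 / (0 - \<phi> x) * g x)))"
      using a B1 B2 C by (simp add: neg_inv_powr_add_2 M_def[symmetric] f(2) g(2))
    also have "norm \<dots> \<le> k / real n * norm (J f)"
      by (rule Lp_countable_partition_bound[OF p J f(1) _ _ X disj un piece[OF n f(1) g]])
        (use C k0 in auto)
    finally show "norm ((blinfun_power (cayley A) n o\<^sub>L neg_inv_powr A (\<alpha> + 2)) x) \<le> k / real n * norm x"
      by (simp add: f(2))
  qed (use k0 in simp)
  show ?thesis by (rule bigo_one_over_natI[where c = k]) (use final in simp)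
qed

end

lemma cayley_decay_Lp:
  fixes \<mu> :: "'w measure" and J :: "('w \<Rightarrow> complex) \<Rightarrow> 'x::complex_banach"
  assumes p: "1 \<le> p" and J: "is_Lp_space \<mu> p J"
    and \<phi>: "\<phi> \<in> borel_measurable \<mu>" and range: "essential_range \<mu> \<phi> \<subseteq> {z. Re z < 0}"
    and A: "A = Lp_mult_op \<mu> p J \<phi>" and T: "C0_semigroup T" and gen: "generator T = A"
    and a: "\<alpha> > 0" and decay: "(\<lambda>t. norm (T t o\<^sub>L neg_inv_powr A \<alpha>)) \<in> O(\<lambda>t. 1 / t)"
  shows "(\<lambda>n. norm (blinfun_power (cayley A) n o\<^sub>L neg_inv_powr A (\<alpha> + 2))) \<in> O(\<lambda>n. 1 / real n)"
proof -
  obtain d where d: "d > 0" and ae: "AE x in \<mu>. Re (\<phi> x) < 0 \<and> d \<le> cmod (\<phi> x)"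
    using AE_essential_range[OF \<phi> range] by blast
  \<comment> \<open>On the exceptional null set any value with negative real part and modulus at
    least \<open>d\<close> will do; \<open>- d\<close> is one.\<close>
  define \<phi>' where "\<phi>' x = (if Re (\<phi> x) < 0 \<and> d \<le> cmod (\<phi> x) then \<phi> x else - complex_of_real d)" for x
  have [measurable]: "\<phi> \<in> borel_measurable \<mu>" by fact
  have \<phi>': "\<phi>' \<in> borel_measurable \<mu>" unfolding \<phi>'_def by measurable
  have "AE x in \<mu>. \<phi> x = \<phi>' x" using ae by eventually_elim (simp add: \<phi>'_def)
  then have A': "A = Lp_mult_op \<mu> p J \<phi>'" using Lp_mult_op_cong_AE[OF p J \<phi> \<phi>'] A by simp
  have "Re (\<phi>' x) < 0" "d \<le> cmod (\<phi>' x)" for x using d by (auto simp: \<phi>'_def)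
  from cayley_decay_Lp_aux[OF p J \<phi>' this(1) d this(2) T gen A' a decay] show ?thesis .
qed

section \<open>The three cases together\<close>

theorem proposition4p5:
  shows
   "(\<forall>(T :: real \<Rightarrow> 'h::complex_hilbert \<Rightarrow>\<^sub>L 'h) A \<alpha>.
       C0_semigroup T \<and> uniformly_bounded T \<and> A = generator T \<and>
       (\<forall>\<eta>::real. \<i> * complex_of_real \<eta> \<in> resolvent_set A) \<and> normal_op A \<and>
       \<alpha> > 0 \<and> (\<lambda>t. norm (T t o\<^sub>L neg_inv_powr A \<alpha>)) \<in> O(\<lambda>t. 1 / t)
       \<longrightarrow> (\<lambda>n. norm (blinfun_power (cayley A) n o\<^sub>L neg_inv_powr A (\<alpha> + 2))) \<in> O(\<lambda>n. 1 / real n))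
    \<and>
    (\<forall>(\<mu> :: 'w::t2_space measure) (p::real) (J :: ('w \<Rightarrow> complex) \<Rightarrow> 'x::complex_banach)
        \<phi> T A \<alpha>.
       locally_compact_space (euclidean :: 'w topology) \<and>
       sigma_finite_measure \<mu> \<and> regular_borel_measure \<mu> \<and>
       1 \<le> p \<and> is_Lp_space \<mu> p J \<and>
       \<phi> \<in> borel_measurable \<mu> \<and> essential_range \<mu> \<phi> \<subseteq> {z. Re z < 0} \<and>
       A = Lp_mult_op \<mu> p J \<phi> \<and> C0_semigroup T \<and> generator T = A \<and>
       \<alpha> > 0 \<and> (\<lambda>t. norm (T t o\<^sub>L neg_inv_powr A \<alpha>)) \<in> O(\<lambda>t. 1 / t)
       \<longrightarrow> (\<lambda>n. norm (blinfun_power (cayley A) n o\<^sub>L neg_inv_powr A (\<alpha> + 2))) \<in> O(\<lambda>n. 1 / real n))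
    \<and>
    (\<forall>(\<phi> :: 'v::t2_space \<Rightarrow> complex) (T :: real \<Rightarrow> 'v c0 \<Rightarrow>\<^sub>L 'v c0) A \<alpha>.
       locally_compact_space (euclidean :: 'v topology) \<and>
       continuous_on UNIV \<phi> \<and> closure (range \<phi>) \<subseteq> {z. Re z < 0} \<and>
       A = C0_mult_op \<phi> \<and> C0_semigroup T \<and> generator T = A \<and>
       \<alpha> > 0 \<and> (\<lambda>t. norm (T t o\<^sub>L neg_inv_powr A \<alpha>)) \<in> O(\<lambda>t. 1 / t)
       \<longrightarrow> (\<lambda>n. norm (blinfun_power (cayley A) n o\<^sub>L neg_inv_powr A (\<alpha> + 2))) \<in> O(\<lambda>n. 1 / real n))"
proof (intro conjI allI impI, goal_cases)
  case (1 T A \<alpha>)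
  \<comment> \<open>Take \<open>\<eta> = 0\<close> on the imaginary axis.\<close>
  moreover have "0 \<in> resolvent_set A"
    using 1 by (metis mult_zero_right of_real_0)
  ultimately show ?case using cayley_decay_hilbert[of T A \<alpha>] by blast
next
  case (2 \<mu> p J \<phi> T A \<alpha>)
  then show ?case using cayley_decay_Lp[of p \<mu> J \<phi> A T \<alpha>] by blast
next
  case (3 \<phi> T A \<alpha>)
  then show ?case using cayley_decay_C0[of \<phi> T A \<alpha>] by blast
qed

end
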